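(* Let $\Phi$ be the mapping that attributes to each prenormalized germ $f$ from the model formal class its $1$-conjugacy class, $\Phi(f)=[f]_1$. Let $[f]_0$ denote any analytic class of such germs. Then the restriction $\Phi|_{[f]_0}$ maps surjectively from $[f]_0$ onto the set of all $1$-conjugacy classes.
   Context: Prenormalized germs from the model formal class are the analytic germs $f(z)=z+z^2+z^3+o(z^3)$ at $0\in\mathbb{C}$, i.e. those formally conjugated, by changes of variables tangent to the identity, to $f_0(z)=\frac{z}{1-z}$. The analytic class $[f]_0$ is the set of germs $g=\varphi^{-1}\circ f\circ\varphi$ with $\varphi\in z+z^2\mathbb{C}\{z\}$. Let $V_+$ be the attracting petal (around the negative real direction, tangent at $0$ to the positive real direction) and $V_-$ the repelling petal (around the positive real direction, tangent at $0$ to the negative real direction) of $f$, and $V^{up}=\{z\in V_+\cap V_-: \mathrm{Im}\,z>0\}$, $V^{low}=\{z\in V_+\cap V_-:\mathrm{Im}\,z<0\}$. Let $\Psi_+$ be the sectorial trivialization on $V_+$: the analytic solution, unique up to an additive constant, of $\Psi(f(z))-\Psi(z)=1$ on $V_+$ with asymptotic expansion in $-\frac1z+\mathbb{C}[[z]]$. $1$-moment: the $1$-Abel equation $H(f(z))-H(z)=-z$ has sectorial solutions of the form $H_\pm=-\log z+R_\pm$ on $V_\pm$, where $R_\pm$ are the analytic solutions on $V_\pm$, unique up to additive constants, of $$R(f(z))-R(z)=-z+\log\frac{f(z)}{z}$$ with a common (up to constants) asymptotic expansion in $\mathbb{C}[[z]]$ as $z\to0$. There are analytic germs $g_\infty,g_0$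 at $t=0$ such that $$R_+(z)-R_-(z)=g_\infty\big(e^{2\pi i\Psi_+(z)}\big),\ z\in V^{up},\qquad R_-(z)-R_+(z)=g_0\big(e^{-2\pi i\Psi_+(z)}\big),\ z\in V^{low},$$ and $g_\infty(0)+g_0(0)=0$. The $1$-moment of $f$ is the pair $(g_\infty,g_0)$ up to the identification of $(g_\infty^1,g_0^1)$ with $(g_\infty^2,g_0^2)$ when $g_\infty^1(t)=g_\infty^2(bt)+a$ and $g_0^1(t)=g_0^2(t/b)-a$ for some $a\in\mathbb{C}$, $b\in\mathbb{C}^*$ (reflecting the free additive constants in $\Psi_+$, $R_+$, $R_-$). Two germs from the model formal class are $1$-conjugate if they have the same $1$-moment; $[f]_1$ is the equivalence class of $f$. *)

theory Defs
  imports "HOL-Analysis.Analysis" "HOL-Library.Landau_Symbols"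
begin

(* Analytic germs at 0 are represented by their Taylor series, i.e. by the elements of C{z}:
   power series with positive radius of convergence. *)

definition analytic_germ :: "complex fps \<Rightarrow> bool" where
  "analytic_germ F \<longleftrightarrow> fps_conv_radius F > 0"

definition prenormalized :: "complex fps set" where
  "prenormalized = {f. analytic_germ f \<and>
     fps_nth f 0 = 0 \<and> fps_nth f 1 = 1 \<and> fps_nth f 2 = 1 \<and> fps_nth f 3 = 1}"

definition tangent_to_identity :: "complex fps \<Rightarrow> bool" where
  "tangent_to_identity \<phi> \<longleftrightarrow> analytic_germ \<phi> \<and> fps_nth \<phi> 0 = 0 \<and> fps_nth \<phi> 1 = 1"

definition analytic_class :: "complex fps \<Rightarrow> complex fps set" where
  "analytic_class f = {fps_inv \<phi> oo (f oo \<phi>) | \<phi>. tangent_to_identity \<phi>}"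

(* The direction is given by a unit complex number d; below d = -1 or d = 1. *)

definition sector :: "complex \<Rightarrow> real \<Rightarrow> complex set" where
  "sector d \<beta> = {z. z \<noteq> 0 \<and> \<bar>Arg (z / d)\<bar> < \<beta>}"

(* Attracting petal of the germ F around the direction d. The last clause expresses the opening
   2 pi: at 0 the boundary of V is tangent to the direction -d. Petals are not required to be
   maximal, so they may be shrunk near the direction -d and away from 0. *)

definition petal :: "complex fps \<Rightarrow> complex \<Rightarrow> complex set \<Rightarrow> bool" where
  "petal F d V \<longleftrightarrow>
     open V \<and> connected V \<and> 0 \<notin> V \<and> V \<subseteq> eball 0 (fps_conv_radius F) \<and>
     eval_fps F ` V \<subseteq> V \<and>
     (\<forall>z\<in>V. (\<lambda>n. (eval_fps F ^^ n) z) \<longlonglongrightarrow> 0) \<and>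
     (\<forall>\<beta>. 0 < \<beta> \<and> \<beta> < pi \<longrightarrow> (\<exists>r>0. sector d \<beta> \<inter> ball 0 r \<subseteq> V))"

definition attracting_petal :: "complex fps \<Rightarrow> complex set \<Rightarrow> bool" where
  "attracting_petal f V \<longleftrightarrow> petal f (-1) V"

definition repelling_petal :: "complex fps \<Rightarrow> complex set \<Rightarrow> bool" where
  "repelling_petal f V \<longleftrightarrow> petal (fps_inv f) 1 V \<and> V \<subseteq> eball 0 (fps_conv_radius f)"

(* Poincare asymptotics at 0 on a petal around the direction d, uniform on proper subsectors. *)

definition has_asymp_expansion ::
    "(complex \<Rightarrow> complex) \<Rightarrow> complex \<Rightarrow> complex fps \<Rightarrow> bool" where
  "has_asymp_expansion F d A \<longleftrightarrow>
     (\<forall>\<beta>. 0 < \<beta> \<and> \<beta> < pi \<longrightarrow>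
       (\<forall>n. (\<lambda>z. F z - (\<Sum>k<n. fps_nth A k * z ^ k)) \<in> O[at 0 within sector d \<beta>](\<lambda>z. z ^ n)))"

definition sectorial_trivialization ::
    "complex fps \<Rightarrow> complex set \<Rightarrow> (complex \<Rightarrow> complex) \<Rightarrow> bool" where
  "sectorial_trivialization f V \<Psi> \<longleftrightarrow>
     \<Psi> holomorphic_on V \<and>
     (\<forall>z\<in>V. \<Psi> (eval_fps f z) - \<Psi> z = 1) \<and>
     (\<exists>A. has_asymp_expansion (\<lambda>z. \<Psi> z + 1 / z) (-1) A)"

(* R is the regular part of a sectorial solution H = - log z + R of H(f(z)) - H(z) = - z.
   A repelling petal is not forward invariant, hence the restriction to f(z) in V. *)

definition abel1_regular_part ::
    "complex fps \<Rightarrow> complex \<Rightarrow> complex set \<Rightarrow> (complex \<Rightarrow> complex) \<Rightarrow> complex fps \<Rightarrow> bool" where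
  "abel1_regular_part f d V R A \<longleftrightarrow>
     R holomorphic_on V \<and>
     (\<forall>z\<in>V. eval_fps f z \<in> V \<longrightarrow> R (eval_fps f z) - R z = - z + Ln (eval_fps f z / z)) \<and>
     has_asymp_expansion R d A"

(* The pair is a pair of germs: the petals may be chosen small enough for exp (2 pi i Psi) and
   exp (- 2 pi i Psi) to stay in the discs of convergence of the two series. *)

definition moment_pair :: "complex fps \<Rightarrow> complex fps \<times> complex fps \<Rightarrow> bool" where
  "moment_pair f = (\<lambda>(ginf, g0).
     analytic_germ ginf \<and> analytic_germ g0 \<and> fps_nth ginf 0 + fps_nth g0 0 = 0 \<and>
     (\<exists>Vp Vm \<Psi> Rp Rm Ap Am.
        attracting_petal f Vp \<and> repelling_petal f Vm \<and>
        sectorial_trivialization f Vp \<Psi> \<and>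
        abel1_regular_part f (-1) Vp Rp Ap \<and> abel1_regular_part f 1 Vm Rm Am \<and>
        (\<exists>c. Ap - Am = fps_const c) \<and>
        (\<forall>z \<in> Vp \<inter> Vm. Im z > 0 \<longrightarrow>
           exp (2 * of_real pi * \<i> * \<Psi> z) \<in> eball 0 (fps_conv_radius ginf) \<and>
           Rp z - Rm z = eval_fps ginf (exp (2 * of_real pi * \<i> * \<Psi> z))) \<and>
        (\<forall>z \<in> Vp \<inter> Vm. Im z < 0 \<longrightarrow>
           exp (- (2 * of_real pi * \<i> * \<Psi> z)) \<in> eball 0 (fps_conv_radius g0) \<and>
           Rm z - Rp z = eval_fps g0 (exp (- (2 * of_real pi * \<i> * \<Psi> z))))))"

definition moment_rel :: "((complex fps \<times> complex fps) \<times> (complex fps \<times> complex fps)) set" where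
  "moment_rel = {((g1, h1), (g2, h2)). \<exists>a b. b \<noteq> 0 \<and>
     g1 = (g2 oo (fps_const b * fps_X)) + fps_const a \<and>
     h1 = (h2 oo (fps_const (1 / b) * fps_X)) - fps_const a}"

(* The 1-moment: the class modulo moment_rel formed by the pairs of f. *)

definition one_moment :: "complex fps \<Rightarrow> (complex fps \<times> complex fps) set" where
  "one_moment f = moment_rel `` {p. moment_pair f p}"

definition one_conjugacy :: "(complex fps \<times> complex fps) set" where
  "one_conjugacy =
     {(f, h). f \<in> prenormalized \<and> h \<in> prenormalized \<and> one_moment f = one_moment h}"

definition one_conjugacy_class :: "complex fps \<Rightarrow> complex fps set" where
  "one_conjugacy_class f = one_conjugacy `` {f}"

end

theory Submission
  imports Defs "HOL-Complex_Analysis.Complex_Analysis"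
begin

text \<open>
  In the coordinate \<open>w = - 1 / z\<close> a prenormalized germ becomes \<open>F w = w + 1 + O(1 / w\<^sup>2)\<close>. The sectorial
  functions \<open>\<Psi>\<close>, \<open>R\<^sub>+\<close> and \<open>R\<^sub>-\<close> are then given by sums over forward or backward orbits, and
  \<open>R\<^sub>+ - R\<^sub>-\<close> is minus the sum of the right-hand side of the cohomological equation over the full orbit.

  To realize a prescribed pair of germs, put \<open>G = g\<^sub>\<infinity> \<circ> exp (2 \<pi> \<i> \<Psi>)\<close> and form the Cauchy integrals
  of \<open>G\<close> along two vertical lines of the Fatou coordinate (Cauchy-Heine). They differ by \<open>G\<close> between the
  lines, and since \<open>G\<close> is invariant their coboundaries under \<open>F\<close> glue to one function \<open>\<delta>\<close> that is
  holomorphic at infinity. The equation with right-hand side \<open>\<delta>\<close> has the jump \<open>G\<close> in the upper half-plane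
  and none in the lower one; complex conjugation exchanges the two half-planes.

  Finally \<open>\<psi> = log (f / z) - \<delta>\<close> is tangent to the identity, and conjugating \<open>f\<close> by \<open>\<psi>\<close> turns the equation
  with right-hand side \<open>\<delta>\<close> into the 1-Abel equation of the new germ, up to a coboundary that does not
  affect the jump. So the whole freedom of the 1-moment is already visible inside one analytic class.
\<close>

text \<open>Each 1-moment contains a pair of germs that both vanish at 0, the one given by orbit
  sums; so such pairs are the general target. Germs are compared along the imaginary axis only: it
  meets both half-planes, and there the relevant exponentials of the Fatou coordinate tend to 0. The
  obstacle is that the right-hand side of the 1-Abel equation contains the unknown germ. Pulled back
  by the conjugating map \<psi>, it becomes log (f / z) - \<psi> plus a coboundary. It is thus
  affine in \<psi>, and any \<delta> with the right jump over the fixed germ f determines \<psi>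
  explicitly. Cauchy integrals along two half-lines do not differ by a residue alone: the contour is
  open at the bottom. A horizontal segment closes it, and as it lies in a bounded region it does no
  harm near infinity. The lines have abscissas -1 and 1 because each has to be avoided together with
  its preimage one unit to the left, that is, with a band of width slightly more than 1. At distance
  2 the two bands are disjoint, so every point near infinity admits at least one of the two
  integrals.\<close>

section \<open>Dynamics near infinity\<close>

text \<open>The level sets of \<open>para\<close> are parabolas with focus \<open>0\<close> opening to the left. The regions
  \<open>para w > M\<close> are forward invariant and contain the ends of all sectors \<open>\<bar>Arg w\<bar> < \<beta>\<close> with \<open>\<beta> < pi\<close>,
  so they serve as petals of full opening.\<close>
definition para :: "complex \<Rightarrow> real" where
  "para w = cmod w + Re w"

lemma para_le: "para w \<le> 2 * cmod w"
  unfolding para_def using complex_Re_le_cmod[of w] by linarith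

lemma para_add_ge: "para w - 2 * cmod e \<le> para (w + e)"
proof -
  have "cmod w \<le> cmod (w + e) + cmod e"
    by (metis add_diff_cancel_right' norm_triangle_ineq4)
  moreover have "- cmod e \<le> Re e" using abs_Re_le_cmod[of e] by linarith
  ultimately show ?thesis by (simp add: para_def)
qed

text \<open>Multiply by the conjugate factor: the squared moduli differ by 2 Re w + 1. The gain of a
  unit step is thus of the size \<open>para w / cmod w\<close>, positive on the whole petal but
  small near its boundary, and all orbit estimates live on it.\<close>

lemma para_add_one:
  assumes "w \<noteq> 0"
  shows "para (w + 1) - para w = (para (w + 1) + para w) / (cmod (w + 1) + cmod w)"
proof -
  have sq: "(cmod (w + 1))\<^sup>2 - (cmod w)\<^sup>2 = 2 * Re w + 1"
    by (simp only: cmod_power2) (simp add: power2_eq_square algebra_simps)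
  have pos: "cmod (w + 1) + cmod w > 0" using assms by (simp add: add_nonneg_pos)
  have "(para (w + 1) - para w) * (cmod (w + 1) + cmod w) =
        (cmod (w + 1))\<^sup>2 - (cmod w)\<^sup>2 + cmod (w + 1) + cmod w"
    by (simp add: para_def power2_eq_square algebra_simps)
  also have "\<dots> = para (w + 1) + para w"
    unfolding sq by (simp add: para_def)
  finally show ?thesis using pos by (simp add: field_simps)
qed

text \<open>The error is O(1 / w^2), not merely O(1 / w); this is what the coefficients 1 in degrees
  2 and 3 of a prenormalized germ provide. Orbit sums of the error then converge without a
  logarithmic correction.\<close>

locale near_translation =
  fixes F :: "complex \<Rightarrow> complex" and C R :: real
  assumes C_nonneg: "C \<ge> 0" and R_ge_1: "R \<ge> 1"
    and holo: "F holomorphic_on {w. R < cmod w}"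
    and dist_le: "\<And>w. R < cmod w \<Longrightarrow> cmod (F w - w - 1) \<le> C / (cmod w)\<^sup>2"
begin

text \<open>Since \<open>para w \<le> 2 * cmod w\<close>, the term 2 R keeps the petal in the domain
  of F. The term 6 C makes the error of one step smaller than half of the gain of a unit
  translation, and 8 is slack.\<close>

definition height_bound :: real where "height_bound = 2 * R + 8 + 6 * C"

lemma height_bound_ge: "height_bound \<ge> 10" "height_bound \<ge> 6 * C" "height_bound \<ge> 2 * R + 8"
  using C_nonneg R_ge_1 by (auto simp: height_bound_def)

lemma height_bound_pos: "height_bound > 0" using height_bound_ge by linarith

lemma cmod_gt:
  assumes "para w > height_bound"
  shows "cmod w > R" "cmod w > 5" "cmod w \<ge> 3 * C" "w \<noteq> 0"
proof -
  have "2 * cmod w > 2 * R + 8 + 6 * C" using assms para_le[of w] by (simp add: height_bound_def)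
  then show "cmod w > R" "cmod w > 5" "cmod w \<ge> 3 * C" using C_nonneg R_ge_1 by auto
  then show "w \<noteq> 0" by auto
qed

lemma para_F:
  assumes "para w > height_bound"
  shows "para (F w) - para w \<ge> para w / (3 * cmod w)"
proof -
  note c = cmod_gt[OF assms]
  define e where "e = F w - w - 1"
  have Fw: "F w = (w + 1) + e" by (simp add: e_def)
  have e: "cmod e \<le> C / (cmod w)\<^sup>2" using dist_le[OF c(1)] by (simp add: e_def)
  have pw: "para w > 0" using assms height_bound_pos by linarith
  have pos: "cmod (w + 1) + cmod w > 0" using c by (simp add: add_nonneg_pos)
  have tri: "cmod (w + 1) \<le> cmod w + 1" using norm_triangle_ineq[of w 1] by simp
  have tri2: "cmod w \<le> cmod (w + 1) + 1" by (metis add_diff_cancel_right' norm_one norm_triangle_ineq4)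
  have p1: "para (w + 1) \<ge> para w" using tri2 by (simp add: para_def)
  have "2 * para w / (3 * cmod w) \<le> 2 * para w / (cmod (w + 1) + cmod w)"
    using pw pos tri c by (intro divide_left_mono mult_pos_pos) auto
  also have "\<dots> \<le> (para (w + 1) + para w) / (cmod (w + 1) + cmod w)"
    using pos p1 by (intro divide_right_mono) auto
  also have "\<dots> = para (w + 1) - para w" using para_add_one[OF c(4)] by simp
  finally have g: "2 * para w / (3 * cmod w) \<le> para (w + 1) - para w" .
  \<comment> \<open>The error may use up half of the gain 2 para w / (3 |w|); this is where 6 C
    \<le> para w enters.\<close>
  have "2 * cmod e \<le> 2 * (C / (cmod w)\<^sup>2)" using e by simp
  also have "\<dots> \<le> para w / (3 * cmod w)"
  proof -
    have "6 * C \<le> para w" using assms height_bound_ge(2) by linarith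
    also have "\<dots> \<le> para w * cmod w" using pw c by simp
    finally show ?thesis using c by (simp add: field_simps power2_eq_square)
  qed
  finally have "2 * cmod e \<le> para w / (3 * cmod w)" .
  moreover have "para (F w) \<ge> para (w + 1) - 2 * cmod e" unfolding Fw by (rule para_add_ge)
  moreover have "2 * para w / (3 * cmod w) = para w / (3 * cmod w) + para w / (3 * cmod w)" by simp
  ultimately show ?thesis using g by linarith
qed

lemma para_F_ge: "para w > height_bound \<Longrightarrow> para (F w) \<ge> para w"
  using para_F[of w] cmod_gt[of w] height_bound_pos
  by (smt (verit) divide_nonneg_nonneg norm_ge_zero)

lemma para_iter: "para w > height_bound \<Longrightarrow> para ((F ^^ n) w) \<ge> para w"
  by (induction n) (auto intro: order_trans para_F_ge[OF less_le_trans])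

text \<open>The telescoping right-hand side is what makes all orbit sums converge, uniformly on the petal.\<close>
lemma inverse_square_le:
  assumes "para w > height_bound"
  shows "1 / (cmod w)\<^sup>2 \<le> 18 * (1 / para w - 1 / para (F w))"
proof -
  note c = cmod_gt[OF assms]
  have pw: "para w > 0" using assms height_bound_pos by linarith
  have pF: "para (F w) \<ge> para w" using para_F_ge[OF assms] .
  have "cmod (F w) \<le> cmod (F w - w - 1) + cmod (w + 1)"
    by (metis add.commute diff_diff_eq diff_add_cancel norm_triangle_ineq)
  also have "cmod (F w - w - 1) \<le> 1"
  proof -
    have "C \<le> 1 * (cmod w)\<^sup>2"
    proof -
      have "C \<le> cmod w" using c(3) C_nonneg by linarith
      also have "\<dots> \<le> (cmod w)\<^sup>2" using c(2) by (intro self_le_power) auto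
      finally show ?thesis by simp
    qed
    then have "C / (cmod w)\<^sup>2 \<le> 1" using c by (simp add: divide_simps)
    then show ?thesis using dist_le[OF c(1)] by linarith
  qed
  also have "cmod (w + 1) \<le> cmod w + 1" using norm_triangle_ineq[of w 1] by simp
  finally have "cmod (F w) \<le> 3 * cmod w" using c by linarith
  then have pF2: "para (F w) \<le> 6 * cmod w" using para_le[of "F w"] by linarith
  \<comment> \<open>The constant is 18 = 3 * 6: the gain is at least para w / (3 |w|), and
    \<open>para (F w)\<close> is at most 6 |w|.\<close>
  have "1 / (18 * (cmod w)\<^sup>2) = (para w / (3 * cmod w)) / (para w * (6 * cmod w))"
    using c pw by (simp add: field_simps power2_eq_square)
  also have "\<dots> \<le> (para (F w) - para w) / (para w * para (F w))"
    using para_F[OF assms] pw pF pF2 c by (intro frac_le mult_left_mono mult_pos_pos) auto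
  also have "\<dots> = 1 / para w - 1 / para (F w)" using pw pF by (simp add: field_simps)
  finally show ?thesis using c by (simp add: field_simps)
qed

lemma sum_inverse_square_le:
  assumes "para w > height_bound"
  shows "(\<Sum>k<n. 1 / (cmod ((F ^^ k) w))\<^sup>2) \<le> 18 / para w"
proof -
  have "(\<Sum>k<n. 1 / (cmod ((F ^^ k) w))\<^sup>2)
      \<le> (\<Sum>k<n. 18 * (1 / para ((F ^^ k) w) - 1 / para ((F ^^ Suc k) w)))"
    using inverse_square_le[OF less_le_trans[OF assms para_iter[OF assms]]] by (intro sum_mono) auto
  also have "\<dots> = 18 * (1 / para w - 1 / para ((F ^^ n) w))"
    by (induction n) (auto simp: algebra_simps)
  also have "\<dots> \<le> 18 * (1 / para w)"
    using para_iter[OF assms, of n] assms height_bound_pos by simp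
  finally show ?thesis by simp
qed

text \<open>Each step differs from a unit translation by at most C over the squared modulus, and
  these errors add up to 18 C / para w \<le> 3 because para w > 6 C. All statements on where orbits
  go rest on this bounded displacement.\<close>

lemma iter_near:
  assumes "para w > height_bound"
  shows "cmod ((F ^^ n) w - w - of_nat n) \<le> 3"
proof -
  have le: "C / (cmod ((F ^^ k) w))\<^sup>2 \<ge> cmod ((F ^^ Suc k) w - (F ^^ k) w - 1)" for k
    using dist_le[OF cmod_gt(1)[OF less_le_trans[OF assms para_iter[OF assms]]]] by simp
  have "(F ^^ n) w - w - of_nat n = (\<Sum>k<n. (F ^^ Suc k) w - (F ^^ k) w - 1)"
    by (induction n) (auto simp: algebra_simps)
  also have "cmod \<dots> \<le> (\<Sum>k<n. C / (cmod ((F ^^ k) w))\<^sup>2)"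
    by (intro sum_norm_le le)
  also have "\<dots> = C * (\<Sum>k<n. 1 / (cmod ((F ^^ k) w))\<^sup>2)" by (simp add: sum_distrib_left)
  also have "\<dots> \<le> C * (18 / para w)"
    using sum_inverse_square_le[OF assms] C_nonneg by (intro mult_left_mono)
  also have "\<dots> \<le> 3" using assms height_bound_ge height_bound_pos by (simp add: field_simps)
  finally show ?thesis .
qed

lemma Re_iter_ge:
  assumes "para w > height_bound"
  shows "Re ((F ^^ n) w) \<ge> Re w + real n - 3"
  using iter_near[OF assms, of n] abs_Re_le_cmod[of "(F ^^ n) w - w - of_nat n"] by simp

lemma iter_at_infinity:
  assumes "para w > height_bound"
  shows "filterlim (\<lambda>n. (F ^^ n) w) at_infinity sequentially"
proof -
  have "filterlim (\<lambda>n. (Re w - 3) + real n) at_top sequentially"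
    by (intro filterlim_tendsto_add_at_top[OF tendsto_const] filterlim_real_sequentially)
  then have "filterlim (\<lambda>n. Re w + real n - 3) at_top sequentially" by (simp add: algebra_simps)
  then have "filterlim (\<lambda>n. cmod ((F ^^ n) w)) at_top sequentially"
    by (rule filterlim_at_top_mono)
       (auto intro!: always_eventually order_trans[OF Re_iter_ge[OF assms]] complex_Re_le_cmod)
  then show ?thesis by (rule filterlim_norm_at_top_imp_at_infinity)
qed

end


section \<open>Orbit sums and Fatou coordinates\<close>

definition orbit_sum :: "(complex \<Rightarrow> complex) \<Rightarrow> (complex \<Rightarrow> complex) \<Rightarrow>
    complex \<Rightarrow> complex" where
  "orbit_sum F D w = (\<Sum>n. D ((F ^^ n) w))"

text \<open>The partial sums telescope to F^n w - n, so this is the attracting Fatou coordinate,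
  normalized to be close to w deep inside the petal.\<close>

definition fatou :: "(complex \<Rightarrow> complex) \<Rightarrow> complex \<Rightarrow> complex" where
  "fatou F w = w + orbit_sum F (\<lambda>w. F w - w - 1) w"

text \<open>On a coboundary the orbit sum returns the potential up to its limit along the orbit.
  This serves twice: to evaluate the sums of \<delta>, and to identify arbitrary sectorial solutions
  with orbit sums.\<close>

lemma orbit_sum_telescope:
  assumes "\<And>n. D ((F ^^ n) w) = A ((F ^^ Suc n) w) - A ((F ^^ n) w)"
    and "(\<lambda>n. A ((F ^^ n) w)) \<longlonglongrightarrow> L"
  shows "orbit_sum F D w = L - A w"
proof -
  have "(\<lambda>n. A ((F ^^ Suc n) w) - A ((F ^^ n) w)) sums (L - A ((F ^^ 0) w))"
    using assms(2) by (rule telescope_sums)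
  then show ?thesis unfolding orbit_sum_def assms(1) by (simp add: sums_iff)
qed

lemma open_para: "open {w. para w > M}"
  unfolding para_def by (intro open_Collect_less continuous_intros)

context near_translation
begin

lemma para_iter_gt: "para w > height_bound \<Longrightarrow> para ((F ^^ n) w) > height_bound"
  using para_iter[of w n] by linarith

lemma holo_iter: "(F ^^ n) holomorphic_on {w. para w > height_bound}"
proof (induction n)
  case (Suc n)
  have "F holomorphic_on {w. para w > height_bound}"
    using cmod_gt(1) by (intro holomorphic_on_subset[OF holo]) auto
  moreover have "(F ^^ n) ` {w. para w > height_bound} \<subseteq> {w. para w > height_bound}"
    using para_iter_gt by auto
  ultimately have "F \<circ> (F ^^ n) holomorphic_on {w. para w > height_bound}"
    by (rule holomorphic_on_compose_gen[OF Suc.IH])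
  then show ?case by (simp add: comp_def)
qed auto

lemma cmod_iter_ge: "para w > height_bound \<Longrightarrow> cmod ((F ^^ n) w) \<ge> para w / 2"
  using para_iter[of w n] para_le[of "(F ^^ n) w"] by linarith

lemma summable_inverse_square:
  assumes "para w > height_bound"
  shows "summable (\<lambda>n. 1 / (cmod ((F ^^ n) w))\<^sup>2)" "(\<Sum>n. 1 / (cmod ((F ^^ n) w))\<^sup>2) \<le> 18
      / para w"
proof -
  show *: "summable (\<lambda>n. 1 / (cmod ((F ^^ n) w))\<^sup>2)"
    by (rule summableI_nonneg_bounded[OF _ sum_inverse_square_le[OF assms]]) simp
  show "(\<Sum>n. 1 / (cmod ((F ^^ n) w))\<^sup>2) \<le> 18 / para w"
    using sum_inverse_square_le[OF assms] by (intro suminf_le_const[OF *])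
qed

context
  fixes D :: "complex \<Rightarrow> complex" and K :: real
  assumes decay: "\<And>w. para w > height_bound \<Longrightarrow> cmod (D w) \<le> K / (cmod w)\<^sup>2"
begin

lemma K_nonneg: "K \<ge> 0"
proof -
  have *: "para (complex_of_real height_bound) > height_bound" using height_bound_pos by (simp add: para_def)
  have "0 \<le> K / (cmod (of_real height_bound))\<^sup>2" using decay[OF *] norm_ge_zero order_trans by blast
  then show ?thesis using height_bound_pos by (simp add: zero_le_divide_iff)
qed

lemma decay_iter: "para w > height_bound \<Longrightarrow>
    cmod (D ((F ^^ n) w)) \<le> K * (1 / (cmod ((F ^^ n) w))\<^sup>2)"
  using decay[OF para_iter_gt[of w n]] by simp

lemma summable_orbit_sum: "para w > height_bound \<Longrightarrow> summable (\<lambda>n. cmod (D ((F ^^ n) w)))"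
  by (rule summable_comparison_test'[OF summable_mult[OF summable_inverse_square(1)], of w 0 _ K])
     (simp_all only: real_norm_def abs_norm_cancel decay_iter)

lemma orbit_sum_sums: "para w > height_bound \<Longrightarrow> (\<lambda>n. D ((F ^^ n) w)) sums orbit_sum F D w"
  unfolding orbit_sum_def by (rule summable_sums[OF summable_norm_cancel[OF summable_orbit_sum]])

lemma orbit_sum_F:
  assumes "para w > height_bound"
  shows "orbit_sum F D (F w) = orbit_sum F D w - D w"
proof -
  have "(\<lambda>n. D ((F ^^ Suc n) w)) sums (orbit_sum F D w - D ((F ^^ 0) w))"
    using orbit_sum_sums[OF assms] by (subst sums_Suc_iff) simp
  then show ?thesis
    unfolding orbit_sum_def by (simp add: sums_iff funpow_swap1)
qed

lemma orbit_sum_le: "para w > height_bound \<Longrightarrow> cmod (orbit_sum F D w) \<le> 18 * K / para w"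
proof -
  assume w: "para w > height_bound"
  have "cmod (orbit_sum F D w) \<le> (\<Sum>n. cmod (D ((F ^^ n) w)))"
    unfolding orbit_sum_def by (rule summable_norm[OF summable_orbit_sum[OF w]])
  also have "\<dots> \<le> (\<Sum>n. K * (1 / (cmod ((F ^^ n) w))\<^sup>2))"
    by (intro suminf_le decay_iter w summable_orbit_sum summable_mult summable_inverse_square)
  also have "\<dots> = K * (\<Sum>n. 1 / (cmod ((F ^^ n) w))\<^sup>2)"
    by (rule suminf_mult[OF summable_inverse_square(1)[OF w]])
  also have "\<dots> \<le> K * (18 / para w)"
    by (intro mult_left_mono summable_inverse_square(2)[OF w] K_nonneg)
  finally show ?thesis by (simp add: mult.commute)
qed

lemma holo_orbit_sum:
  assumes D: "D holomorphic_on {w. para w > height_bound}"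
  shows "orbit_sum F D holomorphic_on {w. para w > height_bound}"
proof (rule holomorphic_uniform_sequence[OF open_para])
  show "(\<lambda>w. \<Sum>k<n. D ((F ^^ k) w)) holomorphic_on {w. para w > height_bound}" for n
    using para_iter_gt
    by (intro holomorphic_on_sum holomorphic_on_compose_gen[OF holo_iter D, unfolded comp_def]) auto
  fix x assume "x \<in> {w. para w > height_bound}"
  then obtain d where d: "d > 0" "cball x d \<subseteq> {w. para w > height_bound}"
    using open_para[of height_bound] open_contains_cball by meson
  \<comment> \<open>The bound 18 / para w controls the whole sum but gives no majorant term by term.
    The drift to the right does: on the disc the n-th iterate has modulus at least n - N.\<close>
  obtain N where N: "real N > \<bar>Re x\<bar> + d + 3 + 1" using reals_Archimedean2 by blast
  define M where "M = (\<lambda>n. K * (1 / (real n - real N)\<^sup>2))"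
  have "summable (\<lambda>n. 1 / (real n)\<^sup>2)" using inverse_power_summable[of 2] by (simp add: field_simps)
  then have "summable (\<lambda>n. K * (1 / (real (n + N) - real N)\<^sup>2))" by (intro summable_mult) simp
  then have M: "summable M" unfolding M_def by (subst (asm) summable_iff_shift) 
  have le: "cmod (D ((F ^^ n) w)) \<le> M n" if "w \<in> cball x d" "n > N" for w n
  proof -
    have w: "para w > height_bound" using that d by auto
    have "\<bar>Re w - Re x\<bar> \<le> d" using that abs_Re_le_cmod[of "w - x"] by (simp add: dist_norm norm_minus_commute)
    then have "Re ((F ^^ n) w) \<ge> real n - real N" using Re_iter_ge[OF w, of n] N by linarith
    then have "cmod ((F ^^ n) w) \<ge> real n - real N" using complex_Re_le_cmod order_trans by blast
    then have "1 / (cmod ((F ^^ n) w))\<^sup>2 \<le> 1 / (real n - real N)\<^sup>2"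
      using that by (intro divide_left_mono power_mono mult_pos_pos zero_less_power) auto
    then show ?thesis using decay_iter[OF w, of n] K_nonneg unfolding M_def
      by (meson mult_left_mono order_trans)
  qed
  have "uniform_limit (cball x d) (\<lambda>n w. \<Sum>k<n. D ((F ^^ k) w)) (orbit_sum F D) sequentially"
    unfolding orbit_sum_def using le
    by (intro Weierstrass_m_test_ev[OF _ M]) (auto intro!: eventually_sequentiallyI[of "Suc N"])
  then show "\<exists>d>0. cball x d \<subseteq> {w. para w > height_bound} \<and>
      uniform_limit (cball x d) (\<lambda>n w. \<Sum>k<n. D ((F ^^ k) w)) (orbit_sum F D) sequentially"
    using d by blast
qed

end

text \<open>Of the m + 2 powers of decay, m are replaced by powers of para w / 2, a lower bound for
  the modulus on the whole orbit, and the other two are summed. So each further order of vanishing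
  of the right-hand side is passed on to the solution, as asymptotic expansions require.\<close>

lemma orbit_sum_le_power:
  assumes decay: "\<And>w. para w > M \<Longrightarrow> cmod (D w) \<le> K / cmod w ^ (m + 2)" and M: "M \<ge> height_bound"
    and w: "para w > M"
  shows "cmod (orbit_sum F D w) \<le> 18 * (K * 2 ^ m) / para w ^ (m + 1)"
proof -
  have w': "para w > height_bound" using w M by linarith
  have pw: "para w > 0" using w' height_bound_pos by linarith
  have *: "para (complex_of_real (M + 1)) > M" using M height_bound_pos by (simp add: para_def)
  have "0 \<le> K / (cmod (of_real (M + 1))) ^ (m + 2)" using decay[OF *] norm_ge_zero order_trans by blast
  moreover have "cmod (complex_of_real (M + 1)) ^ (m + 2) > 0" using M height_bound_pos by (intro zero_less_power) auto
  ultimately have K: "K \<ge> 0" by (metis divide_less_0_iff linorder_not_le)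
  have le: "cmod (D ((F ^^ n) w)) \<le> (K * 2 ^ m / para w ^ m) * (1 / (cmod ((F ^^ n) w))\<^sup>2)" for n
  proof -
    have p: "para ((F ^^ n) w) > M" using para_iter[OF w', of n] w by linarith
    have c: "cmod ((F ^^ n) w) > 0" "cmod ((F ^^ n) w) \<ge> para w / 2"
      using cmod_iter_ge[OF w', of n] pw by auto
    have "cmod (D ((F ^^ n) w)) \<le> K / cmod ((F ^^ n) w) ^ (m + 2)" by (rule decay[OF p])
    also have "\<dots> = K * (1 / (cmod ((F ^^ n) w)) ^ m) * (1 / (cmod ((F ^^ n) w))\<^sup>2)"
      by (simp add: power_add power2_eq_square)
    also have "\<dots> \<le> K * (1 / (para w / 2) ^ m) * (1 / (cmod ((F ^^ n) w))\<^sup>2)"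
      using c pw K by (intro mult_right_mono mult_left_mono divide_left_mono power_mono mult_pos_pos) auto
    finally show ?thesis by (simp add: power_divide)
  qed
  note s = summable_mult[OF summable_inverse_square(1)[OF w']]
  have "summable (\<lambda>n. cmod (D ((F ^^ n) w)))"
    by (rule summable_comparison_test'[OF s, of 0 _ "K * 2 ^ m / para w ^ m"]) (use le in auto)
  then have "cmod (orbit_sum F D w) \<le> (\<Sum>n. cmod (D ((F ^^ n) w)))"
    unfolding orbit_sum_def by (rule summable_norm)
  also have "\<dots> \<le> (\<Sum>n. (K * 2 ^ m / para w ^ m) * (1 / (cmod ((F ^^ n) w))\<^sup>2))"
    by (intro suminf_le le \<open>summable (\<lambda>n. cmod (D ((F ^^ n) w)))\<close> s)
  also have "\<dots> = (K * 2 ^ m / para w ^ m) * (\<Sum>n. 1 / (cmod ((F ^^ n) w))\<^sup>2)"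
    by (rule suminf_mult[OF summable_inverse_square(1)[OF w']])
  also have "\<dots> \<le> (K * 2 ^ m / para w ^ m) * (18 / para w)"
    using K pw by (intro mult_left_mono summable_inverse_square(2)[OF w']) auto
  finally show ?thesis by (simp add: mult_ac)
qed

lemma decay_F: "para w > height_bound \<Longrightarrow> cmod (F w - w - 1) \<le> C / (cmod w)\<^sup>2"
  using dist_le[OF cmod_gt(1)] .

lemma fatou_F: "para w > height_bound \<Longrightarrow> fatou F (F w) = fatou F w + 1"
  unfolding fatou_def by (subst orbit_sum_F[OF decay_F]) (auto simp: algebra_simps)

lemma fatou_iter: "para w > height_bound \<Longrightarrow> fatou F ((F ^^ n) w) = fatou F w + of_nat n"
  by (induction n) (auto simp: fatou_F para_iter_gt)

lemma fatou_near: "para w > height_bound \<Longrightarrow> cmod (fatou F w - w) \<le> 18 * C / para w"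
  unfolding fatou_def using orbit_sum_le[OF decay_F, of w] by simp

lemma fatou_near3: "para w > height_bound \<Longrightarrow> cmod (fatou F w - w) \<le> 3"
proof -
  assume w: "para w > height_bound"
  then have "18 * C / para w \<le> 3" using height_bound_ge height_bound_pos by (simp add: field_simps)
  then show ?thesis using fatou_near[OF w] by linarith
qed

lemma holo_fatou: "fatou F holomorphic_on {w. para w > height_bound}"
proof -
  have "F holomorphic_on {w. para w > height_bound}"
    using cmod_gt(1) by (intro holomorphic_on_subset[OF holo]) auto
  then have "orbit_sum F (\<lambda>w. F w - w - 1) holomorphic_on {w. para w > height_bound}"
    by (intro holo_orbit_sum[OF decay_F] holomorphic_intros)
  then show ?thesis unfolding fatou_def[abs_def] by (intro holomorphic_intros)
qed

text \<open>The description as a limit allows comparison with other normalized solutions of the Abel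
  equation and with the Fatou coordinate of a conjugate germ.\<close>

lemma fatou_lim:
  assumes "para w > height_bound"
  shows "(\<lambda>n. (F ^^ n) w - of_nat n) \<longlonglongrightarrow> fatou F w"
proof -
  have "(\<lambda>n. w + (\<Sum>k<n. F ((F ^^ k) w) - (F ^^ k) w - 1)) \<longlonglongrightarrow> fatou F w"
    unfolding fatou_def using orbit_sum_sums[OF decay_F assms]
    by (intro tendsto_intros) (auto simp: sums_def)
  moreover have "w + (\<Sum>k<n. F ((F ^^ k) w) - (F ^^ k) w - 1) = (F ^^ n) w - of_nat n" for n
    by (induction n) (auto simp: algebra_simps)
  ultimately show ?thesis by simp
qed

end


section \<open>The intersection of the two petals, and the inverse of the Fatou coordinate\<close>

lemma para_uminus_ge: "para w > M \<Longrightarrow> para (- w) > M \<Longrightarrow> cmod w - \<bar>Re w\<bar> > M"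
  by (auto simp: para_def)

lemma Im_gt_para: "para w > M \<Longrightarrow> para (- w) > M \<Longrightarrow> \<bar>Im w\<bar> > M"
  using para_uminus_ge[of M w] cmod_le[of w] by linarith

lemma para_ge_strip: "\<bar>Re w\<bar> \<le> a \<Longrightarrow>
    para w \<ge> Im w - a" "\<bar>Re w\<bar> \<le> a \<Longrightarrow> para (- w) \<ge> Im w - a"
  using abs_Im_le_cmod[of w] by (auto simp: para_def)

text \<open>\<open>\<Theta>\<close> inverts the Fatou coordinate high up in a vertical strip. The numerical constants only leave room
  for shifting by \<open>F\<close>.\<close>
locale strip = near_translation +
  fixes Y :: real and \<Theta> :: "complex \<Rightarrow> complex"
  assumes strip_para: "\<And>w. \<bar>Re w\<bar> < 10 \<Longrightarrow> Im w > Y \<Longrightarrow> para w > height_bound"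
      "\<And>w. \<bar>Re w\<bar> < 10 \<Longrightarrow> Im w > Y \<Longrightarrow> para (- w) > height_bound"
    and strip_near: "\<And>w. \<bar>Re w\<bar> < 10 \<Longrightarrow> Im w > Y \<Longrightarrow>
        cmod (fatou F w - w) \<le> 1 / 8"
    and strip_F: "\<And>w. \<bar>Re w\<bar> < 10 \<Longrightarrow> Im w > Y \<Longrightarrow>
        cmod (F w - w - 1) \<le> 1 / 8"
    and strip_lipschitz: "\<And>w w'. \<bar>Re w\<bar> < 10 \<Longrightarrow> Im w > Y \<Longrightarrow>
        \<bar>Re w'\<bar> < 10 \<Longrightarrow> Im w' > Y \<Longrightarrow>
        cmod ((fatou F w - fatou F w') - (w - w')) \<le> cmod (w - w') / 4"
    and \<Theta>_near: "\<And>\<zeta>. \<bar>Re \<zeta>\<bar> < 9 \<Longrightarrow>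
        Im \<zeta> > Y + 1 \<Longrightarrow> cmod (\<Theta> \<zeta> - \<zeta>) \<le> 1 / 8"
    and fatou_\<Theta>: "\<And>\<zeta>. \<bar>Re \<zeta>\<bar> < 9 \<Longrightarrow>
        Im \<zeta> > Y + 1 \<Longrightarrow> fatou F (\<Theta> \<zeta>) = \<zeta>"
    and holo_\<Theta>: "\<Theta> holomorphic_on {\<zeta>. \<bar>Re \<zeta>\<bar> < 9 \<and> Im \<zeta> > Y + 1}"
    and Y_pos: "Y > 0"
begin

lemma strip_inj: "\<bar>Re w\<bar> < 10 \<Longrightarrow> Im w > Y \<Longrightarrow>
    \<bar>Re w'\<bar> < 10 \<Longrightarrow> Im w' > Y \<Longrightarrow>
  fatou F w = fatou F w' \<Longrightarrow> w = w'"
  using strip_lipschitz[of w w'] by (simp add: norm_minus_commute)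

lemma \<Theta>_strip:
  assumes "\<bar>Re \<zeta>\<bar> < 9" "Im \<zeta> > Y + 1"
  shows "\<bar>Re (\<Theta> \<zeta>) - Re \<zeta>\<bar> \<le> 1 / 8" "\<bar>Im (\<Theta> \<zeta>) - Im \<zeta>\<bar>
      \<le> 1 / 8" "\<bar>Re (\<Theta> \<zeta>)\<bar> < 10" "Im (\<Theta> \<zeta>) > Y"
  using \<Theta>_near[OF assms] abs_Re_le_cmod[of "\<Theta> \<zeta> - \<zeta>"] abs_Im_le_cmod[of "\<Theta> \<zeta> -
      \<zeta>"] assms by auto

lemma \<Theta>_fatou:
  assumes "\<bar>Re w\<bar> < 8" "Im w > Y + 2"
  shows "\<Theta> (fatou F w) = w"
proof (rule strip_inj)
  have n: "cmod (fatou F w - w) \<le> 1 / 8" using assms by (intro strip_near) auto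
  have *: "\<bar>Re (fatou F w)\<bar> < 9" "Im (fatou F w) > Y + 1"
    using n abs_Re_le_cmod[of "fatou F w - w"] abs_Im_le_cmod[of "fatou F w - w"] assms by auto
  show "fatou F (\<Theta> (fatou F w)) = fatou F w" by (rule fatou_\<Theta>[OF *])
  show "\<bar>Re (\<Theta> (fatou F w))\<bar> < 10" "Im (\<Theta> (fatou F w)) > Y" using \<Theta>_strip[OF *] by auto
qed (use assms in auto)

text \<open>Both sides lie in the strip and have Fatou coordinate \<zeta> + 1, and the Fatou
  coordinate is injective there.\<close>

lemma F_\<Theta>:
  assumes "\<bar>Re \<zeta>\<bar> < 9" "\<bar>Re \<zeta> + 1\<bar> < 9" "Im \<zeta> > Y + 1"
  shows "F (\<Theta> \<zeta>) = \<Theta> (\<zeta> + 1)"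
proof (rule strip_inj)
  note t = \<Theta>_strip[OF assms(1,3)]
  have t': "\<bar>Re (\<zeta> + 1)\<bar> < 9" "Im (\<zeta> + 1) > Y + 1" using assms by auto
  have F: "cmod (F (\<Theta> \<zeta>) - \<Theta> \<zeta> - 1) \<le> 1 / 8" using t by (intro strip_F)
  show "\<bar>Re (F (\<Theta> \<zeta>))\<bar> < 10" "Im (F (\<Theta> \<zeta>)) > Y"
    using F abs_Re_le_cmod[of "F (\<Theta> \<zeta>) - \<Theta> \<zeta> - 1"] abs_Im_le_cmod[of "F (\<Theta> \<zeta>)
        - \<Theta> \<zeta> - 1"] t assms
    by (auto, linarith+)
  show "\<bar>Re (\<Theta> (\<zeta> + 1))\<bar> < 10" "Im (\<Theta> (\<zeta> + 1)) > Y" using \<Theta>_strip[OF t'] by auto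
  have "fatou F (F (\<Theta> \<zeta>)) = \<zeta> + 1"
    using strip_para(1)[OF t(3,4)] fatou_\<Theta>[OF assms(1,3)] by (simp add: fatou_F)
  then show "fatou F (F (\<Theta> \<zeta>)) = fatou F (\<Theta> (\<zeta> + 1))" using fatou_\<Theta>[OF t'] by simp
qed

end

context near_translation
begin

text \<open>High up in a strip the Fatou coordinate is the identity plus an error of modulus at most
  1/8, and Cauchy's estimate on discs of radius 1/2 bounds the derivative of the error by 1/4. This
  gives injectivity and the Lipschitz estimate; preimages come from a fixed point.\<close>

lemma strip_exists: "\<exists>Y \<Theta>. strip F C R Y \<Theta> \<and> Y > L"
proof -
  \<comment> \<open>As 144 = 18 * 8, the bound 18 C / para w of the error drops below 1/8; the
    summand 23 pays for the width of the strip.\<close>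
  define Y where "Y = height_bound + 23 + 144 * C + max L 0"
  have Y: "Y > 22 + height_bound" "144 * C \<le> Y - 22" "Y > 30" "Y > L"
    using C_nonneg height_bound_pos height_bound_ge by (auto simp: Y_def)
  define S where "S = (\<lambda>a y. {w. \<bar>Re w\<bar> < a \<and> Im w > y})"
  have open_S: "open (S a y)" for a y
    unfolding S_def by (intro open_Collect_conj open_Collect_less continuous_intros)
  have convex_S: "convex (S a y)" for a y
  proof -
    have "S a y = {w. Re w < a} \<inter> {w. Re w > - a} \<inter> {w. Im w > y}" by (auto simp: S_def)
    then show ?thesis by (simp add: convex_Int convex_halfspace_Re_lt convex_halfspace_Re_gt convex_halfspace_Im_gt)
  qed
  have pS: "para w > height_bound" "para (- w) > height_bound" "18 * C / para w \<le> 1 / 8" if "w \<in> S 11 (Y - 1)" for w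
  proof -
    have "para w \<ge> Y - 22" "para (- w) \<ge> Y - 22" using that para_ge_strip[of w 11] by (auto simp: S_def)
    then show "para w > height_bound" "para (- w) > height_bound" "18 * C / para w \<le> 1 / 8"
        using Y height_bound_pos by (auto simp: field_simps)
  qed
  define E where "E = (\<lambda>w. fatou F w - w)"
  have holE: "E holomorphic_on S 11 (Y - 1)"
    unfolding E_def using pS by (intro holomorphic_intros holomorphic_on_subset[OF holo_fatou]) auto
  have E_le: "cmod (E w) \<le> 1 / 8" if "w \<in> S 11 (Y - 1)" for w
    unfolding E_def using fatou_near[OF pS(1)[OF that]] pS(3)[OF that] by linarith
  have sub: "S 10 Y \<subseteq> S 11 (Y - 1)" by (auto simp: S_def)
  have cb: "cball w (1/2) \<subseteq> S 11 (Y - 1)" if "w \<in> S 10 Y" for w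
  proof
    fix x assume "x \<in> cball w (1/2)"
    then have "cmod (w - x) \<le> 1/2" by (simp add: dist_norm)
    then show "x \<in> S 11 (Y - 1)"
      using that abs_Re_le_cmod[of "w - x"] abs_Im_le_cmod[of "w - x"] by (auto simp: S_def)
  qed
  have dE: "cmod (deriv E w) \<le> 1/4" if "w \<in> S 10 Y" for w
  proof -
    have "cmod ((deriv ^^ 1) E w) \<le> fact 1 * (1/8) / (1/2) ^ 1"
    proof (rule Cauchy_inequality)
      show "E holomorphic_on ball w (1/2)"
        using cb[OF that] ball_subset_cball holomorphic_on_subset[OF holE] by blast
      show "continuous_on (cball w (1/2)) E"
        using cb[OF that] holE holomorphic_on_imp_continuous_on continuous_on_subset by blast
      show "cmod (E x) \<le> 1/8" if "cmod (w - x) = 1/2" for x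
        using that cb[OF \<open>w \<in> S 10 Y\<close>] by (intro E_le) (auto simp: dist_norm)
    qed auto
    then show ?thesis by simp
  qed
  have lip: "cmod (E w - E w') \<le> cmod (w - w') / 4" if "w \<in> S 10 Y" "w' \<in> S 10 Y" for w w'
  proof -
    have "cmod (E w - E w') \<le> 1/4 * cmod (w - w')"
    proof (rule field_differentiable_bound[OF convex_S[of 10 Y] _ _ that])
      show "(E has_field_derivative deriv E z) (at z within S 10 Y)" if "z \<in> S 10 Y" for z
        using holomorphic_derivI[OF holE open_S] that sub has_field_derivative_at_within by blast
    qed (use dE in auto)
    then show ?thesis by simp
  qed
  have inj: "inj_on (fatou F) (S 10 Y)"
  proof (rule inj_onI)
    fix w w' assume a: "w \<in> S 10 Y" "w' \<in> S 10 Y" "fatou F w = fatou F w'"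
    then have "E w - E w' = w' - w" by (simp add: E_def)
    then show "w = w'" using lip[OF a(1,2)] by (simp add: norm_minus_commute)
  qed
  have "fatou F holomorphic_on S 10 Y"
    using pS sub by (intro holomorphic_on_subset[OF holo_fatou]) auto
  then obtain \<Theta> where \<Theta>: "\<Theta> holomorphic_on (fatou F ` S 10 Y)" "\<And>w. w \<in> S 10 Y
      \<Longrightarrow> \<Theta> (fatou F w) = w"
    using holomorphic_has_inverse[OF _ open_S inj] by metis
  have surj: "\<exists>w\<in>S 10 Y. fatou F w = \<zeta> \<and> cmod (w - \<zeta>) \<le> 1/8"
      if "\<zeta> \<in> S 9 (Y + 1)" for \<zeta>
  proof -
    have sub2: "cball \<zeta> (1/8) \<subseteq> S 10 Y"
    proof
      fix x assume "x \<in> cball \<zeta> (1/8)"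
      then have "cmod (\<zeta> - x) \<le> 1/8" by (simp add: dist_norm)
      then show "x \<in> S 10 Y"
        using that abs_Re_le_cmod[of "\<zeta> - x"] abs_Im_le_cmod[of "\<zeta> - x"] by (auto simp: S_def)
    qed
    \<comment> \<open>A preimage of \<zeta> is a fixed point of w \<mapsto> \<zeta> - E w, which
      maps the disc of radius 1/8 about \<zeta> into itself.\<close>
    obtain x where x: "x \<in> cball \<zeta> (1/8)" "\<zeta> - E x = x"
    proof (rule brouwer_ball[of "1/8" \<zeta> "\<lambda>w. \<zeta> - E w"])
      show "continuous_on (cball \<zeta> (1/8)) (\<lambda>w. \<zeta> - E w)"
        using sub2 sub holE by (intro continuous_intros) (meson continuous_on_subset holomorphic_on_imp_continuous_on
            subset_trans)
      show "(\<lambda>w. \<zeta> - E w) \<in> cball \<zeta> (1/8) \<rightarrow> cball \<zeta> (1/8)"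
        using E_le sub2 sub by (auto simp: dist_norm)
    qed auto
    then have "fatou F x = \<zeta>" by (simp add: E_def algebra_simps)
    then show ?thesis using x sub2 by (intro bexI[of _ x]) (auto simp: dist_norm norm_minus_commute)
  qed
  have "S 9 (Y + 1) \<subseteq> fatou F ` S 10 Y" using surj by blast
  then have hol: "\<Theta> holomorphic_on S 9 (Y + 1)" using \<Theta>(1) holomorphic_on_subset by blast
  have sF: "cmod (F w - w - 1) \<le> 1/8" if "w \<in> S 10 Y" for w
  proof -
    have w: "cmod w \<ge> Y" "para w > height_bound" using that abs_Im_le_cmod[of w] pS sub by (auto simp: S_def)
    have "C / (cmod w)\<^sup>2 \<le> 1/8"
    proof -
      have "8 * C \<le> 1 * Y" using Y C_nonneg by linarith
      also have "\<dots> \<le> cmod w * cmod w" using w Y by (intro mult_mono) auto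
      finally have "8 * C \<le> (cmod w)\<^sup>2" by (simp add: power2_eq_square)
      moreover have "(cmod w)\<^sup>2 > 0" using cmod_gt(4)[OF w(2)] by simp
      ultimately show ?thesis by (simp add: field_simps)
    qed
    then show ?thesis using decay_F[OF w(2)] by linarith
  qed
  have "strip F C R Y \<Theta>"
  proof (unfold_locales, goal_cases)
    case (1 w) then show ?case using pS(1)[of w] by (auto simp: S_def)
  next
    case (2 w) then show ?case using pS(2)[of w] by (auto simp: S_def)
  next
    case (3 w) then show ?case using E_le[of w] by (auto simp: S_def E_def)
  next
    case (4 w) then show ?case using sF[of w] by (auto simp: S_def)
  next
    case (5 w w')
    have "cmod (E w - E w') \<le> cmod (w - w') / 4" using 5 by (intro lip) (auto simp: S_def)
    then show ?case by (simp add: E_def algebra_simps)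
  next
    case (6 \<zeta>)
    then obtain w where "w \<in> S 10 Y" "fatou F w = \<zeta>" "cmod (w - \<zeta>) \<le> 1/8"
        using surj[of \<zeta>] by (auto simp: S_def)
    then show ?case using \<Theta>(2)[of w] by auto
  next
    case (7 \<zeta>)
    then obtain w where "w \<in> S 10 Y" "fatou F w = \<zeta>" using surj[of \<zeta>] by (auto simp: S_def)
    then show ?case using \<Theta>(2)[of w] by auto
  next
    case 8 then show ?case using hol by (simp add: S_def)
  next
    case 9 then show ?case using Y by simp
  qed
  then show ?thesis using Y by blast
qed

end


lemma has_germ:
  assumes "g holomorphic_on ball 0 r" "r > 0"
  obtains q where "analytic_germ q" "ereal r \<le> fps_conv_radius q" "fps_nth q 0 = g 0"
    "\<And>t. cmod t < r \<Longrightarrow> eval_fps q t = g t"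
proof
  have g: "g holomorphic_on eball 0 (ereal r)" using assms by simp
  show r: "ereal r \<le> fps_conv_radius (fps_expansion g 0)" by (rule conv_radius_fps_expansion[OF g])
  then show "analytic_germ (fps_expansion g 0)" using assms(2)
    unfolding analytic_germ_def by (meson ereal_less(2) less_le_trans)
  show *: "eval_fps (fps_expansion g 0) t = g t" if "cmod t < r" for t
    using eval_fps_expansion'[OF g, of t] that by simp
  show "fps_nth (fps_expansion g 0) 0 = g 0" using *[of 0] assms(2) by (simp add: eval_fps_at_0)
qed

section \<open>The jump as a germ\<close>

text \<open>A function of period 1 at the upper end of a strip is a function of t = exp (2 pi i
  \<zeta>) on a punctured disc, and since it tends to 0 with growing height, the singularity at t =
  0 is removable. The strip is wider than a period so that two branches of the logarithm fit into
  it.\<close>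

lemma periodic_germ:
  fixes P :: "complex \<Rightarrow> complex" and Y :: real
  assumes holP: "P holomorphic_on {\<zeta>. \<bar>Re \<zeta>\<bar> < 2 \<and> Im \<zeta> > Y}"
    and per: "\<And>\<zeta>. \<bar>Re \<zeta>\<bar> < 2 \<Longrightarrow>
        \<bar>Re \<zeta> + 1\<bar> < 2 \<Longrightarrow> Im \<zeta> > Y \<Longrightarrow> P (\<zeta> + 1) = P \<zeta>"
    and lim: "\<And>e. e > 0 \<Longrightarrow> \<exists>Y'. \<forall>\<zeta>. \<bar>Re \<zeta>\<bar> < 2
        \<longrightarrow> Im \<zeta> > Y' \<longrightarrow> cmod (P \<zeta>) < e"
  obtains q where "analytic_germ q" "ereal (exp (- 2 * pi * Y)) \<le> fps_conv_radius q" "fps_nth q 0 = 0"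
    "\<And>\<zeta>. \<bar>Re \<zeta>\<bar> < 1 / 2 \<Longrightarrow> Im \<zeta> > Y \<Longrightarrow>
        P \<zeta> = eval_fps q (exp (2 * of_real pi * \<i> * \<zeta>))"
proof -
  define r where "r = exp (- 2 * pi * Y)"
  define L :: "complex \<Rightarrow> complex" where "L = (\<lambda>t. Ln t / (2 * of_real pi * \<i>))"
  define g where "g = (\<lambda>t. if t = 0 then 0 else P (L t))"
  define S where "S = {\<zeta>. \<bar>Re \<zeta>\<bar> < 2 \<and> Im \<zeta> > Y}"
  have L_Re: "Re (L t) = Im (Ln t) / (2 * pi)" for t
    by (simp add: L_def Re_divide_Reals[symmetric] Complex_eq complex_eq_iff Re_divide power2_eq_square field_simps)
  have L_Im: "Im (L t) = - ln (cmod t) / (2 * pi)" if "t \<noteq> 0" for t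
    using that by (simp add: L_def Im_divide power2_eq_square field_simps Re_Ln)
  have L_abs: "\<bar>Re (L t)\<bar> \<le> 1 / 2" if "t \<noteq> 0" for t
    using mpi_less_Im_Ln[OF that] Im_Ln_le_pi[OF that] by (simp add: L_Re field_simps abs_le_iff)
  have Im_gt: "Im (L t) > X \<longleftrightarrow> cmod t < exp (- 2 * pi * X)" if "t \<noteq> 0" for t X
  proof -
    have "cmod t < exp (- 2 * pi * X) \<longleftrightarrow> ln (cmod t) < - 2 * pi * X"
      using that by (metis exp_less_mono exp_ln zero_less_norm_iff exp_less_cancel_iff)
    also have "\<dots> \<longleftrightarrow> 2 * pi * X < 2 * pi * Im (L t)" using L_Im[OF that] by (auto simp: field_simps)
    also have "\<dots> \<longleftrightarrow> Im (L t) > X" by simp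
    finally show ?thesis by simp
  qed
  have LS: "L t \<in> S" "L t + 1 / 2 \<in> S" "L t - 1 / 2 \<in> S" if "t \<noteq> 0" "cmod t < r" for t
    using L_abs[OF that(1)] Im_gt[OF that(1), of Y] that by (auto simp: S_def r_def)
  have hol1: "g holomorphic_on ball 0 r - \<real>\<^sub>\<le>\<^sub>0"
  proof -
    have "(\<lambda>t. P (L t)) holomorphic_on ball 0 r - \<real>\<^sub>\<le>\<^sub>0"
    proof (intro holomorphic_on_compose_gen[OF _ holP, unfolded comp_def])
      show "L holomorphic_on ball 0 r - \<real>\<^sub>\<le>\<^sub>0" by (auto simp: L_def intro!: holomorphic_intros)
      show "L ` (ball 0 r - \<real>\<^sub>\<le>\<^sub>0) \<subseteq> {\<zeta>. \<bar>Re \<zeta>\<bar> < 2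
          \<and> Im \<zeta> > Y}"
      proof (rule image_subsetI)
        fix t :: complex assume "t \<in> ball 0 r - \<real>\<^sub>\<le>\<^sub>0"
        then have "t \<noteq> 0" "cmod t < r" by auto
        then show "L t \<in> {\<zeta>. \<bar>Re \<zeta>\<bar> < 2 \<and> Im \<zeta> > Y}" using LS(1) by (simp only: S_def)
      qed
    qed
    then show ?thesis by (rule holomorphic_transform) (auto simp: g_def)
  qed
  \<comment> \<open>Across the cut of \<open>Ln\<close> the branch L (- t) + 1/2 takes over. It
    equals L t or L t + 1, and periodicity absorbs the difference.\<close>
  have hol2: "g holomorphic_on ball 0 r \<inter> {t. Re t < 0}"
  proof -
    have "(\<lambda>t. P (L (- t) + 1 / 2)) holomorphic_on ball 0 r \<inter> {t. Re t < 0}"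
    proof (intro holomorphic_on_compose_gen[OF _ holP, unfolded comp_def])
      show "(\<lambda>t. L (- t) + 1 / 2) holomorphic_on ball 0 r \<inter> {t. Re t < 0}"
        by (auto simp: L_def complex_nonpos_Reals_iff intro!: holomorphic_intros)
      show "(\<lambda>t. L (- t) + 1 / 2) ` (ball 0 r \<inter> {t. Re t < 0}) \<subseteq> {\<zeta>. \<bar>Re
          \<zeta>\<bar> < 2 \<and> Im \<zeta> > Y}"
      proof (rule image_subsetI)
        fix t assume "t \<in> ball 0 r \<inter> {t. Re t < 0}"
        then have "- t \<noteq> 0" "cmod (- t) < r" by auto
        then show "L (- t) + 1 / 2 \<in> {\<zeta>. \<bar>Re \<zeta>\<bar> < 2 \<and> Im \<zeta> > Y}" using LS(2)
            by (simp only: S_def)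
      qed
    qed
    then show ?thesis
    proof (rule holomorphic_transform)
      fix t assume t: "t \<in> ball 0 r \<inter> {t. Re t < 0}"
      then have t0: "t \<noteq> 0" "- t \<noteq> 0" "cmod (- t) < r" "cmod t < r" by auto
      have two: "L (- t) = L t + 1 / 2 \<or> L (- t) = L t - 1 / 2"
        using Ln_minus[OF t0(1)] by (auto simp: L_def field_simps)
      have "P (L (- t) + 1 / 2) = P (L t)"
      proof -
        from two consider "L (- t) + 1 / 2 = L t" | "L (- t) + 1 / 2 = L t + 1" by (auto simp: field_simps)
        then show ?thesis
        proof cases
          case 2
          have "L t + 1 \<in> S" using LS(2)[OF t0(2,3)] 2 by simp
          then show ?thesis using LS(1)[OF t0(1,4)] unfolding 2 by (intro per) (auto simp: S_def)
        qed simp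
      qed
      then show "P (L (- t) + 1 / 2) = g t" using t0 by (simp add: g_def)
    qed
  qed
  have hol0: "g holomorphic_on ball 0 r - {0}"
  proof -
    have "ball 0 r - {0} \<subseteq> (ball 0 r - \<real>\<^sub>\<le>\<^sub>0) \<union> (ball 0 r \<inter> {t. Re t < 0})"
      by (auto simp: complex_nonpos_Reals_iff complex_eq_iff)
    moreover have "open (ball 0 r - \<real>\<^sub>\<le>\<^sub>0 :: complex set)" "open (ball 0 r \<inter> {t ::
        complex. Re t < 0})"
      by (auto intro!: open_Diff open_Int open_halfspace_Re_lt)
    ultimately show ?thesis
      using holomorphic_on_Un[OF hol1 hol2] holomorphic_on_subset by blast
  qed
  have "g \<midarrow>0\<rightarrow> 0"
  proof (rule LIM_I)
    fix e :: real assume "e > 0"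
    then obtain Y' where Y': "\<And>\<zeta>. \<bar>Re \<zeta>\<bar> < 2 \<Longrightarrow>
        Im \<zeta> > Y' \<Longrightarrow> cmod (P \<zeta>) < e" using lim by blast
    have "norm (g t - 0) < e" if "t \<noteq> 0" "norm (t - 0) < exp (- 2 * pi * Y')" for t
    proof -
      have "cmod (P (L t)) < e" using L_abs[OF that(1)] Im_gt[OF that(1), of Y'] that by (intro Y') auto
      then show ?thesis using that by (simp add: g_def)
    qed
    then show "\<exists>s>0. \<forall>x. x \<noteq> 0 \<and> norm (x - 0) < s \<longrightarrow> norm (g x - 0) < e"
      by (intro exI[of _ "exp (- 2 * pi * Y')"]) auto
  qed
  then have "g holomorphic_on ball 0 r"
    by (intro no_isolated_singularity'[OF _ hol0]) (auto simp: g_def intro: filterlim_mono[OF _ order_refl at_le])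
  then obtain q where q: "analytic_germ q" "ereal r \<le> fps_conv_radius q" "fps_nth q 0 = g 0"
    "\<And>t. cmod t < r \<Longrightarrow> eval_fps q t = g t"
    using has_germ[of g r] by (auto simp: r_def)
  show ?thesis
  proof (rule that[OF q(1)])
    show "ereal (exp (- 2 * pi * Y)) \<le> fps_conv_radius q" using q(2) by (simp add: r_def)
    show "fps_nth q 0 = 0" using q(3) by (simp add: g_def)
    fix \<zeta> :: complex assume \<zeta>: "\<bar>Re \<zeta>\<bar> < 1 / 2" "Im \<zeta> > Y"
    have "Ln (exp (2 * of_real pi * \<i> * \<zeta>)) = 2 * of_real pi * \<i> * \<zeta>"
    proof (rule Ln_exp)
      have "pi * (- 1 / 2) < pi * Re \<zeta>" "pi * Re \<zeta> < pi * (1 / 2)"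
        using \<zeta> by (intro mult_strict_left_mono; simp)+
      then show "- pi < Im (2 * of_real pi * \<i> * \<zeta>)" "Im (2 * of_real pi * \<i> * \<zeta>) \<le> pi" by auto
    qed
    then have "L (exp (2 * of_real pi * \<i> * \<zeta>)) = \<zeta>" by (simp add: L_def)
    moreover have "cmod (exp (2 * of_real pi * \<i> * \<zeta>)) < r" using \<zeta> by (simp add: r_def)
    ultimately show "P \<zeta> = eval_fps q (exp (2 * of_real pi * \<i> * \<zeta>))" by (simp add: q(4) g_def)
  qed
qed

text \<open>Here \<open>B\<close> is the inverse of \<open>F\<close> conjugated by \<open>w \<mapsto> - w\<close>, so that the second sum runs over the strict
  backward orbit of \<open>w\<close>, and both petals are treated by the same theory.\<close>
definition jump :: "(complex \<Rightarrow> complex) \<Rightarrow> (complex \<Rightarrow> complex) \<Rightarrow>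
    (complex \<Rightarrow> complex) \<Rightarrow> complex \<Rightarrow> complex" where
  "jump F B D w = - orbit_sum F D w - orbit_sum B (\<lambda>w. D (- B w)) (- w)"

text \<open>For M \<ge> 0 the conditions on \<open>para\<close> say that |w| - |Re w| > M. At fixed
  real part this quantity grows with the height, so two points are joined by going straight up,
  across at a common height, and down again. The identity of the jump with a germ is continued along
  this set.\<close>

lemma connected_lens: "connected {w. Im w > 0 \<and> para w > M \<and> para (- w) > M}"
proof (cases "M \<ge> 0")
  case True
  define U where "U = {w. Im w > 0 \<and> para w > M \<and> para (- w) > M}"
  have U_iff: "w \<in> U \<longleftrightarrow> Im w > 0 \<and> cmod w - \<bar>Re w\<bar> > M" for w
      by (auto simp: U_def para_def)
  have up: "closed_segment w (w + of_real h * \<i>) \<subseteq> U" if "w \<in> U" "h \<ge> 0" for w h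
  proof
    fix x assume "x \<in> closed_segment w (w + of_real h * \<i>)"
    then obtain s where s: "0 \<le> s" "s \<le> 1" "x = w + of_real (s * h) * \<i>"
      by (auto simp: in_segment scaleR_conv_of_real algebra_simps)
    then have "Re x = Re w" "Im x \<ge> Im w" using that by auto
    moreover have "cmod w \<le> cmod x"
      using calculation that by (auto simp: cmod_def U_iff intro!: power_mono)
    ultimately show "x \<in> U" using that by (auto simp: U_iff)
  qed
  have "connected_component U a b" if ab: "a \<in> U" "b \<in> U" for a b
  proof -
    \<comment> \<open>At this height the modulus exceeds M by more than |Re a| + |Re b|, which
      bounds the real parts on the horizontal segment.\<close>
    define H where "H = M + \<bar>Re a\<bar> + \<bar>Re b\<bar> + \<bar>Im a\<bar> + \<bar>Im b\<bar> + 1"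
    define a' b' where "a' = Complex (Re a) H" and "b' = Complex (Re b) H"
    have a': "a' = a + of_real (H - Im a) * \<i>" "b' = b + of_real (H - Im b) * \<i>"
      by (auto simp: a'_def b'_def complex_eq_iff)
    have sa: "closed_segment a a' \<subseteq> U" and sb: "closed_segment b b' \<subseteq> U"
      unfolding a' using True by (intro up ab; simp add: H_def)+
    have sh: "closed_segment a' b' \<subseteq> U"
    proof
      fix x assume x: "x \<in> closed_segment a' b'"
      obtain u where "x = (1 - u) *\<^sub>R a' + u *\<^sub>R b'" using x by (auto simp: in_segment)
      then have "Im x = (1 - u) * H + u * H" by (simp add: a'_def b'_def)
      then have "Im x = H" by (simp add: algebra_simps)
      moreover have "\<bar>Re x\<bar> \<le> \<bar>Re a\<bar> + \<bar>Re b\<bar>"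
      proof -
        have "Re x \<in> closed_segment (Re a) (Re b)"
          using x by (auto simp: in_segment a'_def b'_def)
        then show ?thesis by (auto simp: closed_segment_eq_real_ivl split: if_splits)
      qed
      ultimately have "Im x > 0" "M < cmod x - \<bar>Re x\<bar>" using abs_Im_le_cmod[of x] True
          unfolding H_def by linarith+
      then show "x \<in> U" by (simp add: U_iff)
    qed
    have "connected_component U a a'" "connected_component U a' b'" "connected_component U b b'"
      using sa sb sh by (meson connected_component_def connected_segment ends_in_segment)+
    then show ?thesis by (meson connected_component_sym connected_component_trans)
  qed
  then show ?thesis unfolding U_def[symmetric] connected_iff_connected_component by blast
next
  case False
  have *: "{w. Im w > 0 \<and> para w > M \<and> para (- w) > M} = {w. Im w > 0}"
  proof -
    have "para w > M" "para (- w) > M" for w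
      using abs_Re_le_cmod[of w] False by (auto simp: para_def)
    then show ?thesis by auto
  qed
  show ?thesis unfolding * by (intro convex_connected convex_halfspace_Im_gt)
qed


section \<open>Sums over full orbits and their invariance\<close>

locale parabolic = fwd: near_translation F C R + bwd: near_translation B C R
  for F B :: "complex \<Rightarrow> complex" and C R :: real +
  assumes BF: "\<And>w. R < cmod w \<Longrightarrow> B (- F w) = - w"
    and FB: "\<And>w. R < cmod w \<Longrightarrow> F (- B w) = - w"
begin

abbreviation M0 :: real where "M0 \<equiv> near_translation.height_bound C R"

lemma cmod_B_ge:
  assumes "para w > M0"
  shows "cmod (B w) > R" "cmod (B w) \<ge> cmod w / 2"
proof -
  note c = bwd.cmod_gt[OF assms]
  show "cmod (B w) > R" using bwd.para_iter_gt[OF assms, of 1] bwd.cmod_gt(1) by simp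
  have "C / (cmod w)\<^sup>2 \<le> 1"
  proof -
    have "C \<le> cmod w" using c(3) fwd.C_nonneg by linarith
    also have "\<dots> \<le> (cmod w)\<^sup>2" using c(2) by (intro self_le_power) auto
    finally show ?thesis using c by (simp add: field_simps)
  qed
  then have "cmod (B w - w - 1) \<le> 1" using bwd.decay_F[OF assms] by linarith
  moreover have "cmod w \<le> cmod (B w) + cmod (B w - w - 1) + 1"
  proof -
    have "w = B w - (B w - w - 1) - 1" by simp
    then have "cmod w \<le> cmod (B w - (B w - w - 1)) + cmod 1" by (metis norm_triangle_ineq4)
    also have "cmod (B w - (B w - w - 1)) \<le> cmod (B w) + cmod (B w - w - 1)" by (rule norm_triangle_ineq4)
    finally show ?thesis by simp
  qed
  ultimately show "cmod (B w) \<ge> cmod w / 2" using c(2) by simp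
qed

context
  fixes D :: "complex \<Rightarrow> complex" and K :: real
  assumes D_le: "\<And>w. R < cmod w \<Longrightarrow> cmod (D w) \<le> K / (cmod w)\<^sup>2"
begin

lemma decay_fwd: "para w > M0 \<Longrightarrow> cmod (D w) \<le> K / (cmod w)\<^sup>2"
  using D_le[OF fwd.cmod_gt(1)] .

lemma decay_bwd: "para w > M0 \<Longrightarrow> cmod (D (- B w)) \<le> 4 * K / (cmod w)\<^sup>2"
proof -
  assume w: "para w > M0"
  have "cmod (D (- B w)) \<le> K / (cmod (B w))\<^sup>2" using D_le[of "- B w"] cmod_B_ge[OF w] by simp
  also have "\<dots> \<le> K / (cmod w / 2)\<^sup>2"
    using cmod_B_ge[OF w] fwd.K_nonneg[OF decay_fwd] fwd.cmod_gt[OF w]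
    by (intro divide_left_mono power_mono mult_pos_pos zero_less_power) auto
  finally show ?thesis by (simp add: power_divide mult.commute)
qed

text \<open>The jump is minus the sum of D over the full orbit. Passing from w to F w merely moves
  the term D w from the forward sum to the backward sum.\<close>

lemma jump_F:
  assumes "para w > M0" "para (- w) > M0" "para (- F w) > M0"
  shows "jump F B D (F w) = jump F B D w"
proof -
  have *: "B (- F w) = - w" using BF[OF fwd.cmod_gt(1)[OF assms(1)]] .
  have "orbit_sum B (\<lambda>w. D (- B w)) (B (- F w)) = orbit_sum B (\<lambda>w. D (- B w)) (- F w) - D (- B (- F w))"
    using decay_bwd assms(3) by (intro bwd.orbit_sum_F)
  then show ?thesis
    unfolding jump_def * using fwd.orbit_sum_F[OF decay_fwd assms(1)] by simp
qed

lemma jump_le: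
  assumes "para w > M0" "para (- w) > M0"
  shows "cmod (jump F B D w) \<le> 18 * K / para w + 72 * K / para (- w)"
proof -
  have "cmod (jump F B D w) \<le> cmod (orbit_sum F D w) + cmod (orbit_sum B (\<lambda>w. D (- B w)) (- w))"
    unfolding jump_def by (metis norm_minus_cancel norm_triangle_ineq4)
  then show ?thesis
    using fwd.orbit_sum_le[OF decay_fwd assms(1)] bwd.orbit_sum_le[OF decay_bwd assms(2)] by simp
qed

lemma holo_jump:
  assumes "D holomorphic_on {w. R < cmod w}"
  shows "jump F B D holomorphic_on {w. para w > M0 \<and> para (- w) > M0}"
proof -
  have D: "D holomorphic_on {w. para w > M0}"
    using fwd.cmod_gt(1) by (intro holomorphic_on_subset[OF assms]) auto
  have B: "B holomorphic_on {w. para w > M0}"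
    using fwd.cmod_gt(1) by (intro holomorphic_on_subset[OF bwd.holo]) auto
  have DB: "(\<lambda>w. D (- B w)) holomorphic_on {w. para w > M0}"
    using cmod_B_ge by (intro holomorphic_on_compose_gen[OF _ assms, unfolded comp_def] holomorphic_intros B) auto
  have "(\<lambda>w. orbit_sum B (\<lambda>w. D (- B w)) (- w)) holomorphic_on {w. para w > M0 \<and> para (- w) > M0}"
    by (rule holomorphic_on_compose_gen[OF _ bwd.holo_orbit_sum[OF decay_bwd DB], unfolded comp_def])
      (auto intro!: holomorphic_intros)
  moreover have "orbit_sum F D holomorphic_on {w. para w > M0 \<and> para (- w) > M0}"
    by (rule holomorphic_on_subset[OF fwd.holo_orbit_sum[OF decay_fwd D]]) auto
  ultimately show ?thesis unfolding jump_def[abs_def] by (intro holomorphic_intros)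
qed

text \<open>In the Fatou coordinate the jump has period 1 and vanishes at the upper end, so it is a
  germ in exp (2 pi i fatou). The inverse \<Theta> yields this only near the imaginary axis;
  connectedness of the lens carries it to the whole upper part of the intersection of the
  petals.\<close>

lemma jump_germ_upper:
  assumes D: "D holomorphic_on {w. R < cmod w}"
  obtains q M where "analytic_germ q" "fps_nth q 0 = 0" "M \<ge> M0"
    "\<And>w. Im w > 0 \<Longrightarrow> para w > M \<Longrightarrow> para (- w) > M \<Longrightarrow>
       exp (2 * of_real pi * \<i> * fatou F w) \<in> eball 0 (fps_conv_radius q) \<and>
       jump F B D w = eval_fps q (exp (2 * of_real pi * \<i> * fatou F w))"
proof -
  obtain Y \<Theta> where st: "strip F C R Y \<Theta>" using fwd.strip_exists by blast
  interpret st: strip F C R Y \<Theta> by (rule st)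
  define J where "J = jump F B D"
  define P where "P = (\<lambda>\<zeta>. J (\<Theta> \<zeta>))"
  have K: "K \<ge> 0" using fwd.K_nonneg[OF decay_fwd] .
  have \<Theta>p: "para (\<Theta> \<zeta>) > M0" "para (- \<Theta> \<zeta>) > M0"
      if "\<bar>Re \<zeta>\<bar> < 9" "Im \<zeta> > Y + 1" for \<zeta>
    using st.strip_para[OF st.\<Theta>_strip(3,4)[OF that]] .
  obtain q where q: "analytic_germ q" "ereal (exp (- 2 * pi * (Y + 1))) \<le> fps_conv_radius q" "fps_nth q 0 = 0"
    "\<And>\<zeta>. \<bar>Re \<zeta>\<bar> < 1 / 2 \<Longrightarrow> Im \<zeta> > Y + 1 \<Longrightarrow>
        P \<zeta> = eval_fps q (exp (2 * of_real pi * \<i> * \<zeta>))"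
  proof (rule periodic_germ[of P "Y + 1"])
    have *: "\<Theta> holomorphic_on {\<zeta>. \<bar>Re \<zeta>\<bar> < 2 \<and> Im \<zeta> > Y + 1}"
      by (rule holomorphic_on_subset[OF st.holo_\<Theta>]) auto
    show "P holomorphic_on {\<zeta>. \<bar>Re \<zeta>\<bar> < 2 \<and> Im \<zeta> > Y + 1}"
      unfolding P_def J_def using \<Theta>p
      by (intro holomorphic_on_compose_gen[OF * holo_jump[OF D], unfolded comp_def]) auto
    show "P (\<zeta> + 1) = P \<zeta>"
        if "\<bar>Re \<zeta>\<bar> < 2" "\<bar>Re \<zeta> + 1\<bar> < 2" "Im \<zeta> > Y + 1" for \<zeta>
    proof -
      have "F (\<Theta> \<zeta>) = \<Theta> (\<zeta> + 1)" using that by (intro st.F_\<Theta>) auto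
      moreover have "para (- \<Theta> (\<zeta> + 1)) > M0" using that by (intro \<Theta>p) auto
      ultimately show ?thesis unfolding P_def J_def using jump_F[of "\<Theta> \<zeta>"] \<Theta>p[of \<zeta>] that by simp
    qed
    show "\<exists>Y'. \<forall>\<zeta>. \<bar>Re \<zeta>\<bar> < 2 \<longrightarrow> Im \<zeta> > Y'
        \<longrightarrow> cmod (P \<zeta>) < e" if "e > 0" for e
    proof (intro exI allI impI)
      fix \<zeta> :: complex
      assume \<zeta>: "\<bar>Re \<zeta>\<bar> < 2" "Im \<zeta> > Y + 5 + 90 * K / e"
      have pos: "90 * K / e \<ge> 0" using K that by simp
      \<comment> \<open>Since |Re (\<Theta> \<zeta>)| \<le> 3, both \<open>para\<close> values are
        at least X; the constant 90 is 18 + 72 from the bound of the jump.\<close>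
      define X where "X = Im (\<Theta> \<zeta>) - 3"
      have b: "\<bar>Re \<zeta>\<bar> < 9" "Im \<zeta> > Y + 1" using \<zeta> pos by auto
      have t: "\<bar>Re (\<Theta> \<zeta>)\<bar> \<le> 3" "Im (\<Theta> \<zeta>) > Y + 4 + 90 * K / e"
        using st.\<Theta>_strip[OF b] \<zeta> by linarith+
      then have X: "X > 90 * K / e" "X > 0" using st.Y_pos pos by (auto simp: X_def)
      have "cmod (P \<zeta>) \<le> 18 * K / para (\<Theta> \<zeta>) + 72 * K / para (- \<Theta> \<zeta>)"
        unfolding P_def J_def by (rule jump_le[OF \<Theta>p[OF b]])
      also have "\<dots> \<le> 18 * K / X + 72 * K / X"
        using para_ge_strip[OF t(1)] X K unfolding X_def by (intro add_mono divide_left_mono mult_pos_pos) auto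
      also have "\<dots> = 90 * K / X" by (simp add: field_simps)
      also have "\<dots> < e" using X that by (simp add: field_simps)
      finally show "cmod (P \<zeta>) < e" .
    qed
  qed blast
  \<comment> \<open>On U the height exceeds M, so the Fatou coordinate lies above Y + 1 and its
    exponential falls into the disc where q converges.\<close>
  define M where "M = M0 + Y + 10"
  define U where "U = {w. Im w > 0 \<and> para w > M \<and> para (- w) > M}"
  have M: "M \<ge> M0" "M > Y + 10" using st.Y_pos fwd.height_bound_pos by (auto simp: M_def)
  have U: "para w > M0" "para (- w) > M0" "Im w > Y + 10" if "w \<in> U" for w
    using that M Im_gt_para[of M w] by (auto simp: U_def)
  have disc: "exp (2 * of_real pi * \<i> * fatou F w) \<in> eball 0 (fps_conv_radius q)" if "w \<in> U" for w
  proof -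
    have "Im (fatou F w) > Y + 1"
      using U[OF that] fwd.fatou_near3[of w] abs_Im_le_cmod[of "fatou F w - w"] by auto
    then have "cmod (exp (2 * of_real pi * \<i> * fatou F w)) < exp (- 2 * pi * (Y + 1))" by simp
    then have "ereal (cmod (exp (2 * of_real pi * \<i> * fatou F w))) < ereal (exp (- 2 * pi * (Y + 1)))"
      by (simp only: less_ereal.simps)
    then show ?thesis using q(2) by (simp only: in_eball_iff dist_0_norm)
  qed
  have open_U: "open U" unfolding U_def
    by (intro open_Collect_conj open_halfspace_Im_gt open_para)
       (auto simp: para_def intro!: open_Collect_less continuous_intros)
  have eq: "J w = eval_fps q (exp (2 * of_real pi * \<i> * fatou F w))" if "w \<in> U" for w
  proof (rule analytic_continuation_open[OF _ open_U _ _ _ _ _ _ that])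
    let ?s = "U \<inter> {w. \<bar>Re w\<bar> < 1/4}"
    show "open ?s" by (intro open_Int open_U open_Collect_less continuous_intros)
    have "\<i> * of_real (M + 1) \<in> ?s" using M st.Y_pos by (simp add: U_def para_def norm_mult)
    then show "?s \<noteq> {}" by blast
    show "connected U" unfolding U_def by (rule connected_lens)
    show "J holomorphic_on U" unfolding J_def using U by (intro holomorphic_on_subset[OF holo_jump[OF D]]) auto
    have "fatou F holomorphic_on U" using U by (intro holomorphic_on_subset[OF fwd.holo_fatou]) auto
    then have "(\<lambda>w. exp (2 * of_real pi * \<i> * fatou F w)) holomorphic_on U" by (intro holomorphic_intros)
    then show "(\<lambda>w. eval_fps q (exp (2 * of_real pi * \<i> * fatou F w))) holomorphic_on U"
      using disc by (intro holomorphic_on_compose_gen[OF _ holomorphic_on_eval_fps[OF order_refl], unfolded comp_def]) auto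
    show "J w = eval_fps q (exp (2 * of_real pi * \<i> * fatou F w))" if "w \<in> ?s" for w
    proof -
      have w: "\<bar>Re w\<bar> < 1/4" "Im w > Y + 10" using that U by auto
      have "cmod (fatou F w - w) \<le> 1/8" using w by (intro st.strip_near) auto
      then have "\<bar>Re (fatou F w)\<bar> < 1/2" "Im (fatou F w) > Y + 1"
        using w abs_Re_le_cmod[of "fatou F w - w"] abs_Im_le_cmod[of "fatou F w - w"] by auto
      then have "P (fatou F w) = eval_fps q (exp (2 * of_real pi * \<i> * fatou F w))" by (rule q(4))
      moreover have "\<Theta> (fatou F w) = w" using w by (intro st.\<Theta>_fatou) auto
      ultimately show ?thesis by (simp add: P_def)
    qed
  qed auto
  show ?thesis
    by (rule that[OF q(1) q(3) M(1)]) (use disc eq in \<open>auto simp: U_def J_def\<close>)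
qed

end

end


section \<open>Cauchy integrals along lines of the Fatou coordinate\<close>

text \<open>The intended G is q (exp (2 pi i \<zeta>)) times a constant, with q vanishing at 0. The
  decay makes integrals along vertical half-lines converge; the rate exp (- Im \<zeta>) is weaker
  than the true exp (- 2 pi Im \<zeta>) and keeps the constants simple.\<close>

locale strip_function = strip +
  fixes G :: "complex \<Rightarrow> complex" and Q :: real
  assumes holo_G: "G holomorphic_on {\<zeta>. Im \<zeta> > Y}"
    and G_add_1: "\<And>\<zeta>. Im \<zeta> > Y \<Longrightarrow> G (\<zeta> + 1) = G \<zeta>"
    and G_le: "\<And>\<zeta>. Im \<zeta> > Y \<Longrightarrow> cmod (G \<zeta>) \<le> Q * exp (- Im \<zeta>)"
begin

text \<open>This is the Cauchy kernel at w of the function G o fatou along the image of a line under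
  \<Theta>, pulled back to the straight line. The factor 1 / (2 pi i) is left to the choice of
  G.\<close>

definition cauchy_ker :: "complex \<Rightarrow> complex \<Rightarrow> complex" where
  "cauchy_ker w \<zeta> = G \<zeta> * deriv \<Theta> \<zeta> / (\<Theta> \<zeta> - w)"

definition seg_int :: "complex \<Rightarrow> complex \<Rightarrow> complex \<Rightarrow> complex" where
  "seg_int a b w = contour_integral (linepath a b) (cauchy_ker w)"

definition T :: "complex set" where "T = {\<zeta>. \<bar>Re \<zeta>\<bar> < 3 \<and> Im \<zeta> > Y + 2}"

lemma Q_nonneg: "Q \<ge> 0"
proof -
  have "0 \<le> Q * exp (- Im (Complex 0 (Y + 1)))" using G_le[of "Complex 0 (Y + 1)"] norm_ge_zero order_trans
      by (metis less_add_one complex.sel(2))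
  then show ?thesis by (simp add: zero_le_mult_iff)
qed

lemma open_T: "open T"
  unfolding T_def by (intro open_Collect_conj open_Collect_less continuous_intros)

lemma convex_T: "convex T"
proof -
  have "T = {w. Re w < 3} \<inter> {w. Re w > - 3} \<inter> {w. Im w > Y + 2}" by (auto simp: T_def)
  then show ?thesis by (simp add: convex_Int convex_halfspace_Re_lt convex_halfspace_Re_gt convex_halfspace_Im_gt)
qed

lemma holo_\<Theta>_T: "\<Theta> holomorphic_on T"
  by (rule holomorphic_on_subset[OF holo_\<Theta>]) (auto simp: T_def)

lemma holo_G_T: "G holomorphic_on T"
  using Y_pos by (intro holomorphic_on_subset[OF holo_G]) (auto simp: T_def)

lemma holo_G\<Theta>': "(\<lambda>\<zeta>. G \<zeta> * deriv \<Theta> \<zeta>) holomorphic_on T"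
  by (intro holomorphic_intros holo_G_T holo_\<Theta>_T open_T)

lemma deriv_\<Theta>_near:
  assumes "\<zeta> \<in> T"
  shows "cmod (deriv \<Theta> \<zeta> - 1) \<le> 1 / 2"
proof -
  let ?E = "\<lambda>x. \<Theta> x - x"
  have cb: "cball \<zeta> (1/4) \<subseteq> {\<zeta>. \<bar>Re \<zeta>\<bar> < 9 \<and> Im \<zeta> > Y + 1}"
  proof
    fix x assume "x \<in> cball \<zeta> (1/4)"
    then have "cmod (\<zeta> - x) \<le> 1/4" by (simp add: dist_norm)
    then show "x \<in> {\<zeta>. \<bar>Re \<zeta>\<bar> < 9 \<and> Im \<zeta> > Y + 1}"
      using assms abs_Re_le_cmod[of "\<zeta> - x"] abs_Im_le_cmod[of "\<zeta> - x"] by (auto simp: T_def)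
  qed
  have hol: "?E holomorphic_on cball \<zeta> (1/4)"
    by (intro holomorphic_intros holomorphic_on_subset[OF holo_\<Theta> cb])
  have "cmod ((deriv ^^ 1) ?E \<zeta>) \<le> fact 1 * (1/8) / (1/4) ^ 1"
  proof (rule Cauchy_inequality)
    show "?E holomorphic_on ball \<zeta> (1/4)" using hol ball_subset_cball holomorphic_on_subset by blast
    show "continuous_on (cball \<zeta> (1/4)) ?E" using hol by (rule holomorphic_on_imp_continuous_on)
    show "cmod (?E x) \<le> 1/8" if "cmod (\<zeta> - x) = 1/4" for x
    proof -
      have "x \<in> {\<zeta>. \<bar>Re \<zeta>\<bar> < 9 \<and> Im \<zeta> > Y + 1}" using cb that
          by (intro subsetD[OF cb]) (simp add: dist_norm)
      then show ?thesis by (intro \<Theta>_near) auto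
    qed
  qed auto
  moreover have "deriv ?E \<zeta> = deriv \<Theta> \<zeta> - 1"
    using holomorphic_on_imp_differentiable_at[OF holo_\<Theta>_T open_T assms] by simp
  ultimately show ?thesis by simp
qed

lemma deriv_\<Theta>_le: "\<zeta> \<in> T \<Longrightarrow> cmod (deriv \<Theta> \<zeta>) \<le> 2"
  using deriv_\<Theta>_near[of \<zeta>] norm_triangle_ineq[of "deriv \<Theta> \<zeta> - 1" 1] by simp

lemma deriv_\<Theta>_nonzero: "\<zeta> \<in> T \<Longrightarrow> deriv \<Theta> \<zeta> \<noteq> 0"
  using deriv_\<Theta>_near[of \<zeta>] by auto

lemma fatou_\<Theta>_T: "\<zeta> \<in> T \<Longrightarrow> fatou F (\<Theta> \<zeta>) = \<zeta>"
  by (intro fatou_\<Theta>) (auto simp: T_def)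

lemma inj_\<Theta>: "\<zeta> \<in> T \<Longrightarrow> \<zeta>' \<in> T \<Longrightarrow>
    \<Theta> \<zeta> = \<Theta> \<zeta>' \<Longrightarrow> \<zeta> = \<zeta>'"
  by (metis fatou_\<Theta>_T)

lemma G\<Theta>'_le:
  assumes "\<zeta> \<in> T" "Im \<zeta> \<ge> y"
  shows "cmod (G \<zeta> * deriv \<Theta> \<zeta>) \<le> 2 * Q * exp (- y)"
proof -
  have "cmod (G \<zeta>) \<le> Q * exp (- Im \<zeta>)" using assms by (intro G_le) (auto simp: T_def)
  also have "\<dots> \<le> Q * exp (- y)" using Q_nonneg assms by (intro mult_left_mono) auto
  finally have "cmod (G \<zeta>) * cmod (deriv \<Theta> \<zeta>) \<le> (Q * exp (- y)) * 2"
    using deriv_\<Theta>_le[OF assms(1)] Q_nonneg by (intro mult_mono) auto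
  then show ?thesis by (simp add: norm_mult mult_ac)
qed

lemma cauchy_ker_cont:
  assumes "S \<subseteq> T" "\<And>\<zeta>. \<zeta> \<in> S \<Longrightarrow> \<Theta> \<zeta> \<noteq> w"
  shows "continuous_on S (cauchy_ker w)"
proof -
  have "continuous_on S (\<lambda>\<zeta>. G \<zeta> * deriv \<Theta> \<zeta>)" "continuous_on S \<Theta>"
    using holo_G\<Theta>' holo_\<Theta>_T assms(1) holomorphic_on_imp_continuous_on continuous_on_subset by blast+
  then show ?thesis unfolding cauchy_ker_def[abs_def] using assms(2)
    by (intro continuous_on_divide continuous_on_diff continuous_on_const) auto
qed

lemma cauchy_ker_integrable:
  assumes "closed_segment a b \<subseteq> T" "\<And>\<zeta>. \<zeta> \<in> closed_segment a b \<Longrightarrow>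
      \<Theta> \<zeta> \<noteq> w"
  shows "cauchy_ker w contour_integrable_on linepath a b"
  by (intro contour_integrable_continuous_linepath cauchy_ker_cont assms)

lemma seg_int_le:
  assumes "closed_segment a b \<subseteq> T" "\<And>\<zeta>. \<zeta> \<in> closed_segment a b \<Longrightarrow>
      d \<le> cmod (\<Theta> \<zeta> - w)" "d > 0"
    "\<And>\<zeta>. \<zeta> \<in> closed_segment a b \<Longrightarrow> Im \<zeta> \<ge> y"
  shows "cmod (seg_int a b w) \<le> 2 * Q * exp (- y) / d * cmod (b - a)"
  unfolding seg_int_def
proof (rule contour_integral_bound_linepath)
  show "cauchy_ker w contour_integrable_on linepath a b" using assms by (intro cauchy_ker_integrable) force+
  show "0 \<le> 2 * Q * exp (- y) / d" using Q_nonneg assms(3) by simp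
  fix \<zeta> assume z: "\<zeta> \<in> closed_segment a b"
  have "cmod (cauchy_ker w \<zeta>) = cmod (G \<zeta> * deriv \<Theta> \<zeta>) / cmod (\<Theta> \<zeta> - w)"
      by (simp add: cauchy_ker_def norm_divide)
  also have "\<dots> \<le> 2 * Q * exp (- y) / d"
    using assms z Q_nonneg by (intro frac_le G\<Theta>'_le) auto
  finally show "cmod (cauchy_ker w \<zeta>) \<le> 2 * Q * exp (- y) / d" .
qed

text \<open>The difference of two Cauchy kernels gains one power of the distance. Applied to w and F
  w, it gives the quadratic decay of the increments of the integrals.\<close>

lemma seg_int_diff_le:
  assumes "closed_segment a b \<subseteq> T" "\<And>\<zeta>. \<zeta> \<in> closed_segment a b \<Longrightarrow>
      d \<le> cmod (\<Theta> \<zeta> - w)"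
    "\<And>\<zeta>. \<zeta> \<in> closed_segment a b \<Longrightarrow> d \<le> cmod (\<Theta> \<zeta> - w')" "d > 0"
    "\<And>\<zeta>. \<zeta> \<in> closed_segment a b \<Longrightarrow> Im \<zeta> \<ge> y"
  shows "cmod (seg_int a b w' - seg_int a b w) \<le> 2 * Q * exp (- y) * cmod (w' - w) / d\<^sup>2 * cmod (b - a)"
proof -
  have nz: "\<Theta> \<zeta> \<noteq> w" "\<Theta> \<zeta> \<noteq> w'"
      if "\<zeta> \<in> closed_segment a b" for \<zeta> using assms that by force+
  have int: "cauchy_ker w contour_integrable_on linepath a b" "cauchy_ker w' contour_integrable_on linepath a b"
    using assms nz by (intro cauchy_ker_integrable; auto)+
  have "seg_int a b w' - seg_int a b w = contour_integral (linepath a b) (\<lambda>\<zeta>. cauchy_ker w' \<zeta> -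
      cauchy_ker w \<zeta>)"
    unfolding seg_int_def by (rule contour_integral_diff[symmetric, OF int(2,1)])
  also have "cmod \<dots> \<le> 2 * Q * exp (- y) * cmod (w' - w) / d\<^sup>2 * cmod (b - a)"
  proof (rule contour_integral_bound_linepath)
    show "(\<lambda>\<zeta>. cauchy_ker w' \<zeta> - cauchy_ker w \<zeta>) contour_integrable_on linepath a b"
      by (intro contour_integrable_diff int)
    show "0 \<le> 2 * Q * exp (- y) * cmod (w' - w) / d\<^sup>2" using Q_nonneg by simp
    fix \<zeta> assume z: "\<zeta> \<in> closed_segment a b"
    have "cauchy_ker w' \<zeta> - cauchy_ker w \<zeta> = G \<zeta> * deriv \<Theta> \<zeta> * (w' - w) / ((\<Theta>
        \<zeta> - w') * (\<Theta> \<zeta> - w))"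
      using nz[OF z] by (simp add: cauchy_ker_def field_simps)
    also have "cmod \<dots> = cmod (G \<zeta> * deriv \<Theta> \<zeta>) * cmod (w' - w) / (cmod (\<Theta> \<zeta> -
        w') * cmod (\<Theta> \<zeta> - w))"
      by (simp add: norm_divide norm_mult)
    also have "\<dots> \<le> 2 * Q * exp (- y) * cmod (w' - w) / d\<^sup>2"
      unfolding power2_eq_square using assms z Q_nonneg
      by (intro frac_le mult_mono G\<Theta>'_le mult_pos_pos mult_nonneg_nonneg) auto
    finally show "cmod (cauchy_ker w' \<zeta> - cauchy_ker w \<zeta>) \<le> 2 * Q * exp (- y) * cmod (w' - w) / d\<^sup>2" .
  qed
  finally show ?thesis .
qed

lemma seg_int_holo:
  assumes T: "closed_segment a b \<subseteq> T" and U: "open U"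
    and nz: "\<And>\<zeta> w. w \<in> U \<Longrightarrow> \<zeta> \<in> closed_segment a b \<Longrightarrow>
        \<Theta> \<zeta> \<noteq> w"
  shows "seg_int a b holomorphic_on U"
proof -
  have "\<exists>S. open S \<and> w \<in> S \<and> seg_int a b holomorphic_on S" if w: "w \<in> U" for w
  proof -
    obtain e where e: "e > 0" "ball w e \<subseteq> U" using U w open_contains_ball by blast
    have lp: "linepath a b t \<in> closed_segment a b" if "t \<in> {0..1}" for t
      using that linepath_in_path by auto
    have cl: "continuous_on {0..1} (linepath a b)" by (intro continuous_intros)
    define N where "N = (\<lambda>t. G (linepath a b t) * deriv \<Theta> (linepath a b t) * (b - a))"
    have "continuous_on (closed_segment a b) (\<lambda>\<zeta>. G \<zeta> * deriv \<Theta> \<zeta>)" "continuous_on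
        (closed_segment a b) \<Theta>"
      using holo_G\<Theta>' holo_\<Theta>_T T holomorphic_on_imp_continuous_on continuous_on_subset by blast+
    then have c: "continuous_on {0..1} (\<lambda>t. G (linepath a b t) * deriv \<Theta> (linepath a b t))"
      and c\<Theta>: "continuous_on {0..1} (\<lambda>t. \<Theta> (linepath a b t))"
      using lp by (auto intro: continuous_on_compose2[OF _ cl])
    have cN: "continuous_on {0..1} N"
      unfolding N_def by (intro continuous_on_mult c continuous_on_const)
    have "(\<lambda>x. integral (cbox 0 1) (\<lambda>t. N t / (\<Theta> (linepath a b t) - x))) holomorphic_on ball w e"
    proof (rule leibniz_rule_holomorphic[where fx = "\<lambda>x t. N t / (\<Theta> (linepath a b t) - x)\<^sup>2"])
      show "((\<lambda>x. N t / (\<Theta> (linepath a b t) - x)) has_field_derivative N t / (\<Theta> (linepath a b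
          t) - x)\<^sup>2)
              (at x within ball w e)" if "x \<in> ball w e" "t \<in> cbox 0 1" for x t
      proof -
        have "\<Theta> (linepath a b t) - x \<noteq> 0" using nz[of x "linepath a b t"] e lp[of t] that by auto
        then show ?thesis by (auto intro!: derivative_eq_intros simp: power2_eq_square)
      qed
      show "(\<lambda>t. N t / (\<Theta> (linepath a b t) - x)) integrable_on cbox 0 1" if "x \<in> ball w e" for x
      proof (intro integrable_continuous continuous_intros)
        show "continuous_on (cbox 0 1) N" "continuous_on (cbox 0 1) (\<lambda>t. \<Theta> (linepath a b t))"
          using cN c\<Theta> by simp_all
        show "\<forall>t\<in>cbox 0 1. \<Theta> (linepath a b t) - x \<noteq> 0"
        proof
          fix t :: real assume "t \<in> cbox 0 1"
          then have "\<Theta> (linepath a b t) \<noteq> x" by (intro nz[OF subsetD[OF e(2) that] lp]) simp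
          then show "\<Theta> (linepath a b t) - x \<noteq> 0" by simp
        qed
      qed
      show "continuous_on (ball w e \<times> cbox 0 1) (\<lambda>(x, t). N t / (\<Theta> (linepath a b t) - x)\<^sup>2)"
        unfolding split_beta
      proof (intro continuous_intros)
        show "continuous_on (ball w e \<times> cbox 0 1) (\<lambda>x. N (snd x))"
          by (rule continuous_on_compose2[OF cN]) (auto intro: continuous_intros)
        show "continuous_on (ball w e \<times> cbox 0 1) (\<lambda>x. \<Theta> (linepath a b (snd x)))"
          by (rule continuous_on_compose2[OF c\<Theta>]) (auto intro: continuous_intros)
        show "\<forall>x\<in>ball w e \<times> cbox 0 1. (\<Theta> (linepath a b (snd x)) - fst x)\<^sup>2 \<noteq> 0"
          using nz e lp by fastforce
      qed
    qed auto
    moreover have "seg_int a b x = integral (cbox 0 1) (\<lambda>t. N t / (\<Theta> (linepath a b t) - x))" for x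
      by (simp add: seg_int_def contour_integral_integral cauchy_ker_def N_def mult_ac)
    then have "seg_int a b = (\<lambda>x. integral (cbox 0 1) (\<lambda>t. N t / (\<Theta> (linepath a b t) - x)))"
        by (rule ext)
    ultimately have "seg_int a b holomorphic_on ball w e" by (simp only:)
    then show ?thesis using e by (intro exI[of _ "ball w e"]) auto
  qed
  then show ?thesis
    by (metis (no_types, lifting) U holomorphic_on_def holomorphic_on_open at_within_open field_differentiable_def
        field_differentiable_at_within)
qed

section \<open>Improper integrals along vertical half-lines\<close>

definition k :: real where "k = Y + 4"

text \<open>All line integrals start at height \<open>k\<close>; \<open>sep x d w\<close> says that \<open>w\<close> has distance at least \<open>d\<close> from the
  image of the line with abscissa \<open>x\<close>.\<close>
definition sep :: "real \<Rightarrow> real \<Rightarrow> complex \<Rightarrow> bool" where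
  "sep x d w \<longleftrightarrow> d > 0 \<and> (\<forall>y\<ge>k. d \<le> cmod (\<Theta> (Complex x y) - w))"

text \<open>Cutting the half-line into unit segments turns the improper integral into a series with
  the geometric majorant \<open>mass\<close>, so that convergence and holomorphy follow from the
  M-test.\<close>

definition piece_int :: "real \<Rightarrow> nat \<Rightarrow> complex \<Rightarrow> complex" where
  "piece_int x j = seg_int (Complex x (k + real j)) (Complex x (k + real (Suc j)))"

definition line_int :: "real \<Rightarrow> complex \<Rightarrow> complex" where
  "line_int x w = (\<Sum>j. piece_int x j w)"

definition mass :: "nat \<Rightarrow> real" where "mass j = 2 * Q * exp (- (k + real j))"

lemma summable_mass: "summable mass"
proof -
  have "summable (\<lambda>j. (2 * Q * exp (- k)) * exp (- 1) ^ j)"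
    by (intro summable_mult summable_geometric) simp
  moreover have "(2 * Q * exp (- k)) * exp (- 1) ^ j = mass j" for j
    unfolding mass_def by (simp add: exp_of_nat_mult[symmetric] exp_add[symmetric] exp_diff exp_minus field_simps)
  ultimately show ?thesis by simp
qed

lemma vert_segment:
  assumes "\<zeta> \<in> closed_segment (Complex x y1) (Complex x y2)" "y1 \<le> y2"
  shows "Re \<zeta> = x" "Im \<zeta> \<ge> y1" "Im \<zeta> \<le> y2" "\<zeta> = Complex x (Im \<zeta>)"
proof -
  from assms(1) obtain u where u: "0 \<le> u" "u \<le> 1" "\<zeta> = (1 - u) *\<^sub>R Complex x y1 + u *\<^sub>R
      Complex x y2"
    by (auto simp: in_segment)
  show "Re \<zeta> = x" unfolding u(3) by (simp add: algebra_simps)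
  moreover have im: "Im \<zeta> = y1 + u * (y2 - y1)" unfolding u(3) by (simp add: algebra_simps)
  moreover have "0 \<le> u * (y2 - y1)" "u * (y2 - y1) \<le> 1 * (y2 - y1)"
    using u assms(2) by (intro mult_nonneg_nonneg mult_right_mono; simp)+
  ultimately show "Im \<zeta> \<ge> y1" "Im \<zeta> \<le> y2" "\<zeta> = Complex x (Im \<zeta>)"
      by (auto simp: complex_eq_iff)
qed

lemma vert_segment_T:
  assumes "\<bar>x\<bar> \<le> 2" "k \<le> y1" "y1 \<le> y2"
  shows "closed_segment (Complex x y1) (Complex x y2) \<subseteq> T"
  using vert_segment[of _ x y1 y2] assms by (fastforce simp: T_def k_def)

lemma sep_segment:
  assumes "sep x d w" "k \<le> y1" "y1 \<le> y2" "\<zeta> \<in> closed_segment (Complex x y1) (Complex x y2)"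
  shows "d \<le> cmod (\<Theta> \<zeta> - w)"
  using assms vert_segment[of \<zeta> x y1 y2] unfolding sep_def by (metis order_trans)

lemma piece_int_le:
  assumes "\<bar>x\<bar> \<le> 2" "sep x d w"
  shows "cmod (piece_int x j w) \<le> mass j / d"
proof -
  have "cmod (seg_int (Complex x (k + real j)) (Complex x (k + real (Suc j))) w)
     \<le> 2 * Q * exp (- (k + real j)) / d * cmod (Complex x (k + real (Suc j)) - Complex x (k + real j))"
    by (rule seg_int_le[OF vert_segment_T sep_segment[OF assms(2)]])
       (use assms vert_segment(2) in \<open>auto simp: sep_def\<close>)
  moreover have "cmod (Complex x (k + real (Suc j)) - Complex x (k + real j)) = 1" by (simp add: cmod_def)
  ultimately show ?thesis by (simp add: piece_int_def mass_def)
qed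

lemma line_int_sums:
  assumes "\<bar>x\<bar> \<le> 2" "sep x d w"
  shows "(\<lambda>j. piece_int x j w) sums line_int x w"
proof -
  have "summable (\<lambda>j. piece_int x j w)"
    by (rule summable_comparison_test'[OF summable_divide[OF summable_mass], of 0 _ d])
       (use piece_int_le[OF assms] in auto)
  then show ?thesis unfolding line_int_def by (rule summable_sums)
qed

lemma line_int_le:
  assumes "\<bar>x\<bar> \<le> 2" "sep x d w"
  shows "cmod (line_int x w) \<le> suminf mass / d"
proof -
  have s: "summable (\<lambda>j. mass j / d)" by (intro summable_divide summable_mass)
  have s2: "summable (\<lambda>j. cmod (piece_int x j w))"
    by (rule summable_comparison_test'[OF s, of 0]) (use piece_int_le[OF assms] in auto)
  have "cmod (line_int x w) \<le> (\<Sum>j. cmod (piece_int x j w))" unfolding line_int_def by (rule summable_norm[OF s2])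
  also have "\<dots> \<le> (\<Sum>j. mass j / d)" by (intro suminf_le piece_int_le assms s s2)
  also have "\<dots> = suminf mass / d" by (rule suminf_divide[OF summable_mass])
  finally show ?thesis .
qed

lemma line_int_diff_le:
  assumes "\<bar>x\<bar> \<le> 2" "sep x d w" "sep x d w'"
  shows "cmod (line_int x w' - line_int x w) \<le> suminf mass * cmod (w' - w) / d\<^sup>2"
proof -
  have le: "cmod (piece_int x j w' - piece_int x j w) \<le> mass j * (cmod (w' - w) / d\<^sup>2)" for j
  proof -
    have "cmod (piece_int x j w' - piece_int x j w)
      \<le> 2 * Q * exp (- (k + real j)) * cmod (w' - w) / d\<^sup>2 * cmod (Complex x (k + real (Suc j)) - Complex x
          (k + real j))"
      unfolding piece_int_def
      by (rule seg_int_diff_le[OF vert_segment_T sep_segment[OF assms(2)] sep_segment[OF assms(3)]])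
         (use assms vert_segment(2) in \<open>auto simp: sep_def\<close>)
    moreover have "cmod (Complex x (k + real (Suc j)) - Complex x (k + real j)) = 1" by (simp add: cmod_def)
    ultimately show ?thesis by (simp add: mass_def)
  qed
  have s: "summable (\<lambda>j. mass j * (cmod (w' - w) / d\<^sup>2))" by (intro summable_mult2 summable_mass)
  have s2: "summable (\<lambda>j. cmod (piece_int x j w' - piece_int x j w))"
    by (rule summable_comparison_test'[OF s, of 0]) (use le in auto)
  have "(\<lambda>j. piece_int x j w' - piece_int x j w) sums (line_int x w' - line_int x w)"
    by (rule sums_diff[OF line_int_sums[OF assms(1,3)] line_int_sums[OF assms(1,2)]])
  then have "cmod (line_int x w' - line_int x w) \<le> (\<Sum>j. cmod (piece_int x j w' - piece_int x j w))"
    using summable_norm[OF s2] by (simp add: sums_iff)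
  also have "\<dots> \<le> (\<Sum>j. mass j * (cmod (w' - w) / d\<^sup>2))" by (intro suminf_le le s s2)
  also have "\<dots> = suminf mass * (cmod (w' - w) / d\<^sup>2)" by (rule suminf_mult2[symmetric, OF summable_mass])
  finally show ?thesis by simp
qed

lemma line_int_holo:
  assumes "\<bar>x\<bar> \<le> 2" "open U" "\<And>w. w \<in> U \<Longrightarrow> sep x d w"
  shows "line_int x holomorphic_on U"
proof (rule holomorphic_uniform_sequence[OF assms(2)])
  have "piece_int x j holomorphic_on U" for j
    unfolding piece_int_def
  proof (rule seg_int_holo[OF vert_segment_T assms(2)])
    fix \<zeta> w assume "w \<in> U" "\<zeta> \<in> closed_segment (Complex x (k + real j)) (Complex x (k + real (Suc j)))"
    then have "d \<le> cmod (\<Theta> \<zeta> - w)" "d > 0"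
      using sep_segment[OF assms(3)[of w], of "k + real j" "k + real (Suc j)" \<zeta>] assms(3)[of w]
      by (auto simp: sep_def)
    then show "\<Theta> \<zeta> \<noteq> w" by auto
  qed (use assms in auto)
  then show "(\<lambda>w. \<Sum>j<n. piece_int x j w) holomorphic_on U" for n by (intro holomorphic_on_sum)
  fix w assume "w \<in> U"
  then obtain e where e: "e > 0" "cball w e \<subseteq> U" using assms(2) open_contains_cball by blast
  have "uniform_limit (cball w e) (\<lambda>n w. \<Sum>j<n. piece_int x j w) (line_int x) sequentially"
    unfolding line_int_def
  proof (rule Weierstrass_m_test)
    show "norm (piece_int x j u) \<le> mass j / d" if "u \<in> cball w e" for j u
      using piece_int_le[OF assms(1,3)] subsetD[OF e(2) that] by blast
  qed (rule summable_divide[OF summable_mass])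
  then show "\<exists>e>0. cball w e \<subseteq> U
      \<and> uniform_limit (cball w e) (\<lambda>n w. \<Sum>j<n. piece_int x j w) (line_int x) sequentially"
    using e by blast
qed

section \<open>Closing the contour: rectangles and residues\<close>

lemma sum_piece_int:
  assumes "\<bar>x\<bar> \<le> 2" "sep x d w"
  shows "(\<Sum>j<n. piece_int x j w) = seg_int (Complex x k) (Complex x (k + real n)) w"
proof (induction n)
  case 0 then show ?case by (simp add: seg_int_def)
next
  case (Suc n)
  have "seg_int (Complex x k) (Complex x (k + real (Suc n))) w =
        seg_int (Complex x k) (Complex x (k + real n)) w + piece_int x n w"
    unfolding seg_int_def piece_int_def
  proof (rule contour_integral_split_linepath)
    show "continuous_on (closed_segment (Complex x k) (Complex x (k + real (Suc n)))) (cauchy_ker w)"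
    proof (rule cauchy_ker_cont)
      show "closed_segment (Complex x k) (Complex x (k + real (Suc n))) \<subseteq> T"
        using assms by (intro vert_segment_T) auto
      fix \<zeta> assume "\<zeta> \<in> closed_segment (Complex x k) (Complex x (k + real (Suc n)))"
      then have "d \<le> cmod (\<Theta> \<zeta> - w)" by (intro sep_segment[OF assms(2)]) auto
      then show "\<Theta> \<zeta> \<noteq> w" using assms(2) by (auto simp: sep_def)
    qed
    show "Complex x (k + real n) \<in> closed_segment (Complex x k) (Complex x (k + real (Suc n)))"
      unfolding in_segment
    proof (intro exI conjI)
      define u where "u = real n / real (Suc n)"
      have u: "u * real (Suc n) = real n" by (simp add: u_def)
      have "(1 - u) * k + u * (k + real (Suc n)) = k + u * real (Suc n)" by (simp only: algebra_simps)
      then show "Complex x (k + real n) = (1 - u) *\<^sub>R Complex x k + u *\<^sub>R Complex x (k + real (Suc n))"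
        using u by (simp add: complex_eq_iff) (simp add: algebra_simps)
      show "0 \<le> u" "u \<le> 1" by (auto simp: u_def)
    qed
  qed
  then show ?case using Suc by simp
qed


text \<open>This segment joins the feet of the two lines. With it, the difference of the two line
  integrals becomes a limit of integrals over closed rectangles.\<close>

definition bottom_int :: "complex \<Rightarrow> complex" where
  "bottom_int = seg_int (Complex (- 1) k) (Complex 1 k)"

lemma hor_segment:
  assumes "\<zeta> \<in> closed_segment (Complex x1 y) (Complex x2 y)"
  shows "Im \<zeta> = y" "\<bar>Re \<zeta>\<bar> \<le> max \<bar>x1\<bar> \<bar>x2\<bar>"
proof -
  obtain u where u: "\<zeta> = (1 - u) *\<^sub>R Complex x1 y + u *\<^sub>R Complex x2 y" "0 \<le> u" "u \<le> 1"
    using assms by (auto simp: in_segment)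
  have "Im \<zeta> = (1 - u) * y + u * y" "Re \<zeta> = (1 - u) * x1 + u * x2" by (auto simp: u)
  then show "Im \<zeta> = y" by (simp add: algebra_simps)
  have "\<bar>(1 - u) * x1 + u * x2\<bar> \<le> (1 - u) * \<bar>x1\<bar> + u * \<bar>x2\<bar>"
    using u abs_triangle_ineq[of "(1 - u) * x1" "u * x2"] by (simp add: abs_mult)
  also have "\<dots> \<le> (1 - u) * max \<bar>x1\<bar> \<bar>x2\<bar> + u * max \<bar>x1\<bar> \<bar>x2\<bar>"
    using u by (intro add_mono mult_left_mono) auto
  also have "\<dots> = max \<bar>x1\<bar> \<bar>x2\<bar>" by (simp add: algebra_simps)
  finally show "\<bar>Re \<zeta>\<bar> \<le> max \<bar>x1\<bar> \<bar>x2\<bar>" using \<open>Re \<zeta> = _\<close> by simp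
qed

lemma hor_segment_T: "k \<le> y \<Longrightarrow> closed_segment (Complex (- 1) y) (Complex 1 y) \<subseteq> T"
  using hor_segment[of _ "- 1" y 1] by (fastforce simp: T_def k_def)

lemma rect_integral:
  fixes n :: nat
  defines "a \<equiv> Complex (- 1) k" and "b \<equiv> Complex 1 (k + real n)"
  assumes "sep (- 1) d w" "sep 1 d w"
    and bottom_int: "\<And>\<zeta>. \<zeta> \<in> closed_segment (Complex (- 1) k) (Complex 1 k) \<Longrightarrow>
        \<Theta> \<zeta> \<noteq> w"
    and top: "\<And>\<zeta>. \<zeta> \<in> closed_segment (Complex (- 1) (k + real n)) (Complex 1 (k + real n))
        \<Longrightarrow> \<Theta> \<zeta> \<noteq> w"
  shows "contour_integral (rectpath a b) (cauchy_ker w) =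
      bottom_int w + (\<Sum>j<n. piece_int 1 j w) - seg_int (Complex (- 1) (k + real n)) (Complex 1 (k + real n)) w -
          (\<Sum>j<n. piece_int (- 1) j w)"
proof -
  have vnz: "\<Theta> \<zeta> \<noteq> w"
      if "\<zeta> \<in> closed_segment (Complex x k) (Complex x (k + real n))" "sep x d w" for x \<zeta>
  proof -
    have "d \<le> cmod (\<Theta> \<zeta> - w)" by (rule sep_segment[OF that(2) _ _ that(1)]) auto
    then show ?thesis using that(2) by (auto simp: sep_def)
  qed
  have iL: "cauchy_ker w contour_integrable_on linepath (Complex (- 1) k) (Complex (- 1) (k + real n))"
    and iR: "cauchy_ker w contour_integrable_on linepath (Complex 1 k) (Complex 1 (k + real n))"
    by (rule cauchy_ker_integrable[OF vert_segment_T vnz[OF _ assms(3)]]; simp)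
       (rule cauchy_ker_integrable[OF vert_segment_T vnz[OF _ assms(4)]]; simp)
  have iB: "cauchy_ker w contour_integrable_on linepath (Complex (- 1) k) (Complex 1 k)"
    by (intro cauchy_ker_integrable hor_segment_T bottom_int) auto
  have iT: "cauchy_ker w contour_integrable_on linepath (Complex (- 1) (k + real n)) (Complex 1 (k + real n))"
    by (intro cauchy_ker_integrable hor_segment_T top) auto
  have rev: "cauchy_ker w contour_integrable_on linepath y x \<and>
      contour_integral (linepath y x) (cauchy_ker w) = - contour_integral (linepath x y) (cauchy_ker w)"
    if "cauchy_ker w contour_integrable_on linepath x y" for x y
    using contour_integral_reversepath[of "linepath x y" "cauchy_ker w"]
      contour_integrable_reversepath[of "linepath x y" "cauchy_ker w"] that by simp
  have "contour_integral (rectpath a b) (cauchy_ker w) =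
      contour_integral (linepath (Complex (- 1) k) (Complex 1 k)) (cauchy_ker w) +
      contour_integral (linepath (Complex 1 k) (Complex 1 (k + real n))) (cauchy_ker w) +
      contour_integral (linepath (Complex 1 (k + real n)) (Complex (- 1) (k + real n))) (cauchy_ker w) +
      contour_integral (linepath (Complex (- 1) (k + real n)) (Complex (- 1) k)) (cauchy_ker w)"
    unfolding rectpath_def Let_def a_def b_def using iB iR rev[OF iT] rev[OF iL]
    by (simp add: contour_integral_join contour_integrable_join valid_path_join)
  then show ?thesis
    using rev[OF iT] rev[OF iL] sum_piece_int[of 1 d w n] sum_piece_int[of "- 1" d w n] assms(3,4)
    by (simp add: bottom_int_def seg_int_def)
qed

text \<open>By injectivity of \<Theta> the kernel at \<Theta> \<zeta>0 has its only pole in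
  \<zeta>0, and the pole is simple. Multiplied by \<zeta> - \<zeta>0 it extends with the value G
  \<zeta>0, because the derivative of \<Theta> cancels against the difference quotient. The residue
  is then a case of Cauchy's integral formula.\<close>

lemma holo_pole_part:
  assumes z0: "\<zeta>0 \<in> T"
  defines "h \<equiv> \<lambda>\<zeta>. if \<zeta> = \<zeta>0 then G \<zeta>0 else G \<zeta> * deriv \<Theta> \<zeta>
      * (\<zeta> - \<zeta>0) / (\<Theta> \<zeta> - \<Theta> \<zeta>0)"
  shows "h holomorphic_on T"
proof (rule no_isolated_singularity'[where K = "{\<zeta>0}"])
  have "(\<lambda>\<zeta>. G \<zeta> * deriv \<Theta> \<zeta> * (\<zeta> - \<zeta>0) / (\<Theta> \<zeta> - \<Theta>
      \<zeta>0)) holomorphic_on T - {\<zeta>0}"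
    using inj_\<Theta>[OF _ z0]
    by (intro holomorphic_on_divide holomorphic_on_mult holomorphic_on_diff holomorphic_on_ident holomorphic_on_const
      holomorphic_on_subset[OF holo_G\<Theta>'] holomorphic_on_subset[OF holo_\<Theta>_T]) auto
  then show "h holomorphic_on T - {\<zeta>0}"
    by (rule holomorphic_transform) (auto simp: h_def)
  fix z assume "z \<in> {\<zeta>0}"
  then have z: "z = \<zeta>0" by simp
  have d: "(\<Theta> has_field_derivative deriv \<Theta> \<zeta>0) (at \<zeta>0)"
    by (rule holomorphic_derivI[OF holo_\<Theta>_T open_T z0])
  have "isCont (\<lambda>\<zeta>. G \<zeta> * deriv \<Theta> \<zeta>) \<zeta>0"
    using holo_G\<Theta>' open_T z0 by (meson continuous_on_eq_continuous_at holomorphic_on_imp_continuous_on)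
  then have "((\<lambda>\<zeta>. G \<zeta> * deriv \<Theta> \<zeta> / ((\<Theta> \<zeta> - \<Theta> \<zeta>0) /
      (\<zeta> - \<zeta>0))) \<longlongrightarrow> G \<zeta>0 * deriv \<Theta> \<zeta>0 / deriv \<Theta> \<zeta>0)
          (at \<zeta>0)"
    using d deriv_\<Theta>_nonzero[OF z0] by (intro tendsto_divide) (auto simp: isCont_def has_field_derivative_iff)
  then have "((\<lambda>\<zeta>. G \<zeta> * deriv \<Theta> \<zeta> / ((\<Theta> \<zeta> - \<Theta> \<zeta>0) /
      (\<zeta> - \<zeta>0))) \<longlongrightarrow> G \<zeta>0) (at \<zeta>0)"
    using deriv_\<Theta>_nonzero[OF z0] by simp
  then have "(h \<longlongrightarrow> G \<zeta>0) (at \<zeta>0)"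
    by (rule Lim_transform_eventually) (auto simp: h_def eventually_at_filter)
  then show "(h \<longlongrightarrow> h z) (at z within T)" unfolding z
    by (auto simp: h_def intro: filterlim_mono[OF _ order_refl at_le])
qed (use open_T in auto)

text \<open>On the upper edge G decays exponentially while the distance to w stays at least 1 from
  some height on.\<close>

lemma top_tendsto: "(\<lambda>n. seg_int (Complex (- 1) (k + real n)) (Complex 1 (k + real n)) w)
    \<longlonglongrightarrow> 0"
proof (rule Lim_null_comparison)
  have "mass \<longlonglongrightarrow> 0" by (rule summable_LIMSEQ_zero[OF summable_mass])
  then show "(\<lambda>n. mass n * 2) \<longlonglongrightarrow> 0" by (rule tendsto_mult_left_zero)
  obtain N :: nat where N: "real N > cmod w + 2" using reals_Archimedean2 by blast
  have "cmod (seg_int (Complex (- 1) (k + real n)) (Complex 1 (k + real n)) w) \<le> mass n * 2" if "n \<ge> N" for n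
  proof -
    have T: "closed_segment (Complex (- 1) (k + real n)) (Complex 1 (k + real n)) \<subseteq> T"
        by (intro hor_segment_T) auto
    have "cmod (seg_int (Complex (- 1) (k + real n)) (Complex 1 (k + real n)) w)
       \<le> 2 * Q * exp (- (k + real n)) / 1 * cmod (Complex 1 (k + real n) - Complex (- 1) (k + real n))"
    proof (rule seg_int_le[OF T])
      fix \<zeta> assume z: "\<zeta> \<in> closed_segment (Complex (- 1) (k + real n)) (Complex 1 (k + real n))"
      show "Im \<zeta> \<ge> k + real n" using hor_segment[OF z] by simp
      have "\<zeta> \<in> T" using z T by blast
      then have "\<bar>Im (\<Theta> \<zeta>) - Im \<zeta>\<bar> \<le> 1/8" by (intro \<Theta>_strip) (auto simp: T_def)
      moreover have "real N \<le> real n" using that by simp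
      ultimately have "Im (\<Theta> \<zeta>) - Im w \<ge> 1"
        using hor_segment(1)[OF z] N abs_Im_le_cmod[of w] Y_pos unfolding k_def by linarith
      then have "Im (\<Theta> \<zeta> - w) \<ge> 1" by simp
      then show "1 \<le> cmod (\<Theta> \<zeta> - w)" using abs_Im_le_cmod[of "\<Theta> \<zeta> - w"] by linarith
    qed auto
    moreover have "cmod (Complex 1 (k + real n) - Complex (- 1) (k + real n)) = 2" by (simp add: cmod_def)
    ultimately show ?thesis by (simp add: mass_def)
  qed
  then show "\<forall>\<^sub>F n in sequentially. norm (seg_int (Complex (- 1) (k + real n)) (Complex 1 (k + real n))
      w) \<le> mass n * 2"
    by (auto intro: eventually_sequentiallyI[of N])
qed

lemma strip_limit:
  assumes "sep (- 1) d w" "sep 1 d w"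
    and bottom_int: "\<And>\<zeta>. \<zeta> \<in> closed_segment (Complex (- 1) k) (Complex 1 k) \<Longrightarrow>
        \<Theta> \<zeta> \<noteq> w"
    and ev: "\<forall>\<^sub>F n in sequentially. contour_integral (rectpath (Complex (- 1) k) (Complex 1 (k + real
        n))) (cauchy_ker w) = L"
  shows "bottom_int w + line_int 1 w - line_int (- 1) w = L"
proof -
  obtain N :: nat where N: "real N > cmod w + 2" using reals_Archimedean2 by blast
  have top: "\<Theta> \<zeta> \<noteq> w"
      if "\<zeta> \<in> closed_segment (Complex (- 1) (k + real n)) (Complex 1 (k + real n))" "n \<ge> N" for n \<zeta>
  proof
    assume eq: "\<Theta> \<zeta> = w"
    have "\<zeta> \<in> T" using that hor_segment_T[of "k + real n"] by auto
    then have "\<bar>Im w - Im \<zeta>\<bar> \<le> 1/8" unfolding eq[symmetric] by (intro \<Theta>_strip) (auto simp: T_def)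
    then show False using hor_segment(1)[OF that(1)] N that abs_Im_le_cmod[of w] Y_pos by (simp add: k_def)
  qed
  define R where "R = (\<lambda>n. bottom_int w + (\<Sum>j<n. piece_int 1 j w) - seg_int (Complex (- 1) (k + real n))
      (Complex 1 (k + real n)) w - (\<Sum>j<n. piece_int (- 1) j w))"
  have "R \<longlonglongrightarrow> bottom_int w + line_int 1 w - 0 - line_int (- 1) w"
    unfolding R_def using line_int_sums[of 1 d w] line_int_sums[of "- 1" d w] assms(1,2)
    by (intro tendsto_intros top_tendsto) (auto simp: sums_def)
  moreover have "\<forall>\<^sub>F n in sequentially. L = R n"
    using ev eventually_ge_at_top[of N]
  proof eventually_elim
    case (elim n)
    then show ?case unfolding R_def using rect_integral[OF assms(1,2) bottom_int top[of _ n]] by simp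
  qed
  then have "R \<longlonglongrightarrow> L" by (rule Lim_transform_eventually[OF tendsto_const])
  ultimately show ?thesis using LIMSEQ_unique by fastforce
qed

lemma rect_subset_T: "cbox (Complex (- 1) k) (Complex 1 (k + real n)) \<subseteq> T"
  by (auto simp: in_cbox_complex_iff T_def k_def)

lemma strip_outside:
  assumes "sep (- 1) d w" "sep 1 d w" and w: "\<And>\<zeta>. \<zeta> \<in> T \<Longrightarrow> \<Theta> \<zeta> \<noteq> w"
  shows "bottom_int w + line_int 1 w - line_int (- 1) w = 0"
proof (rule strip_limit[OF assms(1,2)])
  show "\<Theta> \<zeta> \<noteq> w" if "\<zeta> \<in> closed_segment (Complex (- 1) k) (Complex 1 k)" for \<zeta>
    using w that hor_segment_T[of k] by auto
  have "cauchy_ker w holomorphic_on T"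
    unfolding cauchy_ker_def[abs_def] using w
    by (intro holomorphic_on_divide holo_G\<Theta>' holomorphic_on_diff holo_\<Theta>_T holomorphic_on_const) auto
  then have "(cauchy_ker w has_contour_integral 0) (rectpath (Complex (- 1) k) (Complex 1 (k + real n)))" for n
    by (rule Cauchy_theorem_convex_simple[OF _ convex_T])
       (use rect_subset_T[of n] path_image_rectpath_subset_cbox[of "Complex (- 1) k" "Complex 1 (k + real n)"] in auto)
  then show "\<forall>\<^sub>F n in sequentially. contour_integral (rectpath (Complex (- 1) k) (Complex 1 (k + real
      n))) (cauchy_ker w) = 0"
    by (auto intro!: always_eventually contour_integral_unique)
qed

text \<open>The separation from both lines rules out |Re \<zeta>0| = 1. For tall rectangles \<zeta>0
  is therefore either inside, with winding number 1, or strictly outside.\<close>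

lemma strip_inside:
  assumes "sep (- 1) d (\<Theta> \<zeta>0)" "sep 1 d (\<Theta> \<zeta>0)" and z0: "\<zeta>0 \<in> T" "Im \<zeta>0 > k"
  shows "bottom_int (\<Theta> \<zeta>0) + line_int 1 (\<Theta> \<zeta>0) - line_int (- 1) (\<Theta> \<zeta>0) = (if
      \<bar>Re \<zeta>0\<bar> < 1 then 2 * of_real pi * \<i> * G \<zeta>0 else 0)"
    (is "_ = ?L")
proof (rule strip_limit[OF assms(1,2)])
  show "\<Theta> \<zeta> \<noteq> \<Theta> \<zeta>0"
      if "\<zeta> \<in> closed_segment (Complex (- 1) k) (Complex 1 k)" for \<zeta>
    using inj_\<Theta>[OF _ z0(1), of \<zeta>] that hor_segment_T[of k] hor_segment(1)[OF that] z0(2) by auto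
  have Re_ne: "Re \<zeta>0 \<noteq> x" if "sep x d (\<Theta> \<zeta>0)" for x
  proof
    assume "Re \<zeta>0 = x"
    then have "Complex x (Im \<zeta>0) = \<zeta>0" by (simp add: complex_eq_iff)
    then show False using that z0(2) unfolding sep_def by (metis diff_self less_eq_real_def norm_zero not_less)
  qed
  define h where "h = (\<lambda>\<zeta>. if \<zeta> = \<zeta>0 then G \<zeta>0 else G \<zeta> * deriv \<Theta>
      \<zeta> * (\<zeta> - \<zeta>0) / (\<Theta> \<zeta> - \<Theta> \<zeta>0))"
  obtain N :: nat where N: "real N > Im \<zeta>0" using reals_Archimedean2 by blast
  have "contour_integral (rectpath (Complex (- 1) k) (Complex 1 (k + real n))) (cauchy_ker (\<Theta> \<zeta>0)) = ?L"
      if n: "n \<ge> N" for n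
  proof (rule contour_integral_unique)
    let ?a = "Complex (- 1) k" and ?b = "Complex 1 (k + real n)"
    have kn: "k + real n > Im \<zeta>0" using n N Y_pos by (simp add: k_def)
    have ni: "\<zeta>0 \<notin> path_image (rectpath ?a ?b)"
      using Re_ne[OF assms(1)] Re_ne[OF assms(2)] kn z0(2)
      by (subst path_image_rectpath_cbox_minus_box) (auto simp: in_cbox_complex_iff in_box_complex_iff)
    have pi: "path_image (rectpath ?a ?b) \<subseteq> T"
      using rect_subset_T[of n] path_image_rectpath_subset_cbox[of ?a ?b] by auto
    have "((\<lambda>\<zeta>. h \<zeta> / (\<zeta> - \<zeta>0)) has_contour_integral (2 * pi * \<i> * winding_number
        (rectpath ?a ?b) \<zeta>0 * h \<zeta>0)) (rectpath ?a ?b)"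
      by (rule Cauchy_integral_formula_convex_simple[OF convex_T])
         (use holo_pole_part[OF z0(1)] z0 open_T pi ni in \<open>auto simp: h_def interior_open\<close>)
    moreover have "2 * pi * \<i> * winding_number (rectpath ?a ?b) \<zeta>0 * h \<zeta>0 = ?L"
    proof (cases "\<bar>Re \<zeta>0\<bar> < 1")
      case True
      then have "winding_number (rectpath ?a ?b) \<zeta>0 = 1"
        using kn z0(2) by (intro winding_number_rectpath) (auto simp: in_box_complex_iff)
      then show ?thesis using True by (simp add: h_def)
    next
      case False
      then have "winding_number (rectpath ?a ?b) \<zeta>0 = 0"
        using Re_ne[OF assms(1)] Re_ne[OF assms(2)]
        by (intro winding_number_rectpath_outside) (auto simp: in_cbox_complex_iff)
      then show ?thesis using False by simp
    qed
    ultimately have "((\<lambda>\<zeta>. h \<zeta> / (\<zeta> - \<zeta>0)) has_contour_integral ?L) (rectpath ?a ?b)"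
        by simp
    then show "(cauchy_ker (\<Theta> \<zeta>0) has_contour_integral ?L) (rectpath ?a ?b)"
      by (rule has_contour_integral_eq) (use ni in \<open>auto simp: h_def cauchy_ker_def\<close>)
  qed
  then show "\<forall>\<^sub>F n in sequentially. contour_integral (rectpath (Complex (- 1) k) (Complex 1 (k + real
      n))) (cauchy_ker (\<Theta> \<zeta>0)) = ?L"
    by (auto intro: eventually_sequentiallyI[of N])
qed

end


text \<open>The low coefficients are limits at 0, so a quadratic bound along one sequence determines
  them. It will be applied to \<delta> at points w on the positive real axis.\<close>

lemma germ_order_2I:
  fixes z :: "nat \<Rightarrow> complex"
  assumes p: "analytic_germ p" and z: "z \<longlonglongrightarrow> 0" "\<And>n. z n \<noteq> 0"
    and le: "\<And>n. cmod (eval_fps p (z n)) \<le> K * (cmod (z n))\<^sup>2"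
  shows "fps_nth p 0 = 0" "fps_nth p 1 = 0"
proof -
  have cont: "(\<lambda>n. eval_fps q (z n)) \<longlonglongrightarrow> fps_nth q 0" if "fps_conv_radius q > 0" for q
  proof -
    have "isCont (eval_fps q) 0" using continuous_eval_fps[of 0 q UNIV] that by (simp add: zero_ereal_def)
    then show ?thesis using z(1) isCont_tendsto_compose eval_fps_at_0 by metis
  qed
  have pr: "fps_conv_radius p > 0" using p by (simp add: analytic_germ_def)
  have "(\<lambda>n. K * (cmod (z n))\<^sup>2) \<longlonglongrightarrow> K * (cmod 0)\<^sup>2" by (intro tendsto_intros z)
  then have K0: "(\<lambda>n. K * (cmod (z n))\<^sup>2) \<longlonglongrightarrow> 0" by simp
  have "(\<lambda>n. eval_fps p (z n)) \<longlonglongrightarrow> 0"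
    by (rule Lim_null_comparison[OF always_eventually[OF allI[OF le]] K0])
  then show p0: "fps_nth p 0 = 0" using cont[OF pr] LIMSEQ_unique by blast
  have ev: "\<forall>\<^sub>F n in sequentially. z n \<in> eball 0 (fps_conv_radius p)"
    using z(1) pr by (intro topological_tendstoD[of _ 0]) (auto simp: zero_ereal_def)
  have "\<forall>\<^sub>F n in sequentially. norm (eval_fps (fps_shift 1 p) (z n)) \<le> K * cmod (z n)"
    using ev
  proof eventually_elim
    case (elim n)
    have "cmod (eval_fps (fps_shift 1 p) (z n)) = cmod (eval_fps p (z n)) / cmod (z n)"
    proof (cases "p = 0")
      case False
      then have "subdegree p \<ge> 1" using p0 by (intro subdegree_geI) auto
      then show ?thesis using elim z(2)[of n] by (subst eval_fps_shift) (auto simp: norm_divide)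
    qed simp
    also have "\<dots> \<le> K * (cmod (z n))\<^sup>2 / cmod (z n)" by (intro divide_right_mono le) auto
    finally show ?case using z(2)[of n] by (simp add: power2_eq_square)
  qed
  note ev2 = this
  have "(\<lambda>n. K * cmod (z n)) \<longlonglongrightarrow> K * cmod 0" by (intro tendsto_intros z)
  then have K1: "(\<lambda>n. K * cmod (z n)) \<longlonglongrightarrow> 0" by simp
  have "(\<lambda>n. eval_fps (fps_shift 1 p) (z n)) \<longlonglongrightarrow> 0" by (rule Lim_null_comparison[OF ev2 K1])
  moreover have "(\<lambda>n. eval_fps (fps_shift 1 p) (z n)) \<longlonglongrightarrow> fps_nth (fps_shift 1 p) 0"
      using pr by (intro cont) simp
  ultimately show "fps_nth p 1 = 0" using LIMSEQ_unique by fastforce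
qed

section \<open>Realization of a jump\<close>

locale realization = parabolic F B C R + sp: strip_function F C R Y \<Theta> G Q for F B C R Y \<Theta> G Q +
  assumes Y_ge: "Y \<ge> 10"
begin

text \<open>The term 8 C forces |F w - w - 1| \<le> 1/8. The term Y + 20 keeps w away from the
  bottom segment, whose image has modulus at most Y + 6, and places points with small real part at a
  height above Y + 3 in absolute value.\<close>

definition R1 :: real where "R1 = Y + 20 + R + 8 * C"

text \<open>\<open>good lo hi\<close> is a neighbourhood of infinity without the points whose Fatou coordinate lies high up
  in the strip between \<open>lo\<close> and \<open>hi\<close>; the overlapping bounds make it a union of open sets.\<close>
definition good :: "real \<Rightarrow> real \<Rightarrow> complex set" where
  "good lo hi = {w. R1 < cmod w \<and> (Im w < 5 \<or> \<bar>Re w\<bar> > 6 \<or>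
     (\<bar>Re w\<bar> < 8 \<and> Im w > Y + 3 \<and> (Re (fatou F w) < lo \<or> Re (fatou F w) > hi)))}"

text \<open>\<open>O1\<close> avoids the line with abscissa \<open>- 1\<close> and its preimage under \<open>F\<close>, and \<open>O2\<close> those of the
  line with abscissa \<open>1\<close>.\<close>
definition O1 :: "complex set" where "O1 = good (- 9 / 4) (- 3 / 4)"
definition O2 :: "complex set" where "O2 = good (- 1 / 4) (5 / 4)"

definition right_int :: "complex \<Rightarrow> complex" where "right_int w = sp.line_int 1 w + sp.bottom_int w"

text \<open>The residue term by which the two integrals differ, up to 2 pi i. The conditions on w
  itself confine it to the strip, where the Fatou coordinate is close to w.\<close>

definition \<rho> :: "complex \<Rightarrow> complex" where
  "\<rho> w = (if Im w > Y + 3 \<and> \<bar>Re w\<bar> < 8 \<and> \<bar>Re (fatou F w)\<bar> < 1 then G (fatou F w) else 0)"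

definition \<delta> :: "complex \<Rightarrow> complex" where
  "\<delta> w = (if w \<in> O1 then sp.line_int (- 1) (F w) - sp.line_int (- 1) w else right_int (F w) - right_int w)"

lemma R1_ge: "R1 \<ge> Y + 20" "R1 \<ge> 31" "R1 \<ge> R"
  using fwd.C_nonneg fwd.R_ge_1 Y_ge by (auto simp: R1_def)

lemma Im_large: "R1 < cmod w \<Longrightarrow> \<bar>Re w\<bar> \<le> a \<Longrightarrow> \<bar>Im w\<bar> > Y + 20 - a"
  using cmod_le[of w] R1_ge by linarith

lemma F_near: "R1 < cmod w \<Longrightarrow> cmod (F w - w - 1) \<le> 1 / 8"
proof -
  assume w: "R1 < cmod w"
  have "8 * C \<le> cmod w * 1" using w fwd.R_ge_1 Y_ge by (simp add: R1_def)
  also have "\<dots> \<le> cmod w * cmod w" using w R1_ge by (intro mult_left_mono) auto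
  finally have "8 * C \<le> (cmod w)\<^sup>2" by (simp add: power2_eq_square)
  moreover have "(cmod w)\<^sup>2 > 0" using w R1_ge by auto
  ultimately have "C / (cmod w)\<^sup>2 \<le> 1 / 8" by (simp add: field_simps)
  then show ?thesis using fwd.dist_le[of w] w R1_ge by linarith
qed

lemma F_coord:
  assumes "R1 < cmod w"
  shows "\<bar>Re (F w) - Re w - 1\<bar> \<le> 1 / 8" "\<bar>Im (F w) - Im w\<bar> \<le> 1 / 8" "cmod (F w) > R1 - 2"
proof -
  note n = F_near[OF assms]
  show "\<bar>Re (F w) - Re w - 1\<bar> \<le> 1 / 8" "\<bar>Im (F w) - Im w\<bar> \<le> 1 / 8"
    using n abs_Re_le_cmod[of "F w - w - 1"] abs_Im_le_cmod[of "F w - w - 1"] by auto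
  have "cmod w \<le> cmod (F w) + cmod (F w - w - 1) + 1"
  proof -
    have "w = F w - (F w - w - 1) - 1" by simp
    then have "cmod w \<le> cmod (F w - (F w - w - 1)) + cmod 1" by (metis norm_triangle_ineq4)
    also have "cmod (F w - (F w - w - 1)) \<le> cmod (F w) + cmod (F w - w - 1)" by (rule norm_triangle_ineq4)
    finally show ?thesis by simp
  qed
  then show "cmod (F w) > R1 - 2" using n assms by linarith
qed

lemma fatou_coord:
  assumes "\<bar>Re w\<bar> < 10" "Im w > Y"
  shows "\<bar>Re (fatou F w) - Re w\<bar> \<le> 1 / 8" "\<bar>Im (fatou F w) - Im w\<bar> \<le> 1 / 8" "fatou F (F
      w) = fatou F w + 1"
  using sp.strip_near[OF assms] abs_Re_le_cmod[of "fatou F w - w"] abs_Im_le_cmod[of "fatou F w - w"]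
    fwd.fatou_F[OF sp.strip_para(1)[OF assms]] by auto

text \<open>The excluded bands for the real part of the Fatou coordinate are [-9/4, -3/4] and
  [-1/4, 5/4]. They are disjoint, and points low down or far from the imaginary axis meet no
  condition at all.\<close>

lemma cover: "R1 < cmod w \<Longrightarrow> w \<in> O1 \<or> w \<in> O2"
  using Im_large[of w 6] Y_ge by (auto simp: O1_def O2_def good_def)

lemma good_gt: "w \<in> good lo hi \<Longrightarrow> R1 < cmod w" by (simp add: good_def)

lemma near_line:
  assumes "cmod (\<Theta> (Complex x y) - w) < 1 / 16" "\<bar>x\<bar> \<le> 1" "y \<ge> sp.k"
  shows "\<bar>Re w\<bar> < 2" "Im w > Y + 7 / 2" "\<bar>Re (fatou F w) - x\<bar> \<le> 1 / 8"
proof -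
  let ?z = "Complex x y"
  have z: "\<bar>Re ?z\<bar> < 9" "Im ?z > Y + 1" using assms by (auto simp: sp.k_def)
  note t = sp.\<Theta>_strip[OF z]
  have d: "\<bar>Re w - Re (\<Theta> ?z)\<bar> < 1 / 16" "\<bar>Im w - Im (\<Theta> ?z)\<bar> < 1 / 16"
    using assms(1) abs_Re_le_cmod[of "\<Theta> ?z - w"] abs_Im_le_cmod[of "\<Theta> ?z - w"]
    unfolding minus_complex.sel by linarith+
  show w: "\<bar>Re w\<bar> < 2" using d t(1) assms(2) unfolding complex.sel by linarith
  show w2: "Im w > Y + 7 / 2" using d t(2) assms(3) unfolding sp.k_def complex.sel by linarith
  have "cmod ((fatou F w - fatou F (\<Theta> ?z)) - (w - \<Theta> ?z)) \<le> cmod (w - \<Theta> ?z) / 4"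
    by (rule sp.strip_lipschitz) (use w w2 t(3,4) in linarith)+
  then have "cmod (fatou F w - ?z - (w - \<Theta> ?z)) \<le> 1 / 64"
    using assms(1) sp.fatou_\<Theta>[OF z] by (simp add: norm_minus_commute)
  then have "cmod (fatou F w - ?z) \<le> 1 / 8"
    using norm_triangle_ineq[of "fatou F w - ?z - (w - \<Theta> ?z)" "w - \<Theta> ?z"] assms(1)
    by (simp add: norm_minus_commute)
  then show "\<bar>Re (fatou F w) - x\<bar> \<le> 1 / 8" using abs_Re_le_cmod[of "fatou F w - ?z"] by simp
qed

text \<open>A point within 1/16 of the line x has the real part of its Fatou coordinate within 1/8
  of x. If F w is that close, the coordinate of w is within 1/8 of x - 1. So the band from x - 9/8
  to x + 1/8 has to be excluded.\<close>

lemma good_sep: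
  assumes w: "w \<in> good lo hi" and x: "\<bar>x\<bar> \<le> 1" "lo \<le> x - 9 / 8" "x + 1 / 8 \<le> hi"
  shows "sp.sep x (1 / 16) w" "sp.sep x (1 / 16) (F w)"
proof -
  note R = good_gt[OF w]
  have "False" if "cmod (\<Theta> (Complex x y) - w) < 1 / 16" "y \<ge> sp.k" for y
    using near_line[OF that(1) x(1) that(2)] w x Y_ge by (auto simp: good_def)
  then show "sp.sep x (1 / 16) w" unfolding sp.sep_def by (meson not_le zero_less_divide_1_iff zero_less_numeral)
  have "False" if "cmod (\<Theta> (Complex x y) - F w) < 1 / 16" "y \<ge> sp.k" for y
  proof -
    note n = near_line[OF that(1) x(1) that(2)]
    have c: "\<bar>Re w\<bar> < 4" "Im w > Y + 3" using n F_coord[OF R] by linarith+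
    have "\<bar>Re (fatou F w) + 1 - x\<bar> \<le> 1 / 8" using n(3) fatou_coord(3)[of w] c by simp
    then show False using w x c Y_ge by (auto simp: good_def)
  qed
  then show "sp.sep x (1 / 16) (F w)" unfolding sp.sep_def by (meson not_le zero_less_divide_1_iff zero_less_numeral)
qed

lemmas O1_sep = good_sep[of _ "- 9 / 4" "- 3 / 4" "- 1", folded O1_def, simplified]
lemmas O2_sep = good_sep[of _ "- 1 / 4" "5 / 4" 1, folded O2_def, simplified]

lemma O_gt: "w \<in> O1 \<Longrightarrow> R1 < cmod w" "w \<in> O2 \<Longrightarrow> R1 < cmod w"
  by (auto simp: O1_def O2_def dest: good_gt)

lemma bottom_int_sep:
  assumes "R1 - 2 < cmod w" "\<zeta> \<in> closed_segment (Complex (- 1) sp.k) (Complex 1 sp.k)"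
  shows "1 \<le> cmod (\<Theta> \<zeta> - w)"
proof -
  have "\<zeta> \<in> sp.T" using sp.hor_segment_T[of sp.k] assms(2) by auto
  then have "cmod (\<Theta> \<zeta> - \<zeta>) \<le> 1 / 8" by (intro sp.\<Theta>_near) (auto simp: sp.T_def)
  then have "cmod (\<Theta> \<zeta>) \<le> 1 / 8 + cmod \<zeta>"
      using norm_triangle_ineq2[of "\<Theta> \<zeta>" \<zeta>] by linarith
  also have "cmod \<zeta> \<le> 1 + sp.k" using sp.hor_segment[OF assms(2)] cmod_le[of \<zeta>] Y_ge by (simp add: sp.k_def)
  finally have "cmod (\<Theta> \<zeta>) \<le> Y + 6" by (simp add: sp.k_def)
  then show ?thesis using assms(1) R1_ge norm_triangle_ineq3[of w "\<Theta> \<zeta>"] by (simp add: norm_minus_commute)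
qed

lemma line_int_gap:
  assumes "R1 - 2 < cmod w" "sp.sep (- 1) d w" "sp.sep 1 d w"
  shows "right_int w - sp.line_int (- 1) w = 2 * of_real pi * \<i> * \<rho> w"
proof (cases "\<exists>\<zeta>\<in>sp.T. \<Theta> \<zeta> = w")
  case True
  then obtain \<zeta> where z: "\<zeta> \<in> sp.T" "\<Theta> \<zeta> = w" by blast
  have f: "fatou F w = \<zeta>" using sp.fatou_\<Theta>_T[OF z(1)] z(2) by simp
  have zz: "\<bar>Re \<zeta>\<bar> < 3" "Im \<zeta> > Y + 2" using z(1) by (auto simp: sp.T_def)
  have t: "\<bar>Re w - Re \<zeta>\<bar> \<le> 1/8" "\<bar>Im w - Im \<zeta>\<bar> \<le> 1/8"
      using sp.\<Theta>_strip[of \<zeta>] zz z(2) by auto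
  have "Im w > Y + 14" using t zz cmod_le[of w] assms(1) R1_ge Y_ge by linarith
  then have b: "Im \<zeta> > sp.k" "Im w > Y + 3" "\<bar>Re w\<bar> < 8" using t zz unfolding sp.k_def by linarith+
  have "sp.bottom_int w + sp.line_int 1 w - sp.line_int (- 1) w = (if \<bar>Re \<zeta>\<bar> < 1 then 2 * of_real pi
      * \<i> * G \<zeta> else 0)"
    using sp.strip_inside[of d \<zeta>] assms(2,3) z b by simp
  then show ?thesis using b f by (simp add: right_int_def \<rho>_def add.commute)
next
  case False
  have "\<rho> w = 0"
  proof (rule ccontr)
    assume "\<rho> w \<noteq> 0"
    then have c: "Im w > Y + 3" "\<bar>Re w\<bar> < 8" "\<bar>Re (fatou F w)\<bar> < 1"
        by (auto simp: \<rho>_def split: if_splits)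
    then have "\<Theta> (fatou F w) = w" by (intro sp.\<Theta>_fatou) auto
    moreover have "\<bar>Im (fatou F w) - Im w\<bar> \<le> 1 / 8" using c by (intro fatou_coord(2)) auto
    then have "Im (fatou F w) > Y + 2" using c by linarith
    then have "fatou F w \<in> sp.T" using c by (auto simp: sp.T_def)
    ultimately show False using False by blast
  qed
  then show ?thesis using sp.strip_outside[OF assms(2,3)] False by (auto simp: right_int_def add.commute)
qed

text \<open>In the strip, outside both bands, there are two cases. If the real part of the Fatou
  coordinate is between -3/4 and -1/4, both w and F w lie between the lines and the periodicity of G
  applies. If it is below -9/4 or above 5/4, neither does. A step across one of the lines is exactly
  what the bands exclude, and this invariance is why the two coboundaries agree.\<close>

lemma \<rho>_F:
  assumes w: "w \<in> O1" "w \<in> O2"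
  shows "\<rho> (F w) = \<rho> w"
proof -
  note R = O_gt(1)[OF w(1)] note F = F_coord[OF R]
  consider "\<bar>Re w\<bar> < 8" "Im w > 0" | "\<bar>Re w\<bar> \<ge> 8" "Im w > 0" | "Im w \<le> 0" by linarith
  then show ?thesis
  proof cases
    case 1
    have I: "Im w > Y + 10" using Im_large[OF R, of 8] 1 by auto
    then have c: "\<bar>Re (fatou F w) - Re w\<bar> \<le> 1 / 8" "\<bar>Im (fatou F w) - Im w\<bar> \<le> 1 / 8"
        "fatou F (F w) = fatou F w + 1"
      using fatou_coord[of w] 1 by auto
    have "\<bar>Re (fatou F w)\<bar> > 5 \<or> \<bar>Re w\<bar> \<le> 6" using c by linarith
    then consider "Re (fatou F w) > - 3/4" "Re (fatou F w) < - 1/4" | "Re (fatou F w) < - 9/4 \<or> Re (fatou F w) > 5/4"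
      using w I Y_ge by (fastforce simp: O1_def O2_def good_def)
    then show ?thesis
    proof cases
      case 1
      have "Im (fatou F w) > Y" using c I by linarith
      then have "G (fatou F w + 1) = G (fatou F w)" by (rule sp.G_add_1)
      moreover have "Im (F w) > Y + 3" "Im w > Y + 3" "\<bar>Re (F w)\<bar> < 8" "\<bar>Re w\<bar> < 8"
        "\<bar>Re (fatou F w)\<bar> < 1" "\<bar>Re (fatou F w) + 1\<bar> < 1" using 1 c F I by linarith+
      ultimately show ?thesis using c(3) by (simp add: \<rho>_def)
    next
      case 2 then show ?thesis using c by (auto simp: \<rho>_def)
    qed
  next
    case 2
    have "\<not> (Im (F w) > Y + 3 \<and> \<bar>Re (F w)\<bar> < 8 \<and> \<bar>Re (fatou F (F w))\<bar> < 1)"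
    proof
      assume a: "Im (F w) > Y + 3 \<and> \<bar>Re (F w)\<bar> < 8 \<and> \<bar>Re (fatou F (F w))\<bar> < 1"
      then have "\<bar>Re (fatou F (F w)) - Re (F w)\<bar> \<le> 1 / 8" by (intro fatou_coord(1)) auto
      then show False using a F(1) 2 by linarith
    qed
    then have "\<rho> (F w) = 0" unfolding \<rho>_def by (rule if_not_P)
    then show ?thesis using 2 by (simp add: \<rho>_def)
  next
    case 3 then show ?thesis using F Y_ge by (auto simp: \<rho>_def)
  qed
qed

lemma \<delta>_O2:
  assumes w: "w \<in> O2"
  shows "\<delta> w = right_int (F w) - right_int w"
proof (cases "w \<in> O1")
  case True
  note R = O_gt(1)[OF True]
  have "right_int w - sp.line_int (- 1) w = 2 * of_real pi * \<i> * \<rho> w"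
    using O1_sep[OF True] O2_sep[OF w] R by (intro line_int_gap) auto
  moreover have "right_int (F w) - sp.line_int (- 1) (F w) = 2 * of_real pi * \<i> * \<rho> (F w)"
    using O1_sep[OF True] O2_sep[OF w] F_coord(3)[OF R] by (intro line_int_gap) auto
  ultimately show ?thesis using \<rho>_F[OF True w] True by (simp add: \<delta>_def algebra_simps)
qed (simp add: \<delta>_def)

lemma open_good: "open (good lo hi)"
proof -
  define \<Sigma> where "\<Sigma> = {w. \<bar>Re w\<bar> < 8 \<and> Im w > Y + 3}"
  have oS: "open \<Sigma>" unfolding \<Sigma>_def by (intro open_Collect_conj open_Collect_less continuous_intros)
  have "continuous_on \<Sigma> (fatou F)"
    using sp.strip_para(1) by (intro holomorphic_on_imp_continuous_on holomorphic_on_subset[OF fwd.holo_fatou]) (auto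
        simp: \<Sigma>_def)
  then have c: "continuous_on \<Sigma> (\<lambda>w. Re (fatou F w))" by (intro continuous_intros)
  have o: "open (\<Sigma> \<inter> (\<lambda>w. Re (fatou F w)) -` X)" if "open X" for X
    using continuous_open_preimage[OF c oS that] .
  have "good lo hi = {w. R1 < cmod w} \<inter> ({w. Im w < 5} \<union> {w. \<bar>Re w\<bar> > 6} \<union> (\<Sigma>
      \<inter> (\<lambda>w. Re (fatou F w)) -` ({..<lo} \<union> {hi<..})))"
    by (auto simp: good_def \<Sigma>_def)
  then show ?thesis
    by (simp only:) (intro open_Int open_Un o open_Collect_less continuous_intros open_lessThan open_greaterThan)
qed

lemma sep_ball: "sp.sep x (1 / 16) p \<Longrightarrow> dist p v < 1 / 32 \<Longrightarrow> sp.sep x (1 / 32) v"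
  unfolding sp.sep_def
proof (intro conjI allI impI, goal_cases)
  case (2 y)
  then have "1 / 16 \<le> cmod (\<Theta> (Complex x y) - p)" by auto
  also have "\<dots> \<le> cmod (\<Theta> (Complex x y) - v) + cmod (v - p)"
    using norm_triangle_ineq[of "\<Theta> (Complex x y) - v" "v - p"] by simp
  finally show ?case using 2 by (simp add: dist_norm norm_minus_commute)
qed auto

lemma line_int_F_holo:
  assumes U: "open U" "\<And>w. w \<in> U \<Longrightarrow> R1 < cmod w" "\<bar>x\<bar> \<le> 2"
    "\<And>w. w \<in> U \<Longrightarrow> sp.sep x (1 / 16) w" "\<And>w. w \<in> U \<Longrightarrow>
        sp.sep x (1 / 16) (F w)"
  shows "(\<lambda>w. sp.line_int x (F w) - sp.line_int x w) holomorphic_on U"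
proof -
  define V where "V = (\<Union>w\<in>U. ball (F w) (1 / 32))"
  have "sp.line_int x holomorphic_on V"
    by (rule sp.line_int_holo[OF U(3), of _ "1/32"]) (use sep_ball U(5) in \<open>auto simp: V_def\<close>)
  moreover have "F holomorphic_on U" using U(2) R1_ge(3) by (intro holomorphic_on_subset[OF fwd.holo]) force
  moreover have "F ` U \<subseteq> V" unfolding V_def
    by (rule image_subsetI, rule UN_I, assumption, rule centre_in_ball[THEN iffD2], simp)
  ultimately have "(\<lambda>w. sp.line_int x (F w)) holomorphic_on U"
    using holomorphic_on_compose_gen[of F U "sp.line_int x" V] by (simp add: comp_def)
  then show ?thesis using sp.line_int_holo[OF U(3,1,4)] by (intro holomorphic_intros)
qed

lemma bottom_int_holo: "sp.bottom_int holomorphic_on {w. R1 - 2 < cmod w}"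
  unfolding sp.bottom_int_def
proof (rule sp.seg_int_holo[OF sp.hor_segment_T])
  show "open {w. R1 - 2 < cmod w}" by (intro open_Collect_less continuous_intros)
  fix \<zeta> w assume "w \<in> {w. R1 - 2 < cmod w}" "\<zeta> \<in> closed_segment (Complex (- 1) sp.k) (Complex 1 sp.k)"
  then show "\<Theta> \<zeta> \<noteq> w" using bottom_int_sep[of w \<zeta>] by auto
qed simp

lemma \<delta>_holo: "\<delta> holomorphic_on {w. R1 < cmod w}"
proof -
  have "(\<lambda>w. sp.line_int (- 1) (F w) - sp.line_int (- 1) w) holomorphic_on O1"
    using O1_sep O_gt(1) open_good by (intro line_int_F_holo) (auto simp: O1_def)
  then have 1: "\<delta> holomorphic_on O1" by (rule holomorphic_transform) (simp add: \<delta>_def)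
  have l: "(\<lambda>w. sp.line_int 1 (F w) - sp.line_int 1 w) holomorphic_on O2"
    using O2_sep O_gt(2) open_good by (intro line_int_F_holo) (auto simp: O2_def)
  have F: "F holomorphic_on O2" using O_gt(2) R1_ge(3) by (intro holomorphic_on_subset[OF fwd.holo]) force
  have b1: "(\<lambda>w. sp.bottom_int (F w)) holomorphic_on O2"
    by (rule holomorphic_on_compose_gen[OF F bottom_int_holo, unfolded comp_def]) (use F_coord(3) O_gt(2) in auto)
  have b2: "sp.bottom_int holomorphic_on O2" by (rule holomorphic_on_subset[OF bottom_int_holo]) (use O_gt(2) in force)
  have "(\<lambda>w. (sp.line_int 1 (F w) - sp.line_int 1 w) + (sp.bottom_int (F w) - sp.bottom_int w)) holomorphic_on O2"
    by (intro holomorphic_on_add holomorphic_on_diff l b1 b2)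
  then have 2: "\<delta> holomorphic_on O2"
    by (rule holomorphic_transform) (simp add: \<delta>_O2 right_int_def)
  have "\<delta> holomorphic_on O1 \<union> O2"
    using 1 2 open_good by (intro holomorphic_on_Un) (auto simp: O1_def O2_def)
  then show ?thesis by (rule holomorphic_on_subset) (use cover in auto)
qed

lemma bottom_int_le: "R1 - 2 < cmod w \<Longrightarrow> cmod (sp.bottom_int w) \<le> 4 * Q * exp (- sp.k)"
proof -
  assume w: "R1 - 2 < cmod w"
  have "cmod (sp.seg_int (Complex (- 1) sp.k) (Complex 1 sp.k) w) \<le> 2 * Q * exp (- sp.k) / 1 * cmod (Complex 1
      sp.k - Complex (- 1) sp.k)"
    by (rule sp.seg_int_le[OF sp.hor_segment_T bottom_int_sep[OF w]]) (auto dest: sp.hor_segment(1))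
  moreover have "cmod (Complex 1 sp.k - Complex (- 1) sp.k) = 2" by (simp add: cmod_def)
  ultimately show ?thesis by (simp add: sp.bottom_int_def)
qed

text \<open>This makes infinity a removable singularity of \<delta>; the order of vanishing is found
  separately on the real axis.\<close>

lemma \<delta>_bounded: "\<exists>K. \<forall>w. R1 < cmod w \<longrightarrow> cmod (\<delta> w) \<le> K"
proof (intro exI allI impI)
  fix w assume R: "R1 < cmod w"
  define S where "S = suminf sp.mass"
  have b: "cmod (sp.bottom_int w) \<le> 4 * Q * exp (- sp.k)" "cmod (sp.bottom_int (F w)) \<le> 4 * Q * exp (- sp.k)"
    using R F_coord(3)[OF R] by (auto intro!: bottom_int_le)
  have Q: "0 \<le> 4 * Q * exp (- sp.k)" using sp.Q_nonneg by simp
  show "cmod (\<delta> w) \<le> 32 * S + 8 * Q * exp (- sp.k)"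
  proof (cases "w \<in> O1")
    case True
    have "cmod (sp.line_int (- 1) w) \<le> S / (1/16)" "cmod (sp.line_int (- 1) (F w)) \<le> S / (1/16)"
      unfolding S_def using O1_sep[OF True] by (intro sp.line_int_le; simp)+
    then show ?thesis
      using norm_triangle_ineq4[of "sp.line_int (- 1) (F w)" "sp.line_int (- 1) w"] True Q by (simp add: \<delta>_def)
  next
    case False
    then have O2: "w \<in> O2" using cover[OF R] by simp
    have l: "cmod (sp.line_int 1 w) \<le> S / (1/16)" "cmod (sp.line_int 1 (F w)) \<le> S / (1/16)"
      unfolding S_def using O2_sep[OF O2] by (intro sp.line_int_le; simp)+
    have "cmod (right_int (F w) - right_int w) \<le> cmod (right_int (F w)) + cmod (right_int w)"
        by (rule norm_triangle_ineq4)
    also have "\<dots> \<le> (cmod (sp.line_int 1 (F w)) + cmod (sp.bottom_int (F w))) + (cmod (sp.line_int 1 w) +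
        cmod (sp.bottom_int w))"
      unfolding right_int_def by (intro add_mono norm_triangle_ineq)
    finally show ?thesis using l b False by (simp add: \<delta>_def)
  qed
qed

section \<open>Decay along orbits and evaluation of the jump\<close>

lemma right_sep:
  assumes "Re u > 3" "\<bar>x\<bar> \<le> 1"
  shows "sp.sep x (Re u - 2) u"
  unfolding sp.sep_def
proof (intro conjI allI impI)
  fix y assume "y \<ge> sp.k"
  then have "\<bar>Re (\<Theta> (Complex x y)) - x\<bar> \<le> 1/8"
      using sp.\<Theta>_strip(1)[of "Complex x y"] assms by (simp add: sp.k_def)
  then have "Re (\<Theta> (Complex x y)) \<le> 2" using assms by linarith
  then have "Re (\<Theta> (Complex x y) - u) \<le> - (Re u - 2)" by simp
  then show "Re u - 2 \<le> cmod (\<Theta> (Complex x y) - u)"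
      using abs_Re_le_cmod[of "\<Theta> (Complex x y) - u"] by linarith
qed (use assms in auto)

lemma left_sep:
  assumes "Re u < - 3" "\<bar>x\<bar> \<le> 1"
  shows "sp.sep x (- Re u - 2) u"
  unfolding sp.sep_def
proof (intro conjI allI impI)
  fix y assume "y \<ge> sp.k"
  then have "\<bar>Re (\<Theta> (Complex x y)) - x\<bar> \<le> 1/8"
      using sp.\<Theta>_strip(1)[of "Complex x y"] assms by (simp add: sp.k_def)
  then have "Re (\<Theta> (Complex x y)) \<ge> - 2" using assms by linarith
  then have "Re (\<Theta> (Complex x y) - u) \<ge> - Re u - 2" by simp
  then show "- Re u - 2 \<le> cmod (\<Theta> (Complex x y) - u)"
      using abs_Re_le_cmod[of "\<Theta> (Complex x y) - u"] by linarith
qed (use assms in auto)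

lemma left_bottom_int_le:
  assumes "Re u < - 3"
  shows "cmod (sp.bottom_int u) \<le> 4 * Q * exp (- sp.k) / (- Re u - 2)"
proof -
  have "cmod (sp.seg_int (Complex (- 1) sp.k) (Complex 1 sp.k) u) \<le> 2 * Q * exp (- sp.k) / (- Re u - 2) * cmod
      (Complex 1 sp.k - Complex (- 1) sp.k)"
  proof (rule sp.seg_int_le[OF sp.hor_segment_T])
    fix \<zeta> assume z: "\<zeta> \<in> closed_segment (Complex (- 1) sp.k) (Complex 1 sp.k)"
    note h = sp.hor_segment[OF z]
    show "sp.k \<le> Im \<zeta>" using h by simp
    have "\<bar>Re (\<Theta> \<zeta>) - Re \<zeta>\<bar> \<le> 1/8" using sp.\<Theta>_strip(1)[of \<zeta>] h
        by (simp add: sp.k_def)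
    moreover have "\<bar>Re \<zeta>\<bar> \<le> 1" using h by simp
    ultimately have "Re (\<Theta> \<zeta>) \<ge> - 2" by linarith
    then have "Re (\<Theta> \<zeta> - u) \<ge> - Re u - 2" by simp
    then show "- Re u - 2 \<le> cmod (\<Theta> \<zeta> - u)" using abs_Re_le_cmod[of "\<Theta> \<zeta> - u"] by linarith
  qed (use assms in auto)
  moreover have "cmod (Complex 1 sp.k - Complex (- 1) sp.k) = 2" by (simp add: cmod_def)
  ultimately show ?thesis by (simp add: sp.bottom_int_def)
qed

text \<open>A large positive real w belongs to \<open>O1\<close>, and both w and F w have distance
  at least x / 2 from the left line. The difference estimate then yields |F w - w| / (x / 2)^2, and
  8 = 2 * 4.\<close>

lemma \<delta>_real_decay:
  assumes "x > 2 * R1"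
  shows "cmod (\<delta> (of_real x)) \<le> 8 * suminf sp.mass / x\<^sup>2"
proof -
  let ?w = "complex_of_real x"
  have x: "x > 62" using assms R1_ge by linarith
  have w: "R1 < cmod ?w" using assms R1_ge by simp
  have O1: "?w \<in> O1" using w by (simp add: O1_def good_def)
  have ReF: "Re (F ?w) > x" using F_coord(1)[OF w] unfolding Re_complex_of_real by linarith
  have sep_mono: "sp.sep a d' u" if "sp.sep a d u" "0 < d'" "d' \<le> d" for a d d' u
    using that unfolding sp.sep_def by force
  have s: "sp.sep (- 1) (x / 2) ?w" "sp.sep (- 1) (x / 2) (F ?w)"
    by (rule sep_mono[OF right_sep]; use x ReF in simp)+
  have S: "suminf sp.mass \<ge> 0" using sp.Q_nonneg by (intro suminf_nonneg sp.summable_mass) (simp add: sp.mass_def)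
  have "cmod (F ?w - ?w) \<le> 2"
    using norm_triangle_ineq[of "F ?w - ?w - 1" 1] F_near[OF w] by simp
  have "cmod (sp.line_int (- 1) (F ?w) - sp.line_int (- 1) ?w) \<le> suminf sp.mass * cmod (F ?w - ?w) / (x / 2)\<^sup>2"
    by (rule sp.line_int_diff_le[OF _ s]) simp
  also have "\<dots> \<le> suminf sp.mass * 2 / (x / 2)\<^sup>2"
    using S \<open>cmod (F ?w - ?w) \<le> 2\<close> by (intro divide_right_mono mult_left_mono) auto
  finally show ?thesis using O1 by (simp add: \<delta>_def power_divide)
qed

lemma \<delta>_germ:
  obtains p where "analytic_germ p" "fps_nth p 0 = 0" "fps_nth p 1 = 0"
    "\<And>w. R1 < cmod w \<Longrightarrow> eval_fps p (- 1 / w) = \<delta> w"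
proof -
  define r where "r = 1 / R1"
  have r: "r > 0" using R1_ge by (simp add: r_def)
  define f where "f = (\<lambda>z. \<delta> (- 1 / z))"
  have inv: "R1 < cmod (- 1 / z)" if "z \<noteq> 0" "cmod z < r" for z
    using that R1_ge by (simp add: r_def norm_divide field_simps)
  have hol: "f holomorphic_on ball 0 r - {0}"
    unfolding f_def by (intro holomorphic_on_compose_gen[OF _ \<delta>_holo, unfolded comp_def] holomorphic_intros)
        (use inv in auto)
  obtain K where K: "\<And>w. R1 < cmod w \<Longrightarrow> cmod (\<delta> w) \<le> K" using \<delta>_bounded by blast
  have "\<forall>\<^sub>F z in at 0. cmod (f z) \<le> K"
    unfolding eventually_at using r K inv by (intro exI[of _ r]) (auto simp: f_def)
  then obtain g where g: "g holomorphic_on ball 0 r" "\<And>z. z \<in> ball 0 r - {0} \<Longrightarrow> g z = f z"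
    using holomorphic_on_extend_bounded[OF hol] r by auto
  obtain p where p: "analytic_germ p" "\<And>t. cmod t < r \<Longrightarrow> eval_fps p t = g t"
    using has_germ[OF g(1) r] by metis
  have ev: "eval_fps p (- 1 / w) = \<delta> w" if "R1 < cmod w" for w
  proof -
    have "1 / cmod w < 1 / R1"
      using that R1_ge by (intro divide_strict_left_mono mult_pos_pos) linarith+
    then have "cmod (- 1 / w) < r" "w \<noteq> 0" using that R1_ge by (auto simp: r_def norm_divide)
    then show ?thesis using p(2)[of "- 1 / w"] g(2)[of "- 1 / w"] by (simp add: f_def)
  qed
  define x where "x = (\<lambda>n. 2 * R1 + 1 + real n)"
  have x: "x n > 2 * R1" "x n > 0" for n using R1_ge by (auto simp: x_def)
  define z where "z = (\<lambda>n. - 1 / complex_of_real (x n))"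
  have "filterlim x at_top sequentially"
    unfolding x_def by (intro filterlim_tendsto_add_at_top[OF tendsto_const] filterlim_real_sequentially)
  then have "(\<lambda>n. - 1 / x n) \<longlonglongrightarrow> 0" by (intro real_tendsto_divide_at_top[OF tendsto_const])
  then have "(\<lambda>n. complex_of_real (- 1 / x n)) \<longlonglongrightarrow> complex_of_real 0"
      by (rule tendsto_of_real)
  then have z0: "z \<longlonglongrightarrow> 0" by (simp add: z_def)
  have zn: "z n \<noteq> 0" for n using x(2)[of n] by (simp add: z_def)
  have "cmod (eval_fps p (z n)) \<le> (8 * suminf sp.mass) * (cmod (z n))\<^sup>2" for n
  proof -
    have "R1 < cmod (complex_of_real (x n))" using x[of n] R1_ge by simp
    then have "eval_fps p (z n) = \<delta> (of_real (x n))" unfolding z_def by (rule ev)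
    then show ?thesis using \<delta>_real_decay[OF x(1), of n] by (simp add: z_def norm_divide power_divide)
  qed
  then show ?thesis using germ_order_2I[OF p(1) z0 zn] that p(1) ev by metis
qed

lemma line_int_tendsto:
  assumes "para w > M0"
  shows "(\<lambda>n. sp.line_int (- 1) ((F ^^ n) w)) \<longlonglongrightarrow> 0"
proof (rule Lim_null_comparison)
  have t: "filterlim (\<lambda>n. (Re w - 5) + real n) at_top sequentially"
    by (intro filterlim_tendsto_add_at_top[OF tendsto_const] filterlim_real_sequentially)
  then show "(\<lambda>n. suminf sp.mass / ((Re w - 5) + real n)) \<longlonglongrightarrow> 0"
    by (intro real_tendsto_divide_at_top[OF tendsto_const])
  have S: "suminf sp.mass \<ge> 0" using sp.Q_nonneg by (intro suminf_nonneg sp.summable_mass) (simp add: sp.mass_def)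
  show "\<forall>\<^sub>F n in sequentially. norm (sp.line_int (- 1) ((F ^^ n) w)) \<le> suminf sp.mass / ((Re w - 5)
      + real n)"
    using filterlim_at_top_dense[THEN iffD1, OF t, rule_format, of 1]
  proof eventually_elim
    case (elim n)
    have R: "Re ((F ^^ n) w) - 2 \<ge> (Re w - 5) + real n" using fwd.Re_iter_ge[OF assms, of n] by simp
    have "cmod (sp.line_int (- 1) ((F ^^ n) w)) \<le> suminf sp.mass / (Re ((F ^^ n) w) - 2)"
      using R elim by (intro sp.line_int_le right_sep) auto
    also have "\<dots> \<le> suminf sp.mass / ((Re w - 5) + real n)"
      using R elim S by (intro divide_left_mono mult_pos_pos) auto
    finally show ?case by simp
  qed
qed

lemma right_int_tendsto:
  assumes "para w > M0"
  shows "(\<lambda>n. right_int (- (B ^^ n) w)) \<longlonglongrightarrow> 0"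
proof (rule Lim_null_comparison)
  define S where "S = suminf sp.mass + 4 * Q * exp (- sp.k)"
  have t: "filterlim (\<lambda>n. (Re w - 5) + real n) at_top sequentially"
    by (intro filterlim_tendsto_add_at_top[OF tendsto_const] filterlim_real_sequentially)
  then show "(\<lambda>n. S / ((Re w - 5) + real n)) \<longlonglongrightarrow> 0"
    by (intro real_tendsto_divide_at_top[OF tendsto_const])
  have "suminf sp.mass \<ge> 0" using sp.Q_nonneg by (intro suminf_nonneg sp.summable_mass) (simp add: sp.mass_def)
  then have S: "S \<ge> 0" using sp.Q_nonneg by (simp add: S_def)
  show "\<forall>\<^sub>F n in sequentially. norm (right_int (- (B ^^ n) w)) \<le> S / ((Re w - 5) + real n)"
    using filterlim_at_top_dense[THEN iffD1, OF t, rule_format, of 1]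
  proof eventually_elim
    case (elim n)
    let ?u = "- (B ^^ n) w"
    have R: "- Re ?u - 2 \<ge> (Re w - 5) + real n" using bwd.Re_iter_ge[OF assms, of n] by simp
    have "cmod (sp.line_int 1 ?u) \<le> suminf sp.mass / (- Re ?u - 2)"
      using R elim by (intro sp.line_int_le left_sep) auto
    moreover have "cmod (sp.bottom_int ?u) \<le> 4 * Q * exp (- sp.k) / (- Re ?u - 2)"
      using R elim by (intro left_bottom_int_le) auto
    ultimately have "cmod (right_int ?u) \<le> S / (- Re ?u - 2)"
      unfolding right_int_def S_def add_divide_distrib by (intro norm_triangle_le add_mono)
    also have "\<dots> \<le> S / ((Re w - 5) + real n)"
      using R elim S by (intro divide_left_mono mult_pos_pos) auto
    finally show ?case by simp
  qed
qed

text \<open>On the forward orbit \<delta> is the coboundary of the left integral, on the strict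
  backward orbit that of \<open>right_int\<close>. Both potentials tend to 0 along their orbits, so
  both sums telescope to the value at w.\<close>

lemma jump_eq_lines:
  assumes "para w > M0" "para (- w) > M0"
    and O1: "\<And>n. (F ^^ n) w \<in> O1" and O2: "\<And>n. - (B ^^ Suc n) (- w) \<in> O2"
  shows "jump F B \<delta> w = sp.line_int (- 1) w - right_int w"
proof -
  have "orbit_sum F \<delta> w = 0 - sp.line_int (- 1) w"
    using O1 by (intro orbit_sum_telescope line_int_tendsto assms(1)) (simp add: \<delta>_def)
  moreover have "orbit_sum B (\<lambda>w. \<delta> (- B w)) (- w) = 0 - (- right_int (- (- w)))"
  proof (rule orbit_sum_telescope[where A = "\<lambda>w. - right_int (- w)"])
    fix n
    have "F (- B ((B ^^ n) (- w))) = - (B ^^ n) (- w)"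
      by (rule FB[OF bwd.cmod_gt(1)[OF bwd.para_iter_gt[OF assms(2)]]])
    then show "\<delta> (- B ((B ^^ n) (- w))) = - right_int (- (B ^^ Suc n) (- w)) - - right_int (- (B ^^ n) (- w))"
      using \<delta>_O2[OF O2[of n]] by simp
  next
    have "(\<lambda>n. - right_int (- (B ^^ n) (- w))) \<longlonglongrightarrow> - 0"
        by (intro tendsto_minus right_int_tendsto assms(2))
    then show "(\<lambda>n. - right_int (- (B ^^ n) (- w))) \<longlonglongrightarrow> 0" by simp
  qed
  ultimately show ?thesis by (simp add: jump_def)
qed

text \<open>On the upper imaginary axis the Fatou coordinate has real part within 1/8 of 0. Wherever
  they pass through the strip, forward iterates have at least -1/8 and stay to the right of the band
  of \<open>O1\<close>, and strict backward iterates have at most -7/8 and stay to the left of the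
  band of \<open>O2\<close>. Orbits from the lower axis keep a negative imaginary part and meet no
  band.\<close>

lemma jump_\<delta>:
  assumes y: "y > M0 + 2 * R1 + 20"
  shows "jump F B \<delta> (\<i> * of_real y) = - 2 * of_real pi * \<i> * G (fatou F (\<i> * of_real y))"
    and "jump F B \<delta> (- \<i> * of_real y) = 0"
proof -
  have goodI: "w \<in> good lo hi" if "R1 < cmod w" "Im w \<ge> 5 \<Longrightarrow>
      \<bar>Re w\<bar> \<le> 6 \<Longrightarrow> Im w > Y + 3 \<Longrightarrow>
          Re (fatou F w) < lo \<or> Re (fatou F w) > hi" for w lo hi
    using that Im_large[OF that(1), of 6] Y_ge by (auto simp: good_def)
  have M0: "M0 > 0" by (rule fwd.height_bound_pos)
  have para: "para (\<i> * of_real y) = y" "para (- (\<i> * of_real y)) = y" using y M0 R1_ge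
      by (auto simp: para_def norm_mult)
  have yM: "y > M0" "y / 2 > R1" using y M0 R1_ge by auto
  have gtF: "R1 < cmod ((F ^^ n) w)" if "para w = y" for n w
    using fwd.cmod_iter_ge[of w n] that yM by linarith
  have gtB: "R1 < cmod ((B ^^ n) w)" if "para w = y" for n w
    using bwd.cmod_iter_ge[of w n] that yM by linarith
  have ImB: "\<bar>Im ((B ^^ n) w) - Im w\<bar> \<le> 3" if "para w = y" for n w
    using bwd.iter_near[of w n] that yM abs_Im_le_cmod[of "(B ^^ n) w - w - of_nat n"] by auto
  have ImF: "\<bar>Im ((F ^^ n) w) - Im w\<bar> \<le> 3" if "para w = y" for n w
    using fwd.iter_near[of w n] that yM abs_Im_le_cmod[of "(F ^^ n) w - w - of_nat n"] by auto
  {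
    let ?w = "\<i> * complex_of_real y"
    have fw: "\<bar>Re (fatou F ?w)\<bar> \<le> 1 / 8" using fatou_coord(1)[of ?w] y M0 R1_ge by auto
    have O1: "(F ^^ n) ?w \<in> O1" for n
      unfolding O1_def using gtF[OF para(1)]
    proof (rule goodI)
      have "fatou F ((F ^^ n) ?w) = fatou F ?w + of_nat n" using para yM by (intro fwd.fatou_iter) simp
      then have "Re (fatou F ((F ^^ n) ?w)) > - 3/4" using fw by simp
      then show "Re (fatou F ((F ^^ n) ?w)) < - 9/4 \<or> Re (fatou F ((F ^^ n) ?w)) > - 3/4" by simp
    qed
    \<comment> \<open>Running F along the backward orbit leads back to w, which expresses the Fatou
      coordinate of a backward iterate through that of w.\<close>
    have retr: "(F ^^ n) (- (B ^^ n) (- ?w)) = ?w" for n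
    proof (induction n)
      case (Suc n)
      have "F (- B ((B ^^ n) (- ?w))) = - (B ^^ n) (- ?w)"
        using para yM by (intro FB[OF bwd.cmod_gt(1)[OF bwd.para_iter_gt]]) simp
      then show ?case using Suc by (simp add: funpow_swap1)
    qed simp
    have O2: "- (B ^^ Suc n) (- ?w) \<in> O2" for n
      unfolding O2_def
    proof (rule goodI)
      let ?u = "- (B ^^ Suc n) (- ?w)"
      show "R1 < cmod ?u" using gtB[OF para(2), of "Suc n"] by (simp only: norm_minus_cancel)
      assume "\<bar>Re ?u\<bar> \<le> 6" "Im ?u > Y + 3"
      then have "para ?u > M0" by (intro sp.strip_para) auto
      then have "fatou F ((F ^^ Suc n) ?u) = fatou F ?u + of_nat (Suc n)" by (rule fwd.fatou_iter)
      then have "Re (fatou F ?w) = Re (fatou F ?u) + real (Suc n)" unfolding retr by simp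
      then have "Re (fatou F ?u) < - 1/4" using fw by linarith
      then show "Re (fatou F ?u) < - 1/4 \<or> Re (fatou F ?u) > 5/4" ..
    qed
    have w: "R1 < cmod ?w" "\<bar>Re ?w\<bar> < 10" "Im ?w > Y + 3" using yM R1_ge by (auto simp: norm_mult)
    have far: "sp.sep x (1 / 16) ?w" if "x = 1 \<or> x = - 1" for x
      unfolding sp.sep_def
    proof (intro conjI allI impI)
      fix v assume v: "v \<ge> sp.k"
      show "1 / 16 \<le> cmod (\<Theta> (Complex x v) - ?w)"
        using near_line(3)[of x v ?w] v that fw by (cases "cmod (\<Theta> (Complex x v) - ?w) < 1 / 16") auto
    qed simp
    have "right_int ?w - sp.line_int (- 1) ?w = 2 * of_real pi * \<i> * \<rho> ?w"
      using far w(1) by (intro line_int_gap) auto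
    moreover have "\<rho> ?w = G (fatou F ?w)" using w fw by (simp add: \<rho>_def)
    ultimately show "jump F B \<delta> ?w = - 2 * of_real pi * \<i> * G (fatou F ?w)"
      using jump_eq_lines[of ?w] para O1 O2 yM by (simp add: algebra_simps)
  }
  {
    let ?w = "- \<i> * complex_of_real y"
    have p: "para ?w = y" "para (- ?w) = y" using para by auto
    have O1: "(F ^^ n) ?w \<in> O1" for n
      unfolding O1_def using gtF[OF p(1)] ImF[OF p(1), of n] yM R1_ge by (intro goodI) auto
    have O2: "- (B ^^ Suc n) (- ?w) \<in> O2" for n
      unfolding O2_def
    proof (rule goodI)
      show "R1 < cmod (- (B ^^ Suc n) (- ?w))" using gtB[OF p(2), of "Suc n"] by (simp only: norm_minus_cancel)
    qed (use ImB[OF p(2), of "Suc n"] yM R1_ge in auto)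
    have w: "?w \<in> O1" "?w \<in> O2" using yM R1_ge by (auto simp: O1_def O2_def good_def norm_mult)
    have "right_int ?w - sp.line_int (- 1) ?w = 2 * of_real pi * \<i> * \<rho> ?w"
      using O1_sep(1)[OF w(1)] O2_sep(1)[OF w(2)] O_gt(1)[OF w(1)] by (intro line_int_gap) auto
    moreover have "\<rho> ?w = 0" using yM R1_ge Y_ge by (auto simp: \<rho>_def)
    ultimately show "jump F B \<delta> ?w = 0"
      using jump_eq_lines[of ?w] p O1 O2 yM by simp
  }
qed

end

text \<open>The jump is prescribed in one half-plane and kept zero in the other, so that the two
  half-planes can later be treated independently and superposed.\<close>

lemma (in parabolic) realize_upper:
  assumes q: "analytic_germ q" "fps_nth q 0 = 0"
  obtains p X D where "analytic_germ p" "fps_nth p 0 = 0" "fps_nth p 1 = 0"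
    "\<And>w. X < cmod w \<Longrightarrow> eval_fps p (- 1 / w) = D w"
    "\<And>y. y > X \<Longrightarrow> jump F B D (\<i> * of_real y) = eval_fps q (exp (2 * of_real pi * \<i> * fatou
        F (\<i> * of_real y)))"
    "\<And>y. y > X \<Longrightarrow> jump F B D (- \<i> * of_real y) = 0"
proof -
  have qr: "fps_conv_radius q > 0" using q by (simp add: analytic_germ_def)
  obtain r where r: "r > 0" "ereal r < fps_conv_radius q" using qr ereal_dense2[of 0 "fps_conv_radius q"]
    by (auto simp: zero_ereal_def)
  have rq: "ereal (cmod t) < fps_conv_radius q" if "cmod t \<le> r" for t :: complex
    using that r(2) by (metis ereal_less_eq(3) le_less_trans)
  have hq: "eval_fps q holomorphic_on cball 0 r"
    by (rule holomorphic_on_eval_fps) (use rq in auto)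
  have hs: "eval_fps (fps_shift 1 q) holomorphic_on cball 0 r"
    by (rule holomorphic_on_eval_fps) (use rq in auto)
  then have "compact (eval_fps (fps_shift 1 q) ` cball 0 r)"
    by (intro compact_continuous_image holomorphic_on_imp_continuous_on) auto
  then obtain A where A: "\<And>t. cmod t \<le> r \<Longrightarrow> cmod (eval_fps (fps_shift 1 q) t) \<le> A"
    using compact_imp_bounded bounded_iff by (metis (no_types, lifting) image_eqI mem_cball_0)
  have qle: "cmod (eval_fps q t) \<le> A * cmod t" if "cmod t \<le> r" for t
  proof -
    have "q = fps_X * fps_shift 1 q" using q(2) by (intro fps_ext) (simp add: fps_X_mult_nth)
    then have "eval_fps q t = eval_fps (fps_X * fps_shift 1 q) t" by simp
    also have "\<dots> = t * eval_fps (fps_shift 1 q) t"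
      using rq[OF that] by (subst eval_fps_mult) auto
    finally have "cmod (eval_fps q t) = cmod (eval_fps (fps_shift 1 q) t) * cmod t" by (simp add: norm_mult)
    then show ?thesis using mult_right_mono[OF A[OF that], of "cmod t"] by simp
  qed
  have A0: "A \<ge> 0" using A[of 0] r norm_ge_zero order_trans by (metis less_eq_real_def norm_zero)
  \<comment> \<open>Above height - ln r the exponential lies in the disc of radius r where q is
    bounded by A |t|; the value 10 is the lower bound for Y that the construction of \<delta> asks
    for.\<close>
  define L where "L = max 10 (- ln r)"
  obtain Y \<Theta> where st: "strip F C R Y \<Theta>" and Y: "Y > L" using fwd.strip_exists by blast
  have small: "cmod (exp (2 * of_real pi * \<i> * \<zeta>)) \<le> exp (- Im \<zeta>)" "cmod (exp (2 * of_real pi *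
      \<i> * \<zeta>)) < r"
    if "Im \<zeta> > Y" for \<zeta>
  proof -
    have pos: "Im \<zeta> > 10" "Im \<zeta> > - ln r" using that Y by (auto simp: L_def)
    have "1 * Im \<zeta> \<le> (2 * pi) * Im \<zeta>" using pos pi_gt3 by (intro mult_right_mono) auto
    then show 1: "cmod (exp (2 * of_real pi * \<i> * \<zeta>)) \<le> exp (- Im \<zeta>)" by simp
    have "exp (- Im \<zeta>) < exp (ln r)" using pos by (subst exp_less_cancel_iff) simp
    then have "exp (- Im \<zeta>) < r" using r by simp
    then show "cmod (exp (2 * of_real pi * \<i> * \<zeta>)) < r" by (rule le_less_trans[OF 1])
  qed
  \<comment> \<open>The factor compensates the - 2 pi i with which G enters the jump of
    \<delta>.\<close>
  define G where "G = (\<lambda>\<zeta>. eval_fps q (exp (2 * of_real pi * \<i> * \<zeta>)) * (- 1 / (2 * of_real pi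
      * \<i>)))"
  have "realization F B C R Y \<Theta> G A"
  proof (intro realization.intro parabolic_axioms strip_function.intro st strip_function_axioms.intro
      realization_axioms.intro, goal_cases)
    case 1
    have e: "(\<lambda>\<zeta>. exp (2 * of_real pi * \<i> * \<zeta>)) holomorphic_on {\<zeta>. Im \<zeta> > Y}"
        by (intro holomorphic_intros)
    have "(\<lambda>\<zeta>. eval_fps q (exp (2 * of_real pi * \<i> * \<zeta>))) holomorphic_on {\<zeta>. Im \<zeta> > Y}"
      by (rule holomorphic_on_compose_gen[OF e hq, unfolded comp_def]) (use small(2) in \<open>force\<close>)
    then show ?case unfolding G_def by (intro holomorphic_intros) auto
  next
    case (2 \<zeta>)
    have "exp (2 * of_real pi * \<i> * (\<zeta> + 1)) = exp (2 * of_real pi * \<i> * \<zeta>)"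
      by (simp add: algebra_simps exp_add)
    then show ?case by (simp add: G_def)
  next
    case (3 \<zeta>)
    have "cmod (G \<zeta>) = cmod (eval_fps q (exp (2 * of_real pi * \<i> * \<zeta>))) * (1 / (2 * pi))"
      by (simp add: G_def norm_mult norm_divide)
    also have "\<dots> \<le> cmod (eval_fps q (exp (2 * of_real pi * \<i> * \<zeta>))) * 1"
      using pi_gt3 by (intro mult_left_mono) auto
    also have "\<dots> \<le> A * cmod (exp (2 * of_real pi * \<i> * \<zeta>))"
        using qle[OF less_imp_le[OF small(2)[OF 3]]] by (simp only: mult_1_right)
    also have "\<dots> \<le> A * exp (- Im \<zeta>)" by (intro mult_left_mono small(1)[OF 3] A0)
    finally show ?case .
  next
    case 4 then show ?case using Y by (simp add: L_def)
  qed
  then interpret r: realization F B C R Y \<Theta> G A .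
  obtain p where p: "analytic_germ p" "fps_nth p 0 = 0" "fps_nth p 1 = 0"
    "\<And>w. r.R1 < cmod w \<Longrightarrow> eval_fps p (- 1 / w) = r.\<delta> w" using r.\<delta>_germ by blast
  define X where "X = M0 + 2 * r.R1 + 20"
  have X: "X \<ge> r.R1" using r.R1_ge fwd.height_bound_pos by (simp add: X_def)
  show ?thesis
  proof (rule that[OF p(1-3), of X "r.\<delta>"])
    show "eval_fps p (- 1 / w) = r.\<delta> w" if "X < cmod w" for w using p(4) X that by simp
    show "jump F B r.\<delta> (\<i> * of_real y) = eval_fps q (exp (2 * of_real pi * \<i> * fatou F (\<i> * of_real
        y)))" if "y > X" for y
      using r.jump_\<delta>(1)[of y] that by (simp add: X_def G_def)
    show "jump F B r.\<delta> (- \<i> * of_real y) = 0" if "y > X" for y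
      using r.jump_\<delta>(2)[of y] that by (simp add: X_def)
  qed
qed


section \<open>Complex conjugation and both half-planes\<close>

definition cnj_conj :: "(complex \<Rightarrow> complex) \<Rightarrow> complex \<Rightarrow> complex" where
  "cnj_conj h w = cnj (h (cnj w))"

definition fps_cnj :: "complex fps \<Rightarrow> complex fps" where
  "fps_cnj p = Abs_fps (\<lambda>n. cnj (fps_nth p n))"

lemma cnj_conj_cnj_conj [simp]: "cnj_conj (cnj_conj h) = h"
  by (simp add: cnj_conj_def fun_eq_iff)

lemma para_cnj [simp]: "para (cnj w) = para w"
  by (simp add: para_def)

lemma cnj_conj_funpow: "(cnj_conj F ^^ n) w = cnj ((F ^^ n) (cnj w))"
  by (induction n) (auto simp: cnj_conj_def)

lemma suminf_cnj: "summable f \<Longrightarrow> (\<Sum>n. cnj (f n)) = cnj (suminf f)"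
  by (metis sums_cnj sums_unique summable_sums)

lemma fps_conv_radius_cnj [simp]: "fps_conv_radius (fps_cnj p) = fps_conv_radius p"
proof -
  have "conv_radius (\<lambda>n. norm (fps_nth (fps_cnj p) n)) = conv_radius (\<lambda>n. norm (fps_nth p n))"
    by (simp add: fps_cnj_def)
  then show ?thesis unfolding fps_conv_radius_def by simp
qed

lemma analytic_germ_cnj [simp]: "analytic_germ (fps_cnj p) \<longleftrightarrow> analytic_germ p"
  by (simp add: analytic_germ_def)

lemma fps_cnj_nth [simp]: "fps_nth (fps_cnj p) n = cnj (fps_nth p n)"
  by (simp add: fps_cnj_def)

lemma eval_fps_cnj:
  assumes "ereal (cmod t) < fps_conv_radius p"
  shows "eval_fps (fps_cnj p) t = cnj (eval_fps p (cnj t))"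
proof -
  have "summable (\<lambda>n. fps_nth p n * cnj t ^ n)" using assms by (intro summable_fps) simp
  then show ?thesis unfolding eval_fps_def by (subst suminf_cnj[symmetric]) simp_all
qed

lemma holomorphic_cnj_conj:
  assumes "D holomorphic_on {w. R < cmod w}"
  shows "cnj_conj D holomorphic_on {w. R < cmod w}"
proof -
  have "cnj ` {w. R < cmod w} = {w. R < cmod w}"
    by (auto simp: image_iff) (metis complex_cnj_cnj complex_mod_cnj)
  moreover have "open {w :: complex. R < cmod w}" by (intro open_Collect_less continuous_intros)
  ultimately have "cnj \<circ> D \<circ> cnj holomorphic_on {w. R < cmod w}"
    using assms by (intro holomorphic_on_compose_cnj_cnj) auto
  then show ?thesis by (simp add: cnj_conj_def[abs_def] comp_def)
qed

lemma near_translation_cnj_conj: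
  assumes "near_translation F C R"
  shows "near_translation (cnj_conj F) C R"
proof -
  interpret near_translation F C R by fact
  show ?thesis
  proof
    fix w assume "R < cmod w"
    then have "cmod (F (cnj w) - cnj w - 1) \<le> C / (cmod (cnj w))\<^sup>2" by (intro dist_le) simp
    then show "cmod (cnj_conj F w - w - 1) \<le> C / (cmod w)\<^sup>2"
      by (metis cnj_conj_def complex_cnj_cnj complex_cnj_diff complex_cnj_one complex_mod_cnj)
  qed (use C_nonneg R_ge_1 holomorphic_cnj_conj[OF holo] in auto)
qed

lemma parabolic_cnj_conj:
  assumes "parabolic F B C R"
  shows "parabolic (cnj_conj F) (cnj_conj B) C R"
proof -
  interpret parabolic F B C R by fact
  show ?thesis
  proof (intro parabolic.intro near_translation_cnj_conj fwd.near_translation_axioms bwd.near_translation_axioms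
      parabolic_axioms.intro)
    show "cnj_conj B (- cnj_conj F w) = - w" if "R < cmod w" for w
      using BF[of "cnj w"] that by (simp add: cnj_conj_def)
    show "cnj_conj F (- cnj_conj B w) = - w" if "R < cmod w" for w
      using FB[of "cnj w"] that by (simp add: cnj_conj_def)
  qed
qed

lemma near_translation_mono:
  assumes "near_translation F C R" "C \<le> C'" "R \<le> R'"
  shows "near_translation F C' R'"
proof -
  interpret near_translation F C R by fact
  show ?thesis
  proof
    show "F holomorphic_on {w. R' < cmod w}" using assms(3) by (intro holomorphic_on_subset[OF holo]) auto
    show "cmod (F w - w - 1) \<le> C' / (cmod w)\<^sup>2" if "R' < cmod w" for w
      using dist_le[of w] assms that by (meson divide_right_mono le_less_trans order_trans zero_le_power2)
  qed (use assms C_nonneg R_ge_1 in auto)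
qed

lemma parabolic_mono:
  assumes "parabolic F B C R" "R \<le> R'"
  shows "parabolic F B C R'"
proof -
  interpret parabolic F B C R by fact
  show ?thesis
    using assms(2) BF FB
    by (intro parabolic.intro near_translation_mono[OF fwd.near_translation_axioms order_refl]
        near_translation_mono[OF bwd.near_translation_axioms order_refl] parabolic_axioms.intro) auto
qed

lemma (in near_translation) fatou_cnj_conj:
  assumes "para w > height_bound"
  shows "fatou (cnj_conj F) w = cnj (fatou F (cnj w))"
proof -
  have w: "para (cnj w) > height_bound" using assms by simp
  have "orbit_sum (cnj_conj F) (\<lambda>w. cnj_conj F w - w - 1) w = (\<Sum>n. cnj (F ((F ^^ n) (cnj w)) - (F ^^ n)
      (cnj w) - 1))"
    by (simp add: orbit_sum_def cnj_conj_funpow) (simp add: cnj_conj_def)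
  also have "\<dots> = cnj (orbit_sum F (\<lambda>w. F w - w - 1) (cnj w))"
    unfolding orbit_sum_def by (rule suminf_cnj[OF sums_summable[OF orbit_sum_sums[OF decay_F w]]])
  finally show ?thesis by (simp add: fatou_def)
qed

context parabolic
begin

text \<open>All points of both orbits have modulus at least half of the \<open>para\<close> value at
  the start, so only the right-hand side near infinity matters.\<close>

lemma jump_cong:
  assumes "para w > M0" "para (- w) > M0" "para w > 2 * X" "para (- w) > 2 * X"
    and "\<And>u. X < cmod u \<Longrightarrow> D u = D' u"
  shows "jump F B D w = jump F B D' w"
proof -
  have "D ((F ^^ n) w) = D' ((F ^^ n) w)" for n
    using fwd.cmod_iter_ge[OF assms(1), of n] assms(3) by (intro assms(5)) simp
  moreover have "D (- B ((B ^^ n) (- w))) = D' (- B ((B ^^ n) (- w)))" for n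
    using bwd.cmod_iter_ge[OF assms(2), of "Suc n"] assms(4) by (intro assms(5)) simp
  ultimately show ?thesis by (simp add: jump_def orbit_sum_def)
qed

context
  fixes D :: "complex \<Rightarrow> complex" and K :: real
  assumes D_le: "\<And>w. R < cmod w \<Longrightarrow> cmod (D w) \<le> K / (cmod w)\<^sup>2"
begin

lemma jump_cnj_conj:
  assumes "para w > M0" "para (- w) > M0"
  shows "jump (cnj_conj F) (cnj_conj B) (cnj_conj D) w = cnj (jump F B D (cnj w))"
proof -
  have w: "para (cnj w) > M0" "para (- cnj w) > M0" using assms by (simp_all flip: complex_cnj_minus)
  have "orbit_sum (cnj_conj F) (cnj_conj D) w = (\<Sum>n. cnj (D ((F ^^ n) (cnj w))))"
    by (simp add: orbit_sum_def cnj_conj_funpow) (simp add: cnj_conj_def)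
  also have "\<dots> = cnj (orbit_sum F D (cnj w))"
    unfolding orbit_sum_def by (rule suminf_cnj[OF sums_summable[OF fwd.orbit_sum_sums[OF decay_fwd[OF D_le] w(1)]]])
  finally have 1: "orbit_sum (cnj_conj F) (cnj_conj D) w = cnj (orbit_sum F D (cnj w))" .
  have "orbit_sum (cnj_conj B) (\<lambda>w. cnj_conj D (- cnj_conj B w)) (- w) = (\<Sum>n. cnj (D (- B ((B ^^ n) (-
      cnj w)))))"
    by (simp add: orbit_sum_def cnj_conj_funpow) (simp add: cnj_conj_def)
  also have "\<dots> = cnj (orbit_sum B (\<lambda>w. D (- B w)) (- cnj w))"
    unfolding orbit_sum_def by (rule suminf_cnj[OF sums_summable[OF bwd.orbit_sum_sums[OF decay_bwd[OF D_le] w(2)]]])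
  finally show ?thesis using 1 by (simp add: jump_def)
qed

lemma jump_add:
  assumes "para w > M0" "para (- w) > M0"
    and D'_le: "\<And>w. R < cmod w \<Longrightarrow> cmod (D' w) \<le> K' / (cmod w)\<^sup>2"
  shows "jump F B (\<lambda>w. D w + D' w) w = jump F B D w + jump F B D' w"
proof -
  have "orbit_sum F (\<lambda>w. D w + D' w) w = orbit_sum F D w + orbit_sum F D' w"
    unfolding orbit_sum_def
    by (rule suminf_add[symmetric, OF sums_summable[OF fwd.orbit_sum_sums[OF decay_fwd[OF D_le] assms(1)]]
          sums_summable[OF fwd.orbit_sum_sums[OF decay_fwd[OF D'_le] assms(1)]]])
  moreover have "orbit_sum B (\<lambda>w. D (- B w) + D' (- B w)) (- w) = orbit_sum B (\<lambda>w. D (- B w)) (- w) +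
      orbit_sum B (\<lambda>w. D' (- B w)) (- w)"
    unfolding orbit_sum_def
    by (rule suminf_add[symmetric, OF sums_summable[OF bwd.orbit_sum_sums[OF decay_bwd[OF D_le] assms(2)]]
          sums_summable[OF bwd.orbit_sum_sums[OF decay_bwd[OF D'_le] assms(2)]]])
  ultimately show ?thesis by (simp add: jump_def)
qed

text \<open>Complex conjugation carries the lower part of the lens to the upper one and exp (- 2 pi
  i fatou) to the conjugate of exp (2 pi i fatou) for the conjugated map.\<close>

lemma jump_germ_lower:
  assumes D: "D holomorphic_on {w. R < cmod w}"
  obtains q M where "analytic_germ q" "fps_nth q 0 = 0" "M \<ge> M0"
    "\<And>w. Im w < 0 \<Longrightarrow> para w > M \<Longrightarrow> para (- w) > M \<Longrightarrow>
       exp (- (2 * of_real pi * \<i> * fatou F w)) \<in> eball 0 (fps_conv_radius q) \<and>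
       jump F B D w = eval_fps q (exp (- (2 * of_real pi * \<i> * fatou F w)))"
proof -
  interpret c: parabolic "cnj_conj F" "cnj_conj B" C R by (rule parabolic_cnj_conj) unfold_locales
  have le: "cmod (cnj_conj D w) \<le> K / (cmod w)\<^sup>2" if "R < cmod w" for w
    using D_le[of "cnj w"] that by (simp add: cnj_conj_def)
  obtain q M where q: "analytic_germ q" "fps_nth q 0 = 0" "M \<ge> M0"
    "\<And>w. Im w > 0 \<Longrightarrow> para w > M \<Longrightarrow> para (- w) > M \<Longrightarrow>
       exp (2 * of_real pi * \<i> * fatou (cnj_conj F) w) \<in> eball 0 (fps_conv_radius q) \<and>
       jump (cnj_conj F) (cnj_conj B) (cnj_conj D) w = eval_fps q (exp (2 * of_real pi * \<i> * fatou (cnj_conj F) w))"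
    using c.jump_germ_upper[OF le holomorphic_cnj_conj[OF D]] by metis
  show ?thesis
  proof (rule that[of "fps_cnj q" M])
    fix w assume w: "Im w < 0" "para w > M" "para (- w) > M"
    have w': "para w > M0" "para (- w) > M0" using w q(3) by auto
    have m: "para (- cnj w) = para (- w)" by (simp add: para_def)
    let ?t = "exp (- (2 * of_real pi * \<i> * fatou F w))"
    have f: "fatou (cnj_conj F) (cnj w) = cnj (fatou F w)" using w' by (subst fwd.fatou_cnj_conj) auto
    have t: "exp (2 * of_real pi * \<i> * fatou (cnj_conj F) (cnj w)) = cnj ?t"
      unfolding f by (simp add: exp_cnj)
    have j: "jump (cnj_conj F) (cnj_conj B) (cnj_conj D) (cnj w) = cnj (jump F B D w)" using w' m
        by (subst jump_cnj_conj) auto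
    have "cnj ?t \<in> eball 0 (fps_conv_radius q)" "cnj (jump F B D w) = eval_fps q (cnj ?t)"
      using q(4)[of "cnj w"] w m unfolding t j by auto
    then have 1: "ereal (cmod ?t) < fps_conv_radius q" and 2: "jump F B D w = cnj (eval_fps q (cnj ?t))"
      by (auto simp del: norm_exp_eq_Re) (metis complex_cnj_cnj)
    show "?t \<in> eball 0 (fps_conv_radius (fps_cnj q)) \<and> jump F B D w = eval_fps (fps_cnj q) ?t"
      using 1 2 by (simp del: norm_exp_eq_Re add: eval_fps_cnj)
  qed (use q in auto)
qed

end

end

section \<open>Bounds for germs near 0 and superposition of the two half-planes\<close>

lemma germ_le:
  assumes "analytic_germ p" "\<And>i. i < n \<Longrightarrow> fps_nth p i = 0"
  obtains K r where "r > 0" "K \<ge> 0" "ereal r < fps_conv_radius p" "\<And>z. cmod z \<le> r \<Longrightarrow> cmod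
      (eval_fps p z) \<le> K * cmod z ^ n"
proof -
  have "fps_conv_radius p > 0" using assms by (simp add: analytic_germ_def)
  then obtain r where r: "r > 0" "ereal r < fps_conv_radius p" using ereal_dense2[of 0 "fps_conv_radius p"]
    by (auto simp: zero_ereal_def)
  have rq: "ereal (cmod t) < fps_conv_radius p" if "cmod t \<le> r" for t :: complex
    using that r(2) by (metis ereal_less_eq(3) le_less_trans)
  have "eval_fps (fps_shift n p) holomorphic_on cball 0 r"
    by (rule holomorphic_on_eval_fps) (use rq in auto)
  then have "compact (eval_fps (fps_shift n p) ` cball 0 r)"
    by (intro compact_continuous_image holomorphic_on_imp_continuous_on) auto
  then obtain A where A: "\<And>t. cmod t \<le> r \<Longrightarrow> cmod (eval_fps (fps_shift n p) t) \<le> A"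
    using compact_imp_bounded bounded_iff by (metis (no_types, lifting) image_eqI mem_cball_0)
  have A0: "A \<ge> 0" using A[of 0] r norm_ge_zero order_trans by (metis less_eq_real_def norm_zero)
  show ?thesis
  proof (rule that[OF r(1) A0 r(2)])
    fix t :: complex assume t: "cmod t \<le> r"
    have "p = fps_X ^ n * fps_shift n p"
      using assms(2) by (intro fps_ext) (simp add: fps_X_power_mult_nth)
    then have "eval_fps p t = eval_fps (fps_X ^ n * fps_shift n p) t" by simp
    also have "\<dots> = t ^ n * eval_fps (fps_shift n p) t" using rq[OF t] by (subst eval_fps_mult) auto
    finally have "cmod (eval_fps p t) = cmod (eval_fps (fps_shift n p) t) * cmod t ^ n" by (simp add: norm_mult norm_power)
    then show "cmod (eval_fps p t) \<le> A * cmod t ^ n" using mult_right_mono[OF A[OF t], of "cmod t ^ n"] by simp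
  qed
qed

lemma germ_decay:
  assumes "analytic_germ p" "fps_nth p 0 = 0" "fps_nth p 1 = 0"
  obtains K X where "X \<ge> 1" "\<And>w. X \<le> cmod w \<Longrightarrow> ereal (cmod (1 / w)) < fps_conv_radius p"
    "\<And>w. X \<le> cmod w \<Longrightarrow> cmod (eval_fps p (- 1 / w)) \<le> K / (cmod w)\<^sup>2"
    "(\<lambda>w. eval_fps p (- 1 / w)) holomorphic_on {w. X < cmod w}"
proof -
  obtain K r where r: "r > 0" "K \<ge> 0" "ereal r < fps_conv_radius p" "\<And>z. cmod z \<le> r \<Longrightarrow>
      cmod (eval_fps p z) \<le> K * cmod z ^ 2"
  proof -
    have "fps_nth p i = 0" if "i < 2" for i using that assms(2,3) by (auto simp: less_2_cases_iff)
    then show ?thesis using germ_le[OF assms(1), of 2] that by metis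
  qed
  define X where "X = max 1 (1 / r)"
  have le: "cmod (1 / w) \<le> r" "w \<noteq> 0" if "X \<le> cmod w" for w
  proof -
    have "1 / r \<le> cmod w" "1 \<le> cmod w" using that by (auto simp: X_def)
    moreover from this have "cmod w > 0" by linarith
    ultimately show "cmod (1 / w) \<le> r" "w \<noteq> 0" using r(1) by (auto simp: norm_divide field_simps)
  qed
  have conv: "ereal (cmod (1 / w)) < fps_conv_radius p" if "X \<le> cmod w" for w
    using le[OF that] r(3) by (metis ereal_less_eq(3) le_less_trans)
  show ?thesis
  proof (rule that[of X K])
    show "cmod (eval_fps p (- 1 / w)) \<le> K / (cmod w)\<^sup>2" if "X \<le> cmod w" for w
      using r(4)[of "- 1 / w"] le[OF that] by (simp add: norm_divide power_divide)
    have "(\<lambda>w. - 1 / w) holomorphic_on {w. X < cmod w}"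
      by (intro holomorphic_intros) (auto simp: X_def)
    moreover have "eval_fps p holomorphic_on eball 0 (fps_conv_radius p)" by (intro holomorphic_on_eval_fps) auto
    ultimately show "(\<lambda>w. eval_fps p (- 1 / w)) holomorphic_on {w. X < cmod w}"
      by (rule holomorphic_on_compose_gen[unfolded comp_def])
         (use conv in \<open>auto simp: norm_divide dest: less_imp_le\<close>)
  qed (use conv in \<open>auto simp: X_def\<close>)
qed

text \<open>The jump is additive in the right-hand side. For the lower half-plane the conjugate of -
  g0 is realized over the conjugated map; the minus sign appears because g0 describes
  \<open>R_- - R_+\<close>, while the jump is \<open>R_+ - R_-\<close>.\<close>

lemma (in parabolic) realize:
  assumes g: "analytic_germ gi" "fps_nth gi 0 = 0" "analytic_germ g0" "fps_nth g0 0 = 0"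
  obtains p X where "analytic_germ p" "fps_nth p 0 = 0" "fps_nth p 1 = 0"
    "\<And>y. y > X \<Longrightarrow> jump F B (\<lambda>w. eval_fps p (- 1 / w)) (\<i> * of_real y) =
        eval_fps gi (exp (2 * of_real pi * \<i> * fatou F (\<i> * of_real y)))"
    "\<And>y. y > X \<Longrightarrow> jump F B (\<lambda>w. eval_fps p (- 1 / w)) (- \<i> * of_real y) =
        - eval_fps g0 (exp (- (2 * of_real pi * \<i> * fatou F (- \<i> * of_real y))))"
proof -
  obtain p1 X1 D1 where p1: "analytic_germ p1" "fps_nth p1 0 = 0" "fps_nth p1 1 = 0"
    "\<And>w. X1 < cmod w \<Longrightarrow> eval_fps p1 (- 1 / w) = D1 w"
    "\<And>y. y > X1 \<Longrightarrow> jump F B D1 (\<i> * of_real y) = eval_fps gi (exp (2 * of_real pi * \<i> *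
        fatou F (\<i> * of_real y)))"
    "\<And>y. y > X1 \<Longrightarrow> jump F B D1 (- \<i> * of_real y) = 0"
    using realize_upper[OF g(1,2)] by metis
  interpret c: parabolic "cnj_conj F" "cnj_conj B" C R by (rule parabolic_cnj_conj) unfold_locales
  have gc: "analytic_germ (fps_cnj (- g0))" "fps_nth (fps_cnj (- g0)) 0 = 0"
    using g by (auto simp: analytic_germ_def)
  obtain p2 X2 D2 where p2: "analytic_germ p2" "fps_nth p2 0 = 0" "fps_nth p2 1 = 0"
    "\<And>w. X2 < cmod w \<Longrightarrow> eval_fps p2 (- 1 / w) = D2 w"
    "\<And>y. y > X2 \<Longrightarrow> jump (cnj_conj F) (cnj_conj B) D2 (\<i> * of_real y) = eval_fps (fps_cnj (-
        g0)) (exp (2 * of_real pi * \<i> * fatou (cnj_conj F) (\<i> * of_real y)))"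
    "\<And>y. y > X2 \<Longrightarrow> jump (cnj_conj F) (cnj_conj B) D2 (- \<i> * of_real y) = 0"
    using c.realize_upper[OF gc] by metis
  define p where "p = p1 + fps_cnj p2"
  define E1 E2 where "E1 = (\<lambda>w. eval_fps p1 (- 1 / w))" and "E2 = (\<lambda>w. eval_fps p2 (- 1 / w))"
  obtain K1 Y1 where Y1: "Y1 \<ge> 1" "\<And>w. Y1 \<le> cmod w \<Longrightarrow> ereal (cmod (1 / w)) < fps_conv_radius p1"
    "\<And>w. Y1 \<le> cmod w \<Longrightarrow> cmod (E1 w) \<le> K1 / (cmod w)\<^sup>2"
    unfolding E1_def using germ_decay[OF p1(1-3)] by metis
  obtain K2 Y2 where Y2: "Y2 \<ge> 1" "\<And>w. Y2 \<le> cmod w \<Longrightarrow> ereal (cmod (1 / w)) < fps_conv_radius p2"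
    "\<And>w. Y2 \<le> cmod w \<Longrightarrow> cmod (E2 w) \<le> K2 / (cmod w)\<^sup>2"
    unfolding E2_def using germ_decay[OF p2(1-3)] by metis
  have gr: "fps_conv_radius g0 > 0" using g by (simp add: analytic_germ_def)
  obtain r where r: "r > 0" "ereal r < fps_conv_radius g0" using gr ereal_dense2[of 0 "fps_conv_radius g0"]
    by (auto simp: zero_ereal_def)
  define R' where "R' = max R (max Y1 Y2)"
  have R': "R \<le> R'" "Y1 \<le> R'" "Y2 \<le> R'" by (auto simp: R'_def)
  interpret P: parabolic F B C R' by (rule parabolic_mono[OF _ R'(1)]) unfold_locales
  define cE2 where "cE2 = cnj_conj E2"
  have E2': "E2 = cnj_conj cE2" by (simp add: cE2_def)
  have le1: "cmod (E1 w) \<le> K1 / (cmod w)\<^sup>2" if "R' < cmod w" for w using Y1(3)[of w] that R' by auto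
  have le2: "cmod (cE2 w) \<le> K2 / (cmod w)\<^sup>2" if "R' < cmod w" for w
    using Y2(3)[of "cnj w"] that R' by (auto simp: cE2_def cnj_conj_def)
  define X where "X = Max {P.M0, 2 * X1, 2 * X2, 2 * R', X1, X2, 3 - ln r}"
  have "\<forall>a\<in>{P.M0, 2 * X1, 2 * X2, 2 * R', X1, X2, 3 - ln r}. a \<le> X" unfolding X_def
      by (intro ballI Max_ge) auto
  then have X: "P.M0 \<le> X" "2 * X1 \<le> X" "2 * X2 \<le> X" "2 * R' \<le> X" "X1 \<le> X" "X2 \<le> X" "3 - ln r
      \<le> X" by auto
  have para: "para (\<i> * of_real y) = y" "para (- (\<i> * of_real y)) = y" if "y > X" for y
    using that X(1) P.fwd.height_bound_pos by (auto simp: para_def norm_mult)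
  have sum: "eval_fps p (- 1 / w) = E1 w + cE2 w" if "R' < cmod w" for w
  proof -
    have w: "Y1 \<le> cmod w" "Y2 \<le> cmod w" using that R' by auto
    have c: "ereal (cmod (- 1 / w)) < fps_conv_radius p1" "ereal (cmod (- 1 / w)) < fps_conv_radius p2"
      using Y1(2)[OF w(1)] Y2(2)[OF w(2)] by (auto simp: norm_divide)
    have "eval_fps p (- 1 / w) = E1 w + eval_fps (fps_cnj p2) (- 1 / w)"
      unfolding p_def E1_def using c by (subst eval_fps_add) auto
    also have "eval_fps (fps_cnj p2) (- 1 / w) = cE2 w"
      using eval_fps_cnj[OF c(2)] by (simp add: cE2_def cnj_conj_def E2_def)
    finally show ?thesis .
  qed
  have split: "jump F B (\<lambda>w. eval_fps p (- 1 / w)) w = jump F B D1 w + cnj (jump (cnj_conj F) (cnj_conj B) D2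
      (cnj w))"
    if "para w > X" "para (- w) > X" for w
  proof -
    have w: "para w > P.M0" "para (- w) > P.M0" "para w > 2 * R'" "para (- w) > 2 * R'"
      "para w > 2 * X1" "para (- w) > 2 * X1" "para (cnj w) > 2 * X2" "para (- cnj w) > 2 * X2"
      using that X by (auto simp: para_def)
    interpret Q: parabolic "cnj_conj F" "cnj_conj B" C R' by (rule parabolic_cnj_conj) unfold_locales
    have cw: "para (cnj w) > P.M0" "para (- cnj w) > P.M0" using w(1,2) by (auto simp: para_def)
    have "jump F B (\<lambda>w. E1 w + cE2 w) w = jump F B (\<lambda>w. eval_fps p (- 1 / w)) w"
      by (rule P.jump_cong[OF w(1-4)]) (rule sum[symmetric])
    then have "jump F B (\<lambda>w. eval_fps p (- 1 / w)) w = jump F B E1 w + jump F B cE2 w"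
      using P.jump_add[OF le1 w(1,2) le2] by simp
    also have "jump F B E1 w = jump F B D1 w"
      by (rule P.jump_cong[OF w(1,2,5,6)]) (use p1(4) in \<open>auto simp: E1_def\<close>)
    also have "jump F B cE2 w = cnj (jump (cnj_conj F) (cnj_conj B) E2 (cnj w))"
      using P.jump_cnj_conj[OF le2 cw] by (simp add: E2'[symmetric])
    also have "jump (cnj_conj F) (cnj_conj B) E2 (cnj w) = jump (cnj_conj F) (cnj_conj B) D2 (cnj w)"
      by (rule Q.jump_cong[OF cw w(7,8)]) (use p2(4) in \<open>auto simp: E2_def\<close>)
    finally show ?thesis .
  qed
  show ?thesis
  proof (rule that[of p X])
    show "analytic_germ p"
      using p1(1) p2(1) fps_conv_radius_add[of p1 "fps_cnj p2"] unfolding analytic_germ_def p_def fps_conv_radius_cnj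
      by (metis less_le_trans min_less_iff_conj)
    show "fps_nth p 0 = 0" "fps_nth p 1 = 0" using p1 p2 by (auto simp: p_def)
    fix y assume y: "y > X"
    have s: "jump F B (\<lambda>w. eval_fps p (- 1 / w)) (\<i> * of_real y) = jump F B D1 (\<i> * of_real y) + cnj
        (jump (cnj_conj F) (cnj_conj B) D2 (- \<i> * of_real y))"
      using split[of "\<i> * of_real y"] para[OF y] y by simp
    then show "jump F B (\<lambda>w. eval_fps p (- 1 / w)) (\<i> * of_real y) =
        eval_fps gi (exp (2 * of_real pi * \<i> * fatou F (\<i> * of_real y)))"
      using p1(5)[of y] p2(6)[of y] y X by simp
    let ?t = "exp (- (2 * of_real pi * \<i> * fatou F (- \<i> * of_real y)))"
    have fn: "cmod (fatou F (- \<i> * of_real y) - (- \<i> * of_real y)) \<le> 3" using para[OF y] y X(1)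
        by (intro P.fwd.fatou_near3) auto
    have f: "fatou (cnj_conj F) (\<i> * of_real y) = cnj (fatou F (- \<i> * of_real y))"
      using para[OF y] y X(1) by (subst P.fwd.fatou_cnj_conj) auto
    have t: "exp (2 * of_real pi * \<i> * fatou (cnj_conj F) (\<i> * of_real y)) = cnj ?t"
      unfolding f by (simp add: exp_cnj)
    have Im: "Im (fatou F (- \<i> * of_real y)) \<le> - y + 3"
        using fn abs_Im_le_cmod[of "fatou F (- \<i> * of_real y) - (- \<i> * of_real y)"] by auto
    have rr: "ereal (cmod ?t) < fps_conv_radius g0"
    proof -
      have "1 * (y - 3) \<le> (2 * pi) * (- Im (fatou F (- \<i> * of_real y)))"
        using Im pi_gt3 y X P.fwd.height_bound_ge(1) by (intro mult_mono) auto
      then have "cmod ?t \<le> exp (- (y - 3))" by simp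
      also have "\<dots> < exp (ln r)" using y X by (subst exp_less_cancel_iff) auto
      finally have "cmod ?t < r" using r by simp
      then have "ereal (cmod ?t) < ereal r" by (simp only: less_ereal.simps)
      then show ?thesis using r(2) by (rule less_trans)
    qed
    have "jump F B (\<lambda>w. eval_fps p (- 1 / w)) (- \<i> * of_real y) = jump F B D1 (- \<i> * of_real y) + cnj
        (jump (cnj_conj F) (cnj_conj B) D2 (\<i> * of_real y))"
      using split[of "- \<i> * of_real y"] para[OF y] y by simp
    also have "\<dots> = cnj (eval_fps (fps_cnj (- g0)) (cnj ?t))"
      using p1(6)[of y] p2(5)[of y] y X unfolding t by simp
    also have "\<dots> = eval_fps (- g0) ?t"
      using rr by (subst eval_fps_cnj) auto
    also have "\<dots> = - eval_fps g0 ?t" using rr by (subst eval_fps_minus) auto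
    finally show "jump F B (\<lambda>w. eval_fps p (- 1 / w)) (- \<i> * of_real y) = - eval_fps g0 ?t" .
  qed
qed


section \<open>Prenormalized germs in the chart at infinity\<close>

lemma analytic_germ_iff: "analytic_germ p \<longleftrightarrow> eval_fps p has_fps_expansion p"
  unfolding analytic_germ_def has_fps_expansion_def by auto

lemma germ_expansion:
  assumes "h has_fps_expansion p"
  shows "analytic_germ p" "\<forall>\<^sub>F z in nhds 0. eval_fps p z = h z"
  using assms by (auto simp: has_fps_expansion_def analytic_germ_def)

lemma germ_compose:
  assumes "analytic_germ p" "analytic_germ q" "fps_nth q 0 = 0"
  shows "analytic_germ (p oo q)" "\<forall>\<^sub>F z in nhds 0. eval_fps (p oo q) z = eval_fps p (eval_fps q z)"
  using germ_expansion[OF has_fps_expansion_compose[of "eval_fps p" p "eval_fps q" q]] assms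
  by (simp_all add: analytic_germ_iff)

lemma germ_diff:
  assumes "analytic_germ p" "analytic_germ q"
  shows "analytic_germ (p - q)" "\<forall>\<^sub>F z in nhds 0. eval_fps (p - q) z = eval_fps p z - eval_fps q z"
  using germ_expansion[OF has_fps_expansion_diff[of "eval_fps p" p "eval_fps q" q]] assms
  by (simp_all add: analytic_germ_iff)

lemma germ_minus:
  assumes "analytic_germ p"
  shows "analytic_germ (- p)" "\<forall>\<^sub>F z in nhds 0. eval_fps (- p) z = - eval_fps p z"
  using germ_expansion[OF has_fps_expansion_minus[of "eval_fps p" p]] assms
  by (simp_all add: analytic_germ_iff)

lemma germ_isCont: "analytic_germ p \<Longrightarrow> isCont (eval_fps p) 0"
  using continuous_eval_fps[of 0 p UNIV] by (simp add: zero_ereal_def analytic_germ_def)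

lemma germ_filterlim:
  assumes "analytic_germ p" "fps_nth p 0 = 0"
  shows "filterlim (eval_fps p) (nhds 0) (nhds 0)"
  using germ_isCont[OF assms(1)] assms(2) unfolding continuous_at eval_fps_at_0
  by (metis assms(2) eval_fps_at_0 germ_isCont[OF assms(1)] isCont_def tendsto_at_iff_tendsto_nhds)

lemma eventually_germ:
  assumes "analytic_germ p" "fps_nth p 0 = 0" "\<forall>\<^sub>F z in nhds 0. P z"
  shows "\<forall>\<^sub>F z in nhds 0. P (eval_fps p z)"
  using eventually_compose_filterlim[OF assms(3) germ_filterlim[OF assms(1,2)]] .

lemma eventually_uminus_nhds_0:
  fixes P :: "complex \<Rightarrow> bool"
  shows "\<forall>\<^sub>F z in nhds 0. P z \<Longrightarrow> \<forall>\<^sub>F z in nhds 0. P (- z)"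
  using tendsto_minus[of "\<lambda>x. x" 0 "nhds (0::complex)"]
  by (intro eventually_compose_filterlim[where f = uminus]) (auto simp: filterlim_ident)

lemma eventually_nhds_0_at_infinity:
  fixes P :: "complex \<Rightarrow> bool"
  assumes "\<forall>\<^sub>F z in nhds 0. P z"
  obtains X where "X \<ge> 1" "\<And>w. X < cmod w \<Longrightarrow> P (- 1 / w)"
proof -
  obtain r where r: "r > 0" "\<And>z. cmod z < r \<Longrightarrow> P z"
    using assms unfolding eventually_nhds_metric by (auto simp: dist_norm)
  show ?thesis
  proof (rule that[of "max 1 (1 / r)"])
    fix w assume w: "max 1 (1 / r) < cmod w"
    then have "cmod w > 0" "1 / r < cmod w" by auto
    then show "P (- 1 / w)" using r by (intro r(2)) (simp add: norm_divide field_simps)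
  qed simp
qed

text \<open>The local holomorphic inverse has a convergent expansion G with G oo f =
  \<open>fps_X\<close>, and a formal compositional inverse is unique.\<close>

lemma germ_fps_inv:
  assumes f: "analytic_germ f" "fps_nth f 0 = 0" "fps_nth f 1 \<noteq> 0"
  shows "analytic_germ (fps_inv f)"
proof -
  define S where "S = eball (0::complex) (fps_conv_radius f)"
  have S: "0 \<in> S" "open S" using f(1) by (auto simp: S_def analytic_germ_def zero_ereal_def)
  have hol: "eval_fps f holomorphic_on S" by (intro holomorphic_on_eval_fps) (simp add: S_def)
  have "(eval_fps f has_field_derivative eval_fps (fps_deriv f) 0) (at 0)"
    using f(1) by (intro has_field_derivative_eval_fps) (auto simp: analytic_germ_def zero_ereal_def)
  then have "deriv (eval_fps f) 0 \<noteq> 0"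
    using f(3) by (simp add: DERIV_imp_deriv eval_fps_at_0)
  then obtain r where r: "r > 0" "ball 0 r \<subseteq> S" "inj_on (eval_fps f) (ball 0 r)"
    using has_complex_derivative_locally_injective[OF hol S] by metis
  have hol': "eval_fps f holomorphic_on ball 0 r" using hol r(2) holomorphic_on_subset by blast
  obtain g where g: "g holomorphic_on (eval_fps f ` ball 0 r)" "\<And>z. z \<in> ball 0 r \<Longrightarrow>
      g (eval_fps f z) = z"
    using holomorphic_has_inverse[OF hol' open_ball r(3)] by metis
  have o: "open (eval_fps f ` ball 0 r)" by (rule open_mapping_thm3[OF hol' open_ball r(3)])
  have "eval_fps f 0 = 0" using f(2) by (simp add: eval_fps_at_0)
  then have z: "0 \<in> eval_fps f ` ball 0 r" using r(1) by force
  define G where "G = fps_expansion g 0"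
  have G: "g has_fps_expansion G" unfolding G_def by (rule has_fps_expansion_fps_expansion[OF o z g(1)])
  have comp: "(g \<circ> eval_fps f) has_fps_expansion (G oo f)"
    using f by (intro has_fps_expansion_compose G) (auto simp: analytic_germ_iff)
  have "\<forall>\<^sub>F z in nhds 0. (g \<circ> eval_fps f) z = z"
    using r(1) g(2) unfolding eventually_nhds_metric by (intro exI[of _ r]) auto
  then have "(\<lambda>z. z) has_fps_expansion (G oo f)"
    using comp has_fps_expansion_cong[of "g \<circ> eval_fps f" "\<lambda>z. z" "G oo f" "G oo f"] by simp
  then have "G oo f = fps_X" using has_fps_expansion_fps_X fps_expansion_unique_complex by blast
  also have "\<dots> = fps_inv f oo f" using fps_inv[OF f(2,3)] by simp
  finally have "G = fps_inv f" using fps_compose_inj_right[OF f(2,3)] by blast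
  then show ?thesis using germ_expansion(1)[OF G] by simp
qed

lemma fps_inv_nth_0_1:
  assumes "fps_nth f 0 = (0::complex)" "fps_nth f 1 = 1"
  shows "fps_nth (fps_inv f) 0 = 0" "fps_nth (fps_inv f) 1 = 1"
  using assms by (simp_all add: fps_inv_def)

lemma germ_inv_eval:
  assumes f: "analytic_germ f" "fps_nth f 0 = 0" "fps_nth f 1 = 1"
  shows "\<forall>\<^sub>F z in nhds 0. eval_fps (fps_inv f) (eval_fps f z) = z"
    and "\<forall>\<^sub>F z in nhds 0. eval_fps f (eval_fps (fps_inv f) z) = z"
proof -
  have f1: "fps_nth f 1 \<noteq> 0" using f(3) by simp
  note i = germ_fps_inv[OF f(1,2) f1] fps_inv_nth_0_1[OF f(2,3)]
  show "\<forall>\<^sub>F z in nhds 0. eval_fps (fps_inv f) (eval_fps f z) = z"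
    using germ_compose(2)[OF i(1) f(1,2)] unfolding fps_inv[OF f(2) f1]
    by eventually_elim (metis eval_fps_X)
  show "\<forall>\<^sub>F z in nhds 0. eval_fps f (eval_fps (fps_inv f) z) = z"
    using germ_compose(2)[OF f(1) i(1,2)] unfolding fps_inv_right[OF f(2) f1]
    by eventually_elim (metis eval_fps_X)
qed

lemma compose_nth_3:
  fixes p q :: "complex fps"
  assumes "fps_nth q 0 = 0"
  shows "fps_nth (p oo q) 1 = fps_nth p 1 * fps_nth q 1"
    "fps_nth (p oo q) 2 = fps_nth p 1 * fps_nth q 2 + fps_nth p 2 * (fps_nth q 1)\<^sup>2"
    "fps_nth (p oo q) 3 = fps_nth p 1 * fps_nth q 3 + 2 * fps_nth p 2 * fps_nth q 1 * fps_nth q 2 + fps_nth p 3 *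
        (fps_nth q 1) ^ 3"
proof -
  have s: "{0..1::nat} = {0, 1}" "{0..2::nat} = {0, 1, 2}" "{0..3::nat} = {0, 1, 2, 3}" by auto
  have q2: "fps_nth (q ^ 2) 3 = 2 * fps_nth q 1 * fps_nth q 2"
    using assms by (simp add: power2_eq_square fps_mult_nth s)
  show "fps_nth (p oo q) 1 = fps_nth p 1 * fps_nth q 1"
    by (simp add: fps_compose_nth s del: atLeastAtMost_singleton)
  show "fps_nth (p oo q) 2 = fps_nth p 1 * fps_nth q 2 + fps_nth p 2 * (fps_nth q 1)\<^sup>2"
    using startsby_zero_power_nth_same[OF assms, of 2] by (simp add: fps_compose_nth s)
  show "fps_nth (p oo q) 3 = fps_nth p 1 * fps_nth q 3 + 2 * fps_nth p 2 * fps_nth q 1 * fps_nth q 2 + fps_nth p 3 *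
      (fps_nth q 1) ^ 3"
    using startsby_zero_power_nth_same[OF assms, of 3] q2 by (simp add: fps_compose_nth s)
qed

lemma prenormalizedD:
  assumes "f \<in> prenormalized"
  shows "analytic_germ f" "fps_nth f 0 = 0" "fps_nth f 1 = 1" "fps_nth f 1 \<noteq> 0" "fps_nth f 2 = 1" "fps_nth f 3 = 1"
  using assms by (auto simp: prenormalized_def)

text \<open>Compare coefficients in \<phi> oo g = f oo \<phi>. In degree 2 the coefficient of \<phi>
  occurs on both sides and cancels; once g has coefficient 1 there, the same happens in degree
  3.\<close>

lemma analytic_class_prenormalized:
  assumes "f \<in> prenormalized" "g \<in> analytic_class f"
  shows "g \<in> prenormalized"
proof -
  note f = prenormalizedD[OF assms(1)]
  obtain \<phi> where \<phi>: "tangent_to_identity \<phi>" and g: "g = fps_inv \<phi> oo (f oo \<phi>)"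
    using assms(2) by (auto simp: analytic_class_def)
  have p: "analytic_germ \<phi>" "fps_nth \<phi> 0 = 0" "fps_nth \<phi> 1 = 1" "fps_nth \<phi> 1 \<noteq> 0"
    using \<phi> by (auto simp: tangent_to_identity_def)
  note i = germ_fps_inv[OF p(1,2,4)] fps_inv_nth_0_1[OF p(2,3)]
  have fp: "analytic_germ (f oo \<phi>)" "fps_nth (f oo \<phi>) 0 = 0" using germ_compose[OF f(1) p(1,2)] f by auto
  have an: "analytic_germ g" unfolding g by (rule germ_compose(1)[OF i(1) fp])
  have g0: "fps_nth g 0 = 0" unfolding g using i by simp
  have eq: "\<phi> oo g = f oo \<phi>"
    unfolding g using fps_compose_assoc[OF fp(2) i(2), of \<phi>] fps_inv_right[OF p(2,4)]
      fps_X_fps_compose_startby0[OF fp(2)] by simp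
  note cg = compose_nth_3[OF g0, of \<phi>] note cf = compose_nth_3[OF p(2), of f]
  have g1: "fps_nth g 1 = 1" using cg(1) cf(1) eq f p by simp
  have g2: "fps_nth g 2 = 1" using cg(2) cf(2) eq f p g1 by simp
  have g3: "fps_nth g 3 = 1" using cg(3) cf(3) eq f p g1 g2 by simp
  show ?thesis using an g0 g1 g2 g3 by (simp add: prenormalized_def)
qed

definition fps_flip :: "complex fps \<Rightarrow> complex fps" where
  "fps_flip p = p oo (- fps_X)"

text \<open>The germ \<open>z \<mapsto> - f\<^sup>-\<^sup>1 (- z)\<close>: its attracting petal is the mirror image of the repelling petal of \<open>f\<close>.\<close>
definition rev_germ :: "complex fps \<Rightarrow> complex fps" where
  "rev_germ f = - fps_flip (fps_inv f)"

lemma fps_flip_nth [simp]: "fps_nth (fps_flip p) n = (- 1) ^ n * fps_nth p n"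
  by (simp add: fps_flip_def fps_compose_uminus')

lemma eval_fps_flip: "eval_fps (fps_flip p) z = eval_fps p (- z)"
  unfolding eval_fps_def by (simp add: mult_ac power_minus[of z])

lemma fps_conv_radius_fps_flip [simp]: "fps_conv_radius (fps_flip p) = fps_conv_radius p"
proof -
  have "conv_radius (\<lambda>n. norm (fps_nth (fps_flip p) n)) = conv_radius (\<lambda>n. norm (fps_nth p n))"
    by (simp add: norm_mult norm_power)
  then show ?thesis unfolding fps_conv_radius_def by simp
qed

text \<open>The inverse begins with z - z^2 + z^3; replacing z by - z and negating changes the signs
  in even degrees only.\<close>

lemma rev_germ_prenormalized:
  assumes "f \<in> prenormalized"
  shows "rev_germ f \<in> prenormalized"
proof -
  note f = prenormalizedD[OF assms]
  note i = germ_fps_inv[OF f(1,2,4)] fps_inv_nth_0_1[OF f(2,3)]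
  note c = compose_nth_3[OF i(2), of f, unfolded fps_inv_right[OF f(2,4)]]
  have "fps_nth (fps_inv f) 2 + 1 = 0" using c(2) f i by simp
  then have "fps_nth (fps_inv f) 2 = - 1" by (simp only: eq_neg_iff_add_eq_0)
  moreover from this have "fps_nth (fps_inv f) 3 = 1" using c(3) f i by simp
  ultimately show ?thesis using i unfolding prenormalized_def rev_germ_def analytic_germ_def by simp
qed

lemma rev_germ_eval:
  assumes "f \<in> prenormalized"
  shows "\<forall>\<^sub>F z in nhds 0. eval_fps (rev_germ f) z = - eval_fps (fps_inv f) (- z)"
proof -
  note f = prenormalizedD[OF assms]
  have "analytic_germ (fps_flip (fps_inv f))" using germ_fps_inv[OF f(1,2,4)] by (simp add: analytic_germ_def)
  then show ?thesis unfolding rev_germ_def using germ_minus(2)[of "fps_flip (fps_inv f)"] by (simp only: eval_fps_flip)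
qed

section \<open>Germs as maps near infinity\<close>

definition chart_map :: "complex fps \<Rightarrow> complex \<Rightarrow> complex" where
  "chart_map f w = - 1 / eval_fps f (- 1 / w)"

text \<open>Write f = z h. Then - 1 / f + 1 / z - 1 = - (1 / h - 1 + z) / z, which is the deviation
  of the chart map from a unit translation as a germ in z.\<close>

definition step_defect :: "complex fps \<Rightarrow> complex fps" where
  "step_defect f = - fps_shift 1 (inverse (fps_shift 1 f) - 1 + fps_X)"

text \<open>This remains true when the orbit hits \<open>0\<close>, because \<open>1 / 0 = 0\<close>.\<close>
lemma chart_map_funpow: "(chart_map f ^^ n) (- 1 / z) = - 1 / (eval_fps f ^^ n) z"
  by (induction n) (auto simp: chart_map_def)

text \<open>With h = 1 + z + z^2 + ... the inverse is 1 - z + 0 z^2 + ..., so the numerator vanishes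
  to order 3 and the defect to order 2. The coefficient of z^3 in f is what removes the term in 1 /
  w, which would put a logarithm into the Fatou coordinate.\<close>

lemma step_defect_order:
  assumes "f \<in> prenormalized"
  shows "analytic_germ (step_defect f)" "fps_nth (step_defect f) 0 = 0" "fps_nth (step_defect f) 1 = 0"
    "fps_nth (inverse (fps_shift 1 f)) 0 = 1" "fps_nth (inverse (fps_shift 1 f)) 1 = - 1"
    "analytic_germ (inverse (fps_shift 1 f))"
proof -
  note f = prenormalizedD[OF assms]
  define h u where "h = fps_shift 1 f" and "u = inverse h"
  have h: "fps_nth h 0 = 1" "fps_nth h 1 = 1" "fps_nth h 2 = 1"
    using f by (auto simp: h_def numeral_2_eq_2 numeral_3_eq_3)
  have s: "{0..1::nat} = {0, 1}" "{0..2::nat} = {0, 1, 2}" by auto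
  have hu: "u * h = 1" unfolding u_def using h by (intro inverse_mult_eq_1) simp
  have u0: "fps_nth u 0 = 1" using h by (simp add: u_def)
  have "fps_nth (u * h) 1 = 0" "fps_nth (u * h) 2 = 0" unfolding hu by simp_all
  then have u1: "fps_nth u 1 = - 1" and u2: "fps_nth u 2 = 0"
    using h u0 by (simp_all add: fps_mult_nth s add_eq_0_iff)
  have "fps_conv_radius u > 0" unfolding u_def h_def
    using f by (intro fps_conv_radius_inverse_pos) (auto simp: analytic_germ_def)
  then show "analytic_germ (inverse (fps_shift 1 f))" by (simp add: analytic_germ_def u_def h_def)
  have "fps_conv_radius (u - 1 + fps_X) > 0"
    using fps_conv_radius_add[of "u - 1" fps_X] fps_conv_radius_diff[of u 1] \<open>fps_conv_radius u > 0\<close>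
    by (auto intro: less_le_trans)
  then show "analytic_germ (step_defect f)" by (simp add: analytic_germ_def step_defect_def u_def h_def)
  show "fps_nth (inverse (fps_shift 1 f)) 0 = 1" "fps_nth (inverse (fps_shift 1 f)) 1 = - 1"
    using u0 u1 by (simp_all add: u_def h_def)
  show "fps_nth (step_defect f) 0 = 0" "fps_nth (step_defect f) 1 = 0"
    using u1 u2 by (simp_all add: step_defect_def u_def h_def numeral_2_eq_2)
qed

lemma chart_map_step_defect:
  assumes "f \<in> prenormalized"
  obtains X where "X \<ge> 1" "\<And>w. X < cmod w \<Longrightarrow>
      chart_map f w - w - 1 = eval_fps (step_defect f) (- 1 / w)"
proof -
  note f = prenormalizedD[OF assms] note e = step_defect_order[OF assms]
  define h u v where "h = fps_shift 1 f" and "u = inverse h" and "v = u - 1 + fps_X"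
  have "fps_nth h 0 \<noteq> 0" using f by (simp add: h_def)
  then have hu: "h * u = 1" unfolding u_def using inverse_mult_eq_1[of h] by (simp add: mult.commute)
  have fh: "f = fps_X * h" unfolding h_def using f by (intro fps_ext) (simp add: fps_X_mult_nth)
  have vh: "v = fps_X * fps_shift 1 v" using e(4) by (intro fps_ext) (simp add: fps_X_mult_nth v_def u_def h_def)
  have an: "eval_fps h has_fps_expansion h" "eval_fps u has_fps_expansion u" "eval_fps (step_defect f)
      has_fps_expansion step_defect f"
    using f e by (auto simp: analytic_germ_iff[symmetric] h_def u_def analytic_germ_def)
  have sv: "eval_fps (- step_defect f) has_fps_expansion fps_shift 1 v"
    using germ_minus(1)[OF e(1)] by (simp add: analytic_germ_iff step_defect_def v_def u_def h_def)
  have "(\<lambda>z. z * eval_fps h z) has_fps_expansion f" unfolding fh by (intro fps_expansion_intros an)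
  then have 1: "\<forall>\<^sub>F z in nhds 0. eval_fps f z = z * eval_fps h z" by (rule germ_expansion(2))
  have "(\<lambda>z. eval_fps h z * eval_fps u z) has_fps_expansion 1" unfolding hu[symmetric]
      by (intro fps_expansion_intros an)
  then have 2: "\<forall>\<^sub>F z in nhds 0. eval_fps 1 z = eval_fps h z * eval_fps u z" by (rule germ_expansion(2))
  have "(\<lambda>z. eval_fps u z - 1 + z) has_fps_expansion v" unfolding v_def by (intro fps_expansion_intros an)
  then have 3: "\<forall>\<^sub>F z in nhds 0. eval_fps v z = eval_fps u z - 1 + z" by (rule germ_expansion(2))
  have "(\<lambda>z. z * eval_fps (- step_defect f) z) has_fps_expansion v" by (subst vh) (intro fps_expansion_intros sv)
  then have 4: "\<forall>\<^sub>F z in nhds 0. eval_fps v z = z * eval_fps (- step_defect f) z" by (rule germ_expansion(2))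
  note 5 = germ_minus(2)[OF e(1)]
  have "\<forall>\<^sub>F z in nhds 0. z \<noteq> 0 \<longrightarrow> - 1 / eval_fps f z - (- 1 / z) - 1 = eval_fps
      (step_defect f) z"
    using 1 2 3 4 5
  proof eventually_elim
    case (elim z)
    show ?case
    proof
      assume z: "z \<noteq> 0"
      have hz: "eval_fps h z * eval_fps u z = 1" using elim(2) by simp
      then have nz: "eval_fps h z \<noteq> 0" by auto
      have "eval_fps u z = 1 / eval_fps h z" using hz nz by (simp add: field_simps)
      then have "- 1 / eval_fps f z = - eval_fps u z / z" using elim(1) by simp
      moreover have "eval_fps u z - 1 + z = - (z * eval_fps (step_defect f) z)" using elim(3,4,5) by simp
      then have "- eval_fps u z = z * (1 + eval_fps (step_defect f) z) - 1" by (simp add: algebra_simps)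
      ultimately have "- 1 / eval_fps f z = (z * (1 + eval_fps (step_defect f) z) - 1) / z" by simp
      then show "- 1 / eval_fps f z - (- 1 / z) - 1 = eval_fps (step_defect f) z"
        using z by (simp add: diff_divide_distrib)
    qed
  qed
  then obtain X where X: "X \<ge> 1" "\<And>w. X < cmod w \<Longrightarrow>
      - 1 / w \<noteq> 0 \<longrightarrow> - 1 / eval_fps f (- 1 / w) - (- 1 / (- 1 / w)) - 1 = eval_fps (step_defect
          f) (- 1 / w)"
    by (rule eventually_nhds_0_at_infinity) blast
  show ?thesis
  proof (rule that[OF X(1)])
    fix w assume w: "X < cmod w"
    then have "w \<noteq> 0" using X(1) by auto
    then have *: "- 1 / w \<noteq> 0" "- 1 / (- 1 / w) = w" by auto
    show "chart_map f w - w - 1 = eval_fps (step_defect f) (- 1 / w)"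
      using mp[OF X(2)[OF w] *(1)] unfolding *(2) chart_map_def .
  qed
qed

lemma chart_map_near_translation:
  assumes "f \<in> prenormalized"
  obtains C R where "near_translation (chart_map f) C R"
proof -
  note e = step_defect_order[OF assms]
  obtain X where X: "X \<ge> 1" "\<And>w. X < cmod w \<Longrightarrow>
      chart_map f w - w - 1 = eval_fps (step_defect f) (- 1 / w)"
    using chart_map_step_defect[OF assms] by blast
  obtain K Y where Y: "Y \<ge> 1" "\<And>w. Y \<le> cmod w \<Longrightarrow>
      cmod (eval_fps (step_defect f) (- 1 / w)) \<le> K / (cmod w)\<^sup>2"
    "(\<lambda>w. eval_fps (step_defect f) (- 1 / w)) holomorphic_on {w. Y < cmod w}"
    using germ_decay[OF e(1-3)] by metis
  have "near_translation (chart_map f) (max 0 K) (max X Y)"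
  proof
    have "(\<lambda>w. eval_fps (step_defect f) (- 1 / w) + w + 1) holomorphic_on {w. max X Y < cmod w}"
      by (intro holomorphic_intros holomorphic_on_subset[OF Y(3)]) auto
    then show "chart_map f holomorphic_on {w. max X Y < cmod w}"
      by (rule holomorphic_transform) (use X(2) in \<open>auto simp: algebra_simps\<close>)
    fix w assume w: "max X Y < cmod w"
    have "cmod (chart_map f w - w - 1) \<le> K / (cmod w)\<^sup>2" using X(2)[of w] Y(2)[of w] w by simp
    also have "\<dots> \<le> max 0 K / (cmod w)\<^sup>2" by (intro divide_right_mono) auto
    finally show "cmod (chart_map f w - w - 1) \<le> max 0 K / (cmod w)\<^sup>2" .
  qed (use X Y in auto)
  then show ?thesis using that by blast
qed

lemma chart_map_parabolic:
  assumes "f \<in> prenormalized"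
  obtains C R where "parabolic (chart_map f) (chart_map (rev_germ f)) C R"
proof -
  note f = prenormalizedD[OF assms] note b = rev_germ_prenormalized[OF assms] note g = prenormalizedD[OF b]
  note i = germ_fps_inv[OF f(1,2,4)] fps_inv_nth_0_1[OF f(2,3)]
  obtain C1 R1 where 1: "near_translation (chart_map f) C1 R1" using chart_map_near_translation[OF assms] .
  obtain C2 R2 where 2: "near_translation (chart_map (rev_germ f)) C2 R2" using chart_map_near_translation[OF b] .
  have "\<forall>\<^sub>F z in nhds 0. eval_fps (rev_germ f) (- eval_fps f z) = - eval_fps (fps_inv f) (eval_fps f z)"
    using eventually_germ[OF f(1,2) eventually_uminus_nhds_0[OF rev_germ_eval[OF assms]]] by simp
  then have "\<forall>\<^sub>F z in nhds 0. eval_fps (rev_germ f) (- eval_fps f z) = - z"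
    using germ_inv_eval(1)[OF f(1-3)] by eventually_elim simp
  then obtain X where X: "\<And>w. X < cmod w \<Longrightarrow> eval_fps (rev_germ f) (- eval_fps f (- 1 / w)) = 1 / w"
    using eventually_nhds_0_at_infinity by (metis (mono_tags, lifting) divide_minus_left minus_minus)
  have "\<forall>\<^sub>F z in nhds 0. eval_fps f (eval_fps (fps_inv f) (- z)) = - z"
    using eventually_uminus_nhds_0[OF germ_inv_eval(2)[OF f(1-3)]] .
  then have "\<forall>\<^sub>F z in nhds 0. eval_fps f (- eval_fps (rev_germ f) z) = - z"
    using rev_germ_eval[OF assms] by eventually_elim simp
  then obtain Z where Z: "\<And>w. Z < cmod w \<Longrightarrow> eval_fps f (- eval_fps (rev_germ f) (- 1 / w)) = 1 / w"
    using eventually_nhds_0_at_infinity by (metis (mono_tags, lifting) divide_minus_left minus_minus)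
  define C R where "C = max C1 C2" and "R = max (max R1 R2) (max X Z)"
  have "parabolic (chart_map f) (chart_map (rev_germ f)) C R"
  proof (intro parabolic.intro parabolic_axioms.intro)
    show "near_translation (chart_map f) C R" by (rule near_translation_mono[OF 1]) (auto simp: C_def R_def)
    show "near_translation (chart_map (rev_germ f)) C R" by (rule near_translation_mono[OF 2]) (auto simp: C_def R_def)
    show "chart_map (rev_germ f) (- chart_map f w) = - w" if "R < cmod w" for w
      using X[of w] that by (simp add: chart_map_def R_def)
    show "chart_map f (- chart_map (rev_germ f) w) = - w" if "R < cmod w" for w
      using Z[of w] that by (simp add: chart_map_def R_def)
  qed
  then show ?thesis using that by blast
qed

text \<open>Taylor series of log (f / z), with the shifted series for the quotient so that it is
  defined at 0 as well. For a prenormalized germ it begins with z, which makes it the starting point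
  of a conjugacy tangent to the identity.\<close>

definition log_quot :: "complex fps \<Rightarrow> complex fps" where
  "log_quot f = fps_expansion (\<lambda>z. Ln (eval_fps (fps_shift 1 f) z)) 0"

lemma log_quot:
  assumes f: "analytic_germ f" "fps_nth f 0 = 0" "fps_nth f 1 = 1"
  shows "analytic_germ (log_quot f)" "\<forall>\<^sub>F z in nhds 0. z \<noteq> 0 \<longrightarrow> eval_fps
      (log_quot f) z = Ln (eval_fps f z / z)"
    "fps_nth (log_quot f) 0 = 0" "fps_nth (log_quot f) 1 = fps_nth f 2"
proof -
  define h where "h = fps_shift 1 f"
  have h: "analytic_germ h" "fps_nth h 0 = 1" "fps_nth h 1 = fps_nth f 2"
    using f by (auto simp: h_def analytic_germ_def numeral_2_eq_2)
  have an: "eval_fps h analytic_on {0}"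
    using h(1) by (intro analytic_on_eval_fps) (auto simp: analytic_germ_def zero_ereal_def)
  have "(\<lambda>z. Ln (eval_fps h z)) analytic_on {0}"
    by (intro analytic_on_ln an) (use h in \<open>auto simp: eval_fps_at_0\<close>)
  then have L: "(\<lambda>z. Ln (eval_fps h z)) has_fps_expansion log_quot f"
    unfolding log_quot_def h_def by (rule analytic_at_imp_has_fps_expansion_0)
  show "analytic_germ (log_quot f)" by (rule germ_expansion(1)[OF L])
  have fh: "f = fps_X * h" unfolding h_def using f by (intro fps_ext) (simp add: fps_X_mult_nth)
  have "(\<lambda>z. z * eval_fps h z) has_fps_expansion f" unfolding fh using h(1)
    by (intro fps_expansion_intros) (simp add: analytic_germ_iff)
  then have "\<forall>\<^sub>F z in nhds 0. eval_fps f z = z * eval_fps h z" by (rule germ_expansion(2))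
  then show "\<forall>\<^sub>F z in nhds 0. z \<noteq> 0 \<longrightarrow> eval_fps (log_quot f) z = Ln (eval_fps f z / z)"
    using germ_expansion(2)[OF L] by eventually_elim auto
  show l0: "fps_nth (log_quot f) 0 = 0"
    using has_fps_expansion_imp_0_eq_fps_nth_0[OF L] h by (simp add: eval_fps_at_0)
  \<comment> \<open>The linear coefficient is obtained by exponentiating back to h instead of
    differentiating the logarithm.\<close>
  have E: "(exp \<circ> (\<lambda>z. Ln (eval_fps h z))) has_fps_expansion (fps_exp 1 oo log_quot f)"
    by (intro has_fps_expansion_compose L has_fps_expansion_exp1 l0)
  have "\<forall>\<^sub>F z in nhds 0. eval_fps h z \<noteq> 0"
    using germ_isCont[OF h(1)] h(2) unfolding continuous_at eval_fps_at_0
    by (metis eval_fps_at_0 isCont_def tendsto_at_iff_tendsto_nhds tendsto_imp_eventually_ne zero_neq_one)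
  then have "\<forall>\<^sub>F z in nhds 0. (exp \<circ> (\<lambda>z. Ln (eval_fps h z))) z = eval_fps h z" by
      eventually_elim simp
  then have "eval_fps h has_fps_expansion (fps_exp 1 oo log_quot f)"
    using E has_fps_expansion_cong by blast
  then have "fps_exp 1 oo log_quot f = h"
    using h(1) fps_expansion_unique_complex unfolding analytic_germ_iff by blast
  then show "fps_nth (log_quot f) 1 = fps_nth f 2"
    using compose_nth_3(1)[OF l0, of "fps_exp 1"] h by simp
qed

definition abel_rhs :: "complex fps \<Rightarrow> complex fps" where
  "abel_rhs f = log_quot f - fps_X"

text \<open>The linear terms of z and of log (f / z) cancel, so the right-hand side vanishes to
  order 2, as the convergence of its orbit sums requires.\<close>

lemma abel_rhs:
  assumes "f \<in> prenormalized"
  shows "analytic_germ (abel_rhs f)" "fps_nth (abel_rhs f) 0 = 0" "fps_nth (abel_rhs f) 1 = 0"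
    "\<forall>\<^sub>F z in nhds 0. z \<noteq> 0 \<longrightarrow> eval_fps (abel_rhs f) z = - z + Ln (eval_fps f z / z)"
proof -
  note f = prenormalizedD[OF assms] note l = log_quot[OF f(1-3)]
  have X: "analytic_germ fps_X" by (simp add: analytic_germ_def)
  show "analytic_germ (abel_rhs f)" unfolding abel_rhs_def by (rule germ_diff(1)[OF l(1) X])
  show "fps_nth (abel_rhs f) 0 = 0" "fps_nth (abel_rhs f) 1 = 0" using l f by (auto simp: abel_rhs_def)
  show "\<forall>\<^sub>F z in nhds 0. z \<noteq> 0 \<longrightarrow> eval_fps (abel_rhs f) z = - z + Ln (eval_fps f z / z)"
    using germ_diff(2)[OF l(1) X] l(2) unfolding abel_rhs_def by eventually_elim auto
qed


section \<open>Petals, asymptotic expansions and the canonical moment\<close>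

lemma para_neg_inverse: "z \<noteq> 0 \<Longrightarrow> para (- 1 / z) = (cmod z - Re z) / (cmod z)\<^sup>2"
proof -
  assume z: "z \<noteq> 0"
  have "Re (- 1 / z) = - (Re z / (cmod z)\<^sup>2)" by (simp only: cmod_power2) (simp add: Re_divide)
  moreover have "cmod (- 1 / z) = cmod z / (cmod z)\<^sup>2" using z by (simp add: norm_divide power2_eq_square)
  ultimately show ?thesis unfolding para_def by (simp add: diff_divide_distrib)
qed

text \<open>The value of \<open>para\<close> at -1 / z is (|z| - Re z) / |z|^2. In a proper
  subsector it is bounded below by a constant over |z|, which turns bounds by powers of
  \<open>para\<close> into asymptotic estimates.\<close>

lemma para_sector:
  assumes "z \<in> sector (- 1) \<beta>" "\<beta> < pi"
  shows "para (- 1 / z) \<ge> (1 + cos \<beta>) / cmod z"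
proof -
  have z: "z \<noteq> 0" "\<bar>Arg (- z)\<bar> < \<beta>" using assms(1) by (auto simp: sector_def)
  have "- Re z = cmod z * cos (Arg (- z))"
    using Arg_eq[of "- z"] z by (metis Re_complex_of_real Re_exp complex_Re_of_int cos_Arg mult.commute
        nonzero_mult_div_cancel_left norm_eq_zero norm_minus_cancel uminus_complex.sel(1) times_divide_eq_right
            neg_equal_0_iff_equal)
  moreover have "cos (Arg (- z)) \<ge> cos \<beta>"
  proof -
    have "cos \<bar>Arg (- z)\<bar> \<ge> cos \<beta>" using z assms(2) by (intro cos_monotone_0_pi_le) auto
    then show ?thesis by simp
  qed
  then have "cmod z * cos (Arg (- z)) \<ge> cmod z * cos \<beta>" by (intro mult_left_mono) auto
  ultimately have "cmod z - Re z \<ge> cmod z * (1 + cos \<beta>)" by (simp add: algebra_simps)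
  then have "(cmod z - Re z) / (cmod z)\<^sup>2 \<ge> cmod z * (1 + cos \<beta>) / (cmod z)\<^sup>2"
      by (intro divide_right_mono) auto
  then show ?thesis using z para_neg_inverse[OF z(1)] by (simp add: power2_eq_square)
qed

lemma one_plus_cos_pos: "0 < \<beta> \<Longrightarrow> \<beta> < pi \<Longrightarrow> 1 + cos \<beta> > 0"
  using cos_monotone_0_pi[of \<beta> pi] by simp

text \<open>Since \<open>para\<close> of s^2 is 2 (Re s)^2, the region is the image of a half-plane
  under squaring.\<close>

lemma connected_para: "M \<ge> 0 \<Longrightarrow> connected {w. para w > M}"
proof -
  assume M: "M \<ge> 0"
  have "{w. para w > M} = (\<lambda>s. s\<^sup>2) ` {s. Re s > sqrt (M / 2)}"
  proof (intro set_eqI iffI)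
    fix w assume w: "w \<in> {w. para w > M}"
    have eq: "para (s\<^sup>2) = 2 * (Re s)\<^sup>2" for s
      by (simp add: para_def norm_power cmod_power2) (simp add: power2_eq_square)
    have "M / 2 < (Re (csqrt w))\<^sup>2" using w eq[of "csqrt w"] by simp
    then have "sqrt (M / 2) < Re (csqrt w)" using csqrt_principal[of w] by (intro real_less_lsqrt) (auto simp: less_imp_le)
    then show "w \<in> (\<lambda>s. s\<^sup>2) ` {s. Re s > sqrt (M / 2)}" by (intro image_eqI[of _ _ "csqrt w"]) auto
  next
    fix w assume "w \<in> (\<lambda>s. s\<^sup>2) ` {s. Re s > sqrt (M / 2)}"
    then obtain s where s: "w = s\<^sup>2" "Re s > sqrt (M / 2)" by auto
    have "(sqrt (M / 2))\<^sup>2 < (Re s)\<^sup>2" using s M by (intro power_strict_mono) auto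
    then have "M / 2 < (Re s)\<^sup>2" using M by simp
    then show "w \<in> {w. para w > M}"
      unfolding s(1) para_def by (simp add: norm_power cmod_power2) (simp add: power2_eq_square)
  qed
  then show ?thesis
    by (simp only:) (intro connected_continuous_image continuous_intros convex_connected convex_halfspace_Re_gt)
qed

text \<open>For M > 0 this is r < (1 - cos \<theta>) / M in polar coordinates: the inside of a
  cardioid with its cusp at 0 along the positive real axis, hence an attracting petal of opening 2
  pi.\<close>

definition horn :: "real \<Rightarrow> complex set" where
  "horn M = {z. z \<noteq> 0 \<and> para (- 1 / z) > M}"

lemma horn_norm: "z \<in> horn M \<Longrightarrow> M > 0 \<Longrightarrow> cmod z < 2 / M"
proof -
  assume z: "z \<in> horn M" "M > 0"
  then have "M < 2 / cmod z" "cmod z > 0" using para_le[of "- 1 / z"] by (auto simp: horn_def norm_divide)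
  then show ?thesis using z(2) by (simp add: field_simps)
qed

lemma open_horn: "open (horn M)"
proof -
  have "open (- {0} \<inter> (\<lambda>z. - 1 / z :: complex) -` {w. para w > M})"
    by (intro continuous_open_preimage continuous_intros open_para) auto
  moreover have "- {0} \<inter> (\<lambda>z. - 1 / z) -` {w. para w > M} = horn M" by (auto simp: horn_def)
  ultimately show ?thesis by simp
qed

lemma connected_horn:
  assumes "M \<ge> 0"
  shows "connected (horn M)"
proof -
  have "horn M = (\<lambda>w. - 1 / w) ` {w. para w > M}"
  proof (intro set_eqI iffI)
    fix z assume "z \<in> horn M" then show "z \<in> (\<lambda>w. - 1 / w) ` {w. para w > M}"
      by (intro image_eqI[of _ _ "- 1 / z"]) (auto simp: horn_def)
  next
    fix z assume "z \<in> (\<lambda>w. - 1 / w) ` {w. para w > M}"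
    then show "z \<in> horn M" using assms by (auto simp: horn_def para_def)
  qed
  moreover have "continuous_on {w. para w > M} (\<lambda>w. - 1 / w)"
    using assms by (intro continuous_intros) (auto simp: para_def)
  ultimately show ?thesis using connected_continuous_image connected_para[OF assms] by metis
qed

lemma sector_horn:
  assumes "0 < \<beta>" "\<beta> < pi" "M \<ge> 0"
  shows "\<exists>r>0. sector (- 1) \<beta> \<inter> ball 0 r \<subseteq> horn M"
proof (intro exI conjI subsetI)
  note c = one_plus_cos_pos[OF assms(1,2)]
  show "(1 + cos \<beta>) / (M + 1) > 0" using c assms by simp
  fix z assume z: "z \<in> sector (- 1) \<beta> \<inter> ball 0 ((1 + cos \<beta>) / (M + 1))"
  then have nz: "z \<noteq> 0" by (auto simp: sector_def)
  then have "M + 1 < (1 + cos \<beta>) / cmod z" using z assms by (simp add: field_simps)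
  then show "z \<in> horn M" using para_sector[of z \<beta>] z assms nz by (simp add: horn_def)
qed

lemma petal_horn:
  assumes nt: "near_translation (chart_map f) C R" and M: "M \<ge> near_translation.height_bound C R"
    and conv: "\<And>z. cmod z < 2 / M \<Longrightarrow> ereal (cmod z) < fps_conv_radius f"
  shows "petal f (- 1) (horn M)"
proof -
  interpret near_translation "chart_map f" C R by (rule nt)
  have M0: "M > 0" using M height_bound_pos by linarith
  have w: "para (- 1 / z) > height_bound" if "z \<in> horn M" for z using that M by (auto simp: horn_def)
  have it: "- 1 / (eval_fps f ^^ n) z = (chart_map f ^^ n) (- 1 / z)" for n z using chart_map_funpow[where f = f
      and n = n and z = z] by simp
  show ?thesis unfolding petal_def
  proof (intro conjI allI impI ballI)
    show "open (horn M)" by (rule open_horn)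
    show "connected (horn M)" using M0 by (intro connected_horn) simp
    show "0 \<notin> horn M" by (simp add: horn_def)
    show "horn M \<subseteq> eball 0 (fps_conv_radius f)" using conv horn_norm M0 by auto
    show "eval_fps f ` horn M \<subseteq> horn M"
    proof (rule image_subsetI)
      fix z assume z: "z \<in> horn M"
      have "para (- 1 / eval_fps f z) \<ge> para (- 1 / z)" using para_iter[OF w[OF z], of 1] it[of 1 z] by simp
      then have "para (- 1 / eval_fps f z) > M" using z by (simp add: horn_def)
      moreover from this have "eval_fps f z \<noteq> 0" using M0 by (auto simp: para_def)
      ultimately show "eval_fps f z \<in> horn M" by (simp add: horn_def)
    qed
    show "(\<lambda>n. (eval_fps f ^^ n) z) \<longlonglongrightarrow> 0" if z: "z \<in> horn M" for z
    proof -
      have "(\<lambda>n. - 1 / (chart_map f ^^ n) (- 1 / z)) \<longlonglongrightarrow> 0"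
        by (rule tendsto_divide_0[OF tendsto_const iter_at_infinity[OF w[OF z]]])
      then show ?thesis unfolding it[symmetric] by simp
    qed
    show "\<exists>r>0. sector (- 1) \<beta> \<inter> ball 0 r \<subseteq> horn M" if "0 < \<beta>
        \<and> \<beta> < pi" for \<beta>
      using sector_horn that M0 by simp
  qed
qed

lemma sector_uminus: "- z \<in> sector d \<beta> \<longleftrightarrow> z \<in> sector (- d) \<beta>"
  by (simp add: sector_def)

lemma petal_mirror:
  assumes p: "petal p (- 1) V" and q: "\<And>z. z \<in> V \<Longrightarrow> eval_fps q (- z) = - eval_fps p z"
    and conv: "\<And>z. z \<in> V \<Longrightarrow> ereal (cmod z) < fps_conv_radius q"
  shows "petal q 1 (uminus ` V)"
proof -
  note p' = p[unfolded petal_def]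
  note p7 = conjunct2[OF conjunct2[OF conjunct2[OF conjunct2[OF conjunct2[OF conjunct2[OF p']]]]], rule_format]
  have inV: "(eval_fps p ^^ n) z \<in> V" if "z \<in> V" for n z
    by (induction n) (use that p' in auto)
  have it: "(eval_fps q ^^ n) (- z) = - (eval_fps p ^^ n) z" if "z \<in> V" for n z
    by (induction n) (use q inV[OF that] in auto)
  show ?thesis unfolding petal_def
  proof (intro conjI allI impI ballI)
    show "open (uminus ` V)" using p' open_negations by blast
    show "connected (uminus ` V)" using p' by (intro connected_continuous_image continuous_intros) auto
    show "0 \<notin> uminus ` V" using p' by auto
    show "uminus ` V \<subseteq> eball 0 (fps_conv_radius q)" using conv by auto
    show "eval_fps q ` uminus ` V \<subseteq> uminus ` V" using p' q by auto
    show "(\<lambda>n. (eval_fps q ^^ n) z) \<longlonglongrightarrow> 0" if z: "z \<in> uminus ` V" for z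
    proof -
      obtain x where x: "x \<in> V" "z = - x" using z by blast
      have "(\<lambda>n. - (eval_fps p ^^ n) x) \<longlonglongrightarrow> - 0" using p' x by (intro tendsto_minus) auto
      then show ?thesis using it[OF x(1)] x(2) by simp
    qed
    show "\<exists>r>0. sector 1 \<beta> \<inter> ball 0 r \<subseteq> uminus ` V" if b: "0 < \<beta>
        \<and> \<beta> < pi" for \<beta>
    proof -
      obtain r where r: "r > 0" "sector (- 1) \<beta> \<inter> ball 0 r \<subseteq> V" using p7[OF b] by blast
      have "z \<in> uminus ` V" if "z \<in> sector 1 \<beta> \<inter> ball 0 r" for z
      proof -
        have "- z \<in> sector (- 1) \<beta> \<inter> ball 0 r" using that sector_uminus[of z "- 1" \<beta>] by simp
        then have "- z \<in> V" using r(2) by blast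
        then show ?thesis by (rule rev_image_eqI) simp
      qed
      then show ?thesis using r(1) by blast
    qed
  qed
qed

section \<open>Formal solutions and asymptotic expansions\<close>

function abel_coeff :: "complex fps \<Rightarrow> complex fps \<Rightarrow> nat \<Rightarrow> complex" where
  "abel_coeff f d n = (if n = 0 then 0 else
     (fps_nth d (Suc n) - (\<Sum>k<n. abel_coeff f d k * fps_nth (f ^ k) (Suc n))) / of_nat n)"
  by pat_completeness auto
termination by (relation "Wellfounded.measure (\<lambda>(f, d, n). n)") auto

declare abel_coeff.simps [simp del]

lemma power_nth_Suc:
  fixes f :: "complex fps"
  assumes "fps_nth f 0 = 0" "fps_nth f 1 = 1"
  shows "fps_nth (f ^ n) (Suc n) = of_nat n * fps_nth f 2"
proof -
  define h where "h = fps_shift 1 f"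
  have h: "fps_nth h 0 = 1" "fps_nth h 1 = fps_nth f 2" using assms by (auto simp: h_def numeral_2_eq_2)
  have fh: "f = fps_X * h" unfolding h_def using assms by (intro fps_ext) (simp add: fps_X_mult_nth)
  have "fps_nth (f ^ n) (Suc n) = fps_nth (fps_X ^ n * h ^ n) (Suc n)" by (simp add: fh power_mult_distrib)
  also have "\<dots> = fps_nth (h ^ n) 1" by (simp add: fps_X_power_mult_nth)
  also have "\<dots> = of_nat n * fps_nth h 1"
    using h(1) by (induction n) (auto simp: fps_mult_nth_1 fps_power_zeroth algebra_simps)
  finally show ?thesis using h by simp
qed

text \<open>Since \<open>f\<^sup>n\<close> has coefficient \<open>n\<close> at degree \<open>n + 1\<close>, the
    formal Abel equation is triangular
  with an index shift by one.\<close>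
lemma formal_abel:
  assumes f: "f \<in> prenormalized" and d: "fps_nth d 0 = 0" "fps_nth d 1 = 0"
  obtains A where "fps_nth A 0 = 0" "(A oo f) - A = d"
proof -
  note f = prenormalizedD[OF f]
  define A where "A = Abs_fps (abel_coeff f d)"
  have A0: "fps_nth A 0 = 0" by (simp add: A_def abel_coeff.simps)
  have "fps_nth ((A oo f) - A) m = fps_nth d m" for m
  proof (cases m)
    case 0 then show ?thesis using A0 d by simp
  next
    case (Suc n)
    have "fps_nth (A oo f) m = (\<Sum>k<n. fps_nth A k * fps_nth (f ^ k) (Suc n))
        + fps_nth A n * fps_nth (f ^ n) (Suc n) + fps_nth A (Suc n) * fps_nth (f ^ Suc n) (Suc n)"
      by (simp add: fps_compose_nth Suc atLeast0AtMost lessThan_Suc_atMost[symmetric] del: power_Suc)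
    also have "fps_nth (f ^ Suc n) (Suc n) = 1" using startsby_zero_power_nth_same[OF f(2), of "Suc n"] f by simp
    also have "fps_nth (f ^ n) (Suc n) = of_nat n" using power_nth_Suc[OF f(2,3)] f by simp
    finally have eq: "fps_nth ((A oo f) - A) m = (\<Sum>k<n. fps_nth A k * fps_nth (f ^ k) (Suc n)) + fps_nth A n *
        of_nat n"
      by (simp add: Suc)
    show ?thesis
    proof (cases "n = 0")
      case True then show ?thesis using eq d Suc by simp
    next
      case False
      then have "fps_nth A n * of_nat n = fps_nth d (Suc n) - (\<Sum>k<n. fps_nth A k * fps_nth (f ^ k) (Suc n))"
        by (simp add: A_def abel_coeff.simps[of f d n])
      then show ?thesis using eq Suc by simp
    qed
  qed
  then have "(A oo f) - A = d" by (intro fps_ext)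
  then show ?thesis using that A0 by blast
qed

text \<open>The truncation of the formal solution below degree n solves the equation up to an error
  of order n + 1. The truncation itself telescopes along the orbit, the orbit sum of the error has n
  powers of decay in \<open>para\<close>, and in a sector \<open>para\<close> dominates 1 /
  |z|.\<close>

lemma asymp_orbit_sum:
  assumes f: "f \<in> prenormalized" and nt: "near_translation (chart_map f) C R"
    and d: "analytic_germ d" and A: "fps_nth A 0 = 0" "(A oo f) - A = d"
  shows "has_asymp_expansion (\<lambda>z. - orbit_sum (chart_map f) (\<lambda>w. eval_fps d (- 1 / w)) (- 1 / z)) (- 1) A"
proof -
  note f' = prenormalizedD[OF f]
  define X where "X = (\<lambda>z. - orbit_sum (chart_map f) (\<lambda>w. eval_fps d (- 1 / w)) (- 1 / z))"
  have main: "\<exists>c r. c \<ge> 0 \<and> r > 0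
      \<and> (\<forall>z\<in>sector (- 1) \<beta>. cmod z < r \<longrightarrow> cmod (X z - (\<Sum>k<n. fps_nth A k *
          z ^ k)) \<le> c * cmod z ^ n)"
    if b: "0 < \<beta>" "\<beta> < pi" and n: "n \<ge> 1" for \<beta> n
  proof -
    define c where "c = (\<lambda>z. \<Sum>k<n. fps_nth A k * z ^ k)"
    define P where "P = (\<Sum>k<n. fps_const (fps_nth A k) * fps_X ^ k)"
    have cP: "c has_fps_expansion P" unfolding c_def P_def by (intro fps_expansion_intros)
    then have P: "analytic_germ P" "\<forall>\<^sub>F z in nhds 0. eval_fps P z = c z" by (auto dest: germ_expansion)
    have Pn: "fps_nth P i = (if i < n then fps_nth A i else 0)" for i
      by (simp add: P_def fps_sum_nth fps_X_power_nth sum.delta if_distrib cong: if_cong)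
    \<comment> \<open>The defect of the truncation. The remainder A - P starts in degree n, and its
      increment along f starts one degree later because f is tangent to the identity.\<close>
    define q where "q = d - ((P oo f) - P)"
    note Pf = germ_compose[OF P(1) f'(1,2)]
    note Pd = germ_diff[OF Pf(1) P(1)]
    have q: "analytic_germ q" unfolding q_def by (rule germ_diff(1)[OF d Pd(1)])
    have "fps_nth q m = 0" if "m < n + 1" for m
    proof -
      define E where "E = A - P"
      have E: "fps_nth E i = 0" if "i < n" for i using that by (simp add: E_def Pn)
      have "q = (E oo f) - E" unfolding q_def E_def A(2)[symmetric] fps_compose_sub_distrib by simp
      moreover have "fps_nth (E oo f) m = (\<Sum>i\<in>{0..m}. if i = n then fps_nth E n * fps_nth (f ^ n) m else 0)"
        unfolding fps_compose_nth using E that by (intro sum.cong) auto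
      moreover have "fps_nth (f ^ n) n = 1" using startsby_zero_power_nth_same[OF f'(2)] f' by simp
      ultimately show ?thesis using that E by (auto simp: not_less less_Suc_eq)
    qed
    then obtain K r0 where K: "r0 > 0" "K \<ge> 0" "\<And>z. cmod z \<le> r0 \<Longrightarrow>
        cmod (eval_fps q z) \<le> K * cmod z ^ (n + 1)"
      using germ_le[OF q, of "n + 1"] by metis
    define near where "near = (\<lambda>z. eval_fps d z = eval_fps q z + (c (eval_fps f z) - c z) \<and> cmod z \<le> r0)"
    have "\<forall>\<^sub>F z in nhds 0. near z"
    proof -
      have "\<forall>\<^sub>F z in nhds (0::complex). cmod z \<le> r0" using K(1) unfolding eventually_nhds_metric
        by (intro exI[of _ r0]) (auto simp: dist_norm)
      then show ?thesis
        using germ_diff(2)[OF d Pd(1), folded q_def] Pd(2) Pf(2) P(2) eventually_germ[OF f'(1,2) P(2)]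
        unfolding near_def by eventually_elim simp
    qed
    then obtain Z where Z0: "Z \<ge> 1" "\<And>w. Z < cmod w \<Longrightarrow> near (- 1 / w)"
      by (rule eventually_nhds_0_at_infinity) blast
    then have Z: "Z \<ge> 1" "\<And>w. Z < cmod w \<Longrightarrow>
        eval_fps d (- 1 / w) = eval_fps q (- 1 / w) + (c (eval_fps f (- 1 / w)) - c (- 1 / w))"
       "\<And>w. Z < cmod w \<Longrightarrow> cmod (- 1 / w) \<le> r0"
      unfolding near_def by blast+
    interpret N: near_translation "chart_map f" C "max R Z" by (rule near_translation_mono[OF nt]) auto
    have big: "cmod w > Z" "cmod w > 1" if "para w > N.height_bound" for w using N.cmod_gt[OF that] by auto
    \<comment> \<open>The error decays with exponent n + 1 = m + 2, the form in which the refined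
      bound for orbit sums returns m + 1 = n powers.\<close>
    obtain m where m: "n = Suc m" using n by (cases n) auto
    define Q where "Q = (\<lambda>w. eval_fps q (- 1 / w))"
    have Q: "cmod (Q w) \<le> K / cmod w ^ (m + 2)" if "para w > N.height_bound" for w
      using K(3)[OF Z(3)[OF big(1)[OF that]]] by (simp add: Q_def norm_divide power_divide m)
    have Q2: "cmod (Q w) \<le> K / (cmod w)\<^sup>2" if "para w > N.height_bound" for w
    proof -
      have "(cmod w)\<^sup>2 \<le> cmod w ^ (m + 2)" using big[OF that] by (intro power_increasing) auto
      then have "K / cmod w ^ (m + 2) \<le> K / (cmod w)\<^sup>2"
        using K(2) big(2)[OF that] by (intro divide_left_mono mult_pos_pos zero_less_power) auto
      then show ?thesis using Q[OF that] by linarith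
    qed
    have Xc: "X z - c z = - orbit_sum (chart_map f) Q (- 1 / z)" if z: "para (- 1 / z) > N.height_bound" for z
    proof -
      let ?w = "- 1 / z"
      define zn where "zn = (\<lambda>k. (eval_fps f ^^ k) z)"
      have it: "- 1 / (chart_map f ^^ k) ?w = zn k" for k
        unfolding zn_def chart_map_funpow by simp
      have "zn \<longlonglongrightarrow> 0" unfolding it[symmetric]
        by (rule tendsto_divide_0[OF tendsto_const N.iter_at_infinity[OF z]])
      moreover have "isCont c 0" unfolding c_def by (intro continuous_intros)
      moreover have "c 0 = 0" using A(1) m by (simp add: c_def power_0_left if_distrib sum.delta cong: if_cong)
      ultimately have "(\<lambda>k. c (zn k)) \<longlonglongrightarrow> 0" using isCont_tendsto_compose[of 0 c zn] by simp
      then have "(\<lambda>k. c (zn (Suc k)) - c (zn k)) sums (0 - c (zn 0))" by (rule telescope_sums)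
      then have "(\<lambda>k. Q ((chart_map f ^^ k) ?w) + (c (zn (Suc k)) - c (zn k))) sums (orbit_sum (chart_map f)
          Q ?w + (0 - c (zn 0)))"
        by (intro sums_add N.orbit_sum_sums[OF Q2 z])
      moreover have "eval_fps d (- 1 / (chart_map f ^^ k) ?w) = Q ((chart_map f ^^ k) ?w) + (c (zn (Suc k)) - c (zn
          k))" for k
        using Z(2)[OF big(1)[OF N.para_iter_gt[OF z, of k]]] unfolding Q_def it by (simp add: zn_def)
      ultimately have "orbit_sum (chart_map f) (\<lambda>w. eval_fps d (- 1 / w)) ?w = orbit_sum (chart_map f) Q ?w - c z"
        unfolding orbit_sum_def by (simp add: sums_iff zn_def)
      then show ?thesis by (simp add: X_def)
    qed
    define S where "S = 1 + cos \<beta>"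
    have S: "S > 0" using one_plus_cos_pos[OF b] by (simp add: S_def)
    define Kc where "Kc = 18 * (K * 2 ^ m) / S ^ n"
    have "cmod (X z - c z) \<le> Kc * cmod z ^ n" if z: "z \<in> sector (- 1) \<beta>" "cmod z < S / (N.height_bound
        + 1)" for z
    proof -
      have nz: "z \<noteq> 0" using z by (auto simp: sector_def)
      have pz: "para (- 1 / z) \<ge> S / cmod z" using para_sector[OF z(1) b(2)] by (simp add: S_def)
      moreover have "N.height_bound + 1 < S / cmod z" using z(2) nz N.height_bound_pos by (simp add: field_simps)
      ultimately have p: "para (- 1 / z) > N.height_bound" by linarith
      have "cmod (X z - c z) = cmod (orbit_sum (chart_map f) Q (- 1 / z))" using Xc[OF p] by simp
      also have "\<dots> \<le> 18 * (K * 2 ^ m) / para (- 1 / z) ^ (m + 1)"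
        by (rule N.orbit_sum_le_power[OF Q order_refl p])
      also have "\<dots> \<le> 18 * (K * 2 ^ m) / (S / cmod z) ^ (m + 1)"
        using pz p K(2) S nz N.height_bound_pos by (intro divide_left_mono power_mono mult_pos_pos zero_less_power) auto
      finally show ?thesis by (simp add: Kc_def m power_divide)
    qed
    moreover have "Kc \<ge> 0" using K S by (simp add: Kc_def)
    moreover have "S / (N.height_bound + 1) > 0" using S N.height_bound_pos by simp
    ultimately show ?thesis unfolding c_def by - (rule exI[of _ Kc], rule exI[of _ "S / (N.height_bound + 1)"], blast)
  qed
  have "has_asymp_expansion X (- 1) A" unfolding has_asymp_expansion_def
  proof (intro allI impI)
    fix \<beta> :: real and n assume b: "0 < \<beta> \<and> \<beta> < pi"
    have "\<exists>c r. r > 0 \<and> (\<forall>z\<in>sector (- 1) \<beta>. cmod z < r \<longrightarrow> cmod (X z -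
        (\<Sum>k<n. fps_nth A k * z ^ k)) \<le> c * cmod (z ^ n))"
    proof (cases "n = 0")
      case False
      then show ?thesis using main[of \<beta> n] b by (auto simp: norm_power)
    next
      \<comment> \<open>The claim for n = 0 is weaker than that for n = 1, as A has no constant
        term.\<close>
      case True
      obtain c r where c: "c \<ge> 0" "r > 0" "\<And>z. z \<in> sector (- 1) \<beta> \<Longrightarrow>
          cmod z < r \<Longrightarrow> cmod (X z) \<le> c * cmod z"
        using main[of \<beta> 1] b A(1) by auto
      show ?thesis
      proof (rule exI[of _ c], rule exI[of _ "min r 1"], intro conjI ballI impI)
        fix z assume z: "z \<in> sector (- 1) \<beta>" "cmod z < min r 1"
        have "cmod (X z) \<le> c * cmod z" using c(3) z by auto
        also have "\<dots> \<le> c * 1" using c(1) z by (intro mult_left_mono) auto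
        finally show "cmod (X z - (\<Sum>k<n. fps_nth A k * z ^ k)) \<le> c * cmod (z ^ n)" using True by simp
      qed (use c in auto)
    qed
    then obtain c r where "r > 0" "\<forall>z\<in>sector (- 1) \<beta>. cmod z < r \<longrightarrow> cmod (X z -
        (\<Sum>k<n. fps_nth A k * z ^ k)) \<le> c * cmod (z ^ n)"
      by blast
    then have "\<forall>\<^sub>F z in at 0 within sector (- 1) \<beta>. norm (X z - (\<Sum>k<n. fps_nth A k * z ^ k))
        \<le> c * norm (z ^ n)"
      unfolding eventually_at by (intro exI[of _ r]) (auto simp: dist_norm)
    then show "(\<lambda>z. X z - (\<Sum>k<n. fps_nth A k * z ^ k)) \<in> O[at 0 within sector (- 1)
        \<beta>](\<lambda>z. z ^ n)"
      by (rule bigoI)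
  qed
  then show ?thesis by (simp only: X_def)
qed

lemma asymp_cong:
  assumes X: "has_asymp_expansion X (- 1) A" and M: "M \<ge> 0"
      and eq: "\<And>z. z \<in> horn M \<Longrightarrow> X z = Y z"
  shows "has_asymp_expansion Y (- 1) A"
  unfolding has_asymp_expansion_def
proof (intro allI impI)
  fix \<beta> :: real and n assume b: "0 < \<beta> \<and> \<beta> < pi"
  obtain r where r: "r > 0" "sector (- 1) \<beta> \<inter> ball 0 r \<subseteq> horn M" using sector_horn b M by blast
  have "\<forall>\<^sub>F z in at 0 within sector (- 1) \<beta>. X z - (\<Sum>k<n. fps_nth A k * z ^ k) = Y z -
      (\<Sum>k<n. fps_nth A k * z ^ k)"
    unfolding eventually_at using r eq by (intro exI[of _ r]) (auto simp: dist_norm)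
  moreover have "(\<lambda>z. X z - (\<Sum>k<n. fps_nth A k * z ^ k)) \<in> O[at 0 within sector (- 1)
      \<beta>](\<lambda>z. z ^ n)"
    using X b by (simp add: has_asymp_expansion_def)
  ultimately show "(\<lambda>z. Y z - (\<Sum>k<n. fps_nth A k * z ^ k)) \<in> O[at 0 within sector (- 1)
      \<beta>](\<lambda>z. z ^ n)"
    by (rule landau_o.big.in_cong[THEN iffD1])
qed

lemma asymp_uminus:
  assumes "has_asymp_expansion X d A"
  shows "has_asymp_expansion (\<lambda>z. - X z) d (- A)"
  unfolding has_asymp_expansion_def
proof (intro allI impI)
  fix \<beta> :: real and n assume "0 < \<beta> \<and> \<beta> < pi"
  then have "(\<lambda>z. X z - (\<Sum>k<n. fps_nth A k * z ^ k)) \<in> O[at 0 within sector d \<beta>](\<lambda>z. z ^ n)"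
    using assms by (simp add: has_asymp_expansion_def)
  then have "(\<lambda>z. - (X z - (\<Sum>k<n. fps_nth A k * z ^ k))) \<in> O[at 0 within sector d
      \<beta>](\<lambda>z. z ^ n)"
    by (subst landau_o.big.uminus_in_iff)
  then show "(\<lambda>z. - X z - (\<Sum>k<n. fps_nth (- A) k * z ^ k)) \<in> O[at 0 within sector d
      \<beta>](\<lambda>z. z ^ n)"
    by (simp add: sum_negf)
qed

lemma asymp_mirror:
  assumes "has_asymp_expansion X (- d) A"
  shows "has_asymp_expansion (\<lambda>z. X (- z)) d (fps_flip A)"
  unfolding has_asymp_expansion_def
proof (intro allI impI)
  fix \<beta> :: real and n assume "0 < \<beta> \<and> \<beta> < pi"
  then have *: "(\<lambda>z. X z - (\<Sum>k<n. fps_nth A k * z ^ k)) \<in> O[at 0 within sector (- d)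
      \<beta>](\<lambda>z. z ^ n)"
    using assms by (simp add: has_asymp_expansion_def)
  have filt: "filterlim uminus (at 0 within sector (- d) \<beta>) (at 0 within sector d \<beta>)"
    unfolding filterlim_at
  proof (intro conjI)
    show "\<forall>\<^sub>F z in at 0 within sector d \<beta>. - z \<in> sector (- d) \<beta> \<and> - z \<noteq> 0"
      by (auto simp: eventually_at_filter sector_uminus)
    show "(uminus \<longlongrightarrow> 0) (at 0 within sector d \<beta>)" by (auto intro!: tendsto_eq_intros)
  qed
  have "(\<lambda>z. X (- z) - (\<Sum>k<n. fps_nth A k * (- z) ^ k)) \<in> O[at 0 within sector d
      \<beta>](\<lambda>z. (- z) ^ n)"
    by (rule landau_o.big.compose[OF * filt])
  moreover have "(\<Sum>k<n. fps_nth A k * (- z) ^ k) = (\<Sum>k<n. fps_nth (fps_flip A) k * z ^ k)" for z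
    by (intro sum.cong) (auto simp: power_minus[of z])
  moreover have "(\<lambda>z. (- z) ^ n) \<in> O[at 0 within sector d \<beta>](\<lambda>z. z ^ n)"
    by (intro bigoI[of _ 1]) (auto simp: norm_power)
  ultimately show "(\<lambda>z. X (- z) - (\<Sum>k<n. fps_nth (fps_flip A) k * z ^ k)) \<in> O[at 0 within sector d
      \<beta>](\<lambda>z. z ^ n)"
    using landau_o.big_trans by simp
qed


text \<open>Composing A o f - A = d with the inverse of f gives an equation for the inverse, and
  replacing z by - z turns it into one for \<open>rev_germ f\<close>. Hence the solutions on both
  petals share the expansion A.\<close>

lemma rev_germ_formal_abel:
  assumes f: "f \<in> prenormalized" and A: "(A oo f) - A = d"
  shows "(- fps_flip A oo rev_germ f) - (- fps_flip A) = d oo (- rev_germ f)"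
proof -
  note f = prenormalizedD[OF f]
  note i = fps_inv_nth_0_1[OF f(2,3)]
  have X0: "fps_nth (- fps_X :: complex fps) 0 = 0" by simp
  have r0: "fps_nth (rev_germ f) 0 = 0" using i by (simp add: rev_germ_def)
  have neg: "- rev_germ f = fps_inv f oo (- fps_X)" by (simp add: rev_germ_def fps_flip_def)
  have "(- fps_X) oo rev_germ f = - rev_germ f"
    using fps_X_fps_compose_startby0[OF r0] by (simp add: fps_compose_uminus)
  then have 1: "- fps_flip A oo rev_germ f = - (A oo (- rev_germ f))"
    unfolding fps_flip_def fps_compose_uminus[of "A oo - fps_X"] fps_compose_assoc[OF r0 X0, of A, symmetric] by simp
  have "A oo (- rev_germ f) = (A oo fps_inv f) oo (- fps_X)"
    unfolding neg using fps_compose_assoc[OF X0 i(1), of A] by simp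
  also have "A oo fps_inv f = A - (d oo fps_inv f)"
  proof -
    have "A = (A oo f) oo fps_inv f"
      using fps_compose_assoc[OF i(1) f(2), of A] fps_inv_right[OF f(2,4)] by simp
    moreover have "A oo f = A + d" using A by (simp add: algebra_simps)
    ultimately have "A = (A oo fps_inv f) + (d oo fps_inv f)" by (metis fps_compose_add_distrib)
    then show ?thesis by (metis add_diff_cancel_right')
  qed
  also have "(A - (d oo fps_inv f)) oo (- fps_X) = fps_flip A - (d oo (- rev_germ f))"
    unfolding neg fps_compose_sub_distrib fps_flip_def using fps_compose_assoc[OF X0 i(1), of d] by simp
  finally show ?thesis using 1 by simp
qed

text \<open>\<open>R_+\<close> and \<open>R_-\<close> are taken as orbit sums, which tend to 0 at
  the origin within proper subsectors. Their difference is the jump, so both germs vanish at 0. The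
  link with \<open>jump\<close> is part of the conclusion because other pairs are compared through
  it.\<close>

lemma moment_pair_canonical:
  assumes f: "f \<in> prenormalized"
  obtains C R M qi q0 where "parabolic (chart_map f) (chart_map (rev_germ f)) C R" "M \<ge>
      near_translation.height_bound C R"
    "analytic_germ qi" "fps_nth qi 0 = 0" "analytic_germ q0" "fps_nth q0 0 = 0"
    "moment_pair f (qi, q0)"
    "\<And>w. Im w > 0 \<Longrightarrow> para w > M \<Longrightarrow> para (- w) > M \<Longrightarrow>
       jump (chart_map f) (chart_map (rev_germ f)) (\<lambda>w. eval_fps (abel_rhs f) (- 1 / w)) w = eval_fps qi (exp
           (2 * of_real pi * \<i> * fatou (chart_map f) w))"
    "\<And>w. Im w < 0 \<Longrightarrow> para w > M \<Longrightarrow> para (- w) > M \<Longrightarrow>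
       jump (chart_map f) (chart_map (rev_germ f)) (\<lambda>w. eval_fps (abel_rhs f) (- 1 / w)) w = - eval_fps q0
           (exp (- (2 * of_real pi * \<i> * fatou (chart_map f) w)))"
proof -
  note f' = prenormalizedD[OF f] note rf = rev_germ_prenormalized[OF f] note r' = prenormalizedD[OF rf]
  note i = germ_fps_inv[OF f'(1,2,4)] fps_inv_nth_0_1[OF f'(2,3)]
  note dl = abel_rhs[OF f] note ep = step_defect_order[OF f]
  define D where "D = (\<lambda>w. eval_fps (abel_rhs f) (- 1 / w))"
  define F B where "F = chart_map f" and "B = chart_map (rev_germ f)"
  obtain C R0 where par0: "parabolic F B C R0" unfolding F_def B_def using chart_map_parabolic[OF f] .
  obtain K X where X: "X \<ge> 1" "\<And>w. X \<le> cmod w \<Longrightarrow> cmod (D w) \<le> K / (cmod w)\<^sup>2"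
    "D holomorphic_on {w. X < cmod w}" unfolding D_def using germ_decay[OF dl(1-3)] by metis
  obtain X2 where X2: "\<And>w. X2 < cmod w \<Longrightarrow> F w - w - 1 = eval_fps (step_defect f) (- 1 / w)"
    unfolding F_def using chart_map_step_defect[OF f] by metis
  \<comment> \<open>Identities between composed germs hold only near 0; collected in one predicate
    they are transported to a neighbourhood of infinity at once.\<close>
  define near where "near = (\<lambda>z. (z \<noteq> 0 \<longrightarrow> eval_fps (abel_rhs f) z = - z + Ln (eval_fps
      f z / z))
     \<and> eval_fps (rev_germ f) (- z) = - eval_fps (fps_inv f) z
     \<and> eval_fps (- rev_germ f) z = - eval_fps (rev_germ f) z
     \<and> eval_fps (abel_rhs f oo (- rev_germ f)) z = eval_fps (abel_rhs f) (eval_fps (- rev_germ f) z)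
     \<and> ereal (cmod z) < fps_conv_radius f \<and> ereal (cmod z) < fps_conv_radius (fps_inv f)
     \<and> ereal (cmod z) < fps_conv_radius (rev_germ f))"
  have conv: "\<forall>\<^sub>F z in nhds 0. ereal (cmod z) < fps_conv_radius p" if "analytic_germ p" for p :: "complex fps"
  proof -
    have "\<forall>\<^sub>F z in nhds 0. z \<in> eball (0 :: complex) (fps_conv_radius p)"
      using that by (intro eventually_nhds_in_open) (auto simp: analytic_germ_def zero_ereal_def)
    then show ?thesis by simp
  qed
  have mr: "analytic_germ (- rev_germ f)" "fps_nth (- rev_germ f) 0 = 0" using germ_minus(1)[OF r'(1)] r' by auto
  have "\<forall>\<^sub>F z in nhds 0. near z"
    unfolding near_def
    by (intro eventually_conj dl(4) germ_minus(2)[OF r'(1)] germ_compose(2)[OF dl(1) mr] conv f'(1) i(1) r'(1))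
       (use eventually_uminus_nhds_0[OF rev_germ_eval[OF f]] in simp)
  then obtain X3 where X3: "X3 \<ge> 1" "\<And>w. X3 < cmod w \<Longrightarrow> near (- 1 / w)"
    by (rule eventually_nhds_0_at_infinity) blast
  define R where "R = max (max R0 X) (max X2 X3)"
  interpret P: parabolic F B C R by (rule parabolic_mono[OF par0]) (simp add: R_def)
  have D_le: "cmod (D w) \<le> K / (cmod w)\<^sup>2" if "R < cmod w" for w using X(2)[of w] that by (simp add: R_def)
  have D_holo: "D holomorphic_on {w. R < cmod w}" by (rule holomorphic_on_subset[OF X(3)]) (auto simp: R_def)
  obtain qi M1 where qi: "analytic_germ qi" "fps_nth qi 0 = 0" "M1 \<ge> P.M0"
    "\<And>w. Im w > 0 \<Longrightarrow> para w > M1 \<Longrightarrow> para (- w) > M1 \<Longrightarrow>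
       exp (2 * of_real pi * \<i> * fatou F w) \<in> eball 0 (fps_conv_radius qi) \<and>
       jump F B D w = eval_fps qi (exp (2 * of_real pi * \<i> * fatou F w))"
    by (rule P.jump_germ_upper[OF D_le D_holo]) blast+
  obtain ql M2 where ql: "analytic_germ ql" "fps_nth ql 0 = 0" "M2 \<ge> P.M0"
    "\<And>w. Im w < 0 \<Longrightarrow> para w > M2 \<Longrightarrow> para (- w) > M2 \<Longrightarrow>
       exp (- (2 * of_real pi * \<i> * fatou F w)) \<in> eball 0 (fps_conv_radius ql) \<and>
       jump F B D w = eval_fps ql (exp (- (2 * of_real pi * \<i> * fatou F w)))"
    by (rule P.jump_germ_lower[OF D_le D_holo]) blast+
  \<comment> \<open>In the lower half-plane the moment records \<open>R_- - R_+\<close>, the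
    negative of the jump.\<close>
  define q0 where "q0 = - ql"
  have q0: "analytic_germ q0" "fps_nth q0 0 = 0" "fps_conv_radius q0 = fps_conv_radius ql"
    using ql by (auto simp: q0_def analytic_germ_def)
  define M where "M = max M1 M2"
  have M: "M \<ge> M1" "M \<ge> M2" "M \<ge> P.M0" "M > 0" using qi(3) P.fwd.height_bound_pos by (auto simp: M_def)
  have wR: "R < cmod w" if "para w > M" for w using P.fwd.cmod_gt(1)[of w] that M(3) by simp
  have wX: "X2 < cmod w" "near (- 1 / w)" if "R < cmod w" for w using that X3(2)[of w] by (auto simp: R_def)
  \<comment> \<open>Every nonzero z in this disc has |-1 / z| > R. The point z = 0 is not of this
    form; there the property holds because it holds in a neighbourhood.\<close>
  have small: "near z" if "cmod z < 2 / M" for z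
  proof (cases "z = 0")
    case False
    have "M < 2 * cmod (- 1 / z)" using that False M(4) by (simp add: norm_divide field_simps)
    moreover have "2 * R < M" using P.fwd.height_bound_ge(3) M(3) by linarith
    ultimately have "R < cmod (- 1 / z)" by linarith
    then have "near (- 1 / (- 1 / z))" by (rule wX)
    then show ?thesis by simp
  qed (use X3(2)[of "of_real (X3 + 1)"] X3(1) eventually_nhds_x_imp_x[OF \<open>\<forall>\<^sub>F z in nhds 0. near
      z\<close>] in simp)
  have jl: "jump F B D w = - eval_fps q0 (exp (- (2 * of_real pi * \<i> * fatou F w)))"
    and jc: "exp (- (2 * of_real pi * \<i> * fatou F w)) \<in> eball 0 (fps_conv_radius q0)"
    if "Im w < 0" "para w > M" "para (- w) > M" for w
    using ql(4)[of w] that M unfolding q0_def by (auto simp: eval_fps_minus)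
  define Rp Rm \<Psi> where "Rp = (\<lambda>z. - orbit_sum F D (- 1 / z))"
      and "Rm = (\<lambda>z. orbit_sum B (\<lambda>w. D (- B w)) (1 / z))"
    and "\<Psi> = (\<lambda>z. fatou F (- 1 / z))"
  obtain A where A: "fps_nth A 0 = 0" "(A oo f) - A = abel_rhs f" using formal_abel[OF f dl(2,3)] .
  obtain A\<Psi> where A\<Psi>: "fps_nth A\<Psi> 0 = 0" "(A\<Psi> oo f) - A\<Psi> = step_defect f"
      using formal_abel[OF f ep(2,3)] .
  define Vp Vm where "Vp = horn M" and "Vm = uminus ` horn M"
  have inVp: "z \<noteq> 0" "para (- 1 / z) > M" "para (- 1 / z) > P.M0" "R < cmod (- 1 / z)" if "z \<in> Vp" for z
    using that M(3) wR[of "- 1 / z"] by (auto simp: Vp_def horn_def norm_divide)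
  have inVm: "z \<noteq> 0" "para (1 / z) > M" "para (1 / z) > P.M0" "R < cmod (- 1 / z)" if "z \<in> Vm" for z
    using that M(3) wR[of "1 / z"] by (auto simp: Vm_def horn_def norm_divide)
  have ap: "attracting_petal f Vp"
    unfolding attracting_petal_def Vp_def
    by (rule petal_horn[OF P.fwd.near_translation_axioms[unfolded F_def] M(3)]) (use small in \<open>auto simp:
        near_def\<close>)
  have pr: "petal (rev_germ f) (- 1) (horn M)"
    by (rule petal_horn[OF P.bwd.near_translation_axioms[unfolded B_def] M(3)]) (use small in \<open>auto simp:
        near_def\<close>)
  have rp: "repelling_petal f Vm"
    unfolding repelling_petal_def Vm_def
  proof
    show "petal (fps_inv f) 1 (uminus ` horn M)"
    proof (rule petal_mirror[OF pr])
      fix z assume "z \<in> horn M"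
      then have "near (- z)" using small[of "- z"] horn_norm M(4) by simp
      then show "eval_fps (fps_inv f) (- z) = - eval_fps (rev_germ f) z"
        "ereal (cmod z) < fps_conv_radius (fps_inv f)" by (auto simp: near_def)
    qed
    show "uminus ` horn M \<subseteq> eball 0 (fps_conv_radius f)"
      using small horn_norm M(4) by (auto simp: near_def)
  qed
  have holo_inv: "(\<lambda>z. - 1 / z) holomorphic_on Vp" "(\<lambda>z. 1 / z) holomorphic_on Vm"
    using inVp(1) inVm(1) by (auto intro!: holomorphic_intros)
  have Dh: "D holomorphic_on {w. para w > P.M0}"
    using P.fwd.cmod_gt(1) by (intro holomorphic_on_subset[OF D_holo]) auto
  have Bh: "B holomorphic_on {w. para w > P.M0}"
    using P.fwd.cmod_gt(1) by (intro holomorphic_on_subset[OF P.bwd.holo]) auto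
  have DBh: "(\<lambda>w. D (- B w)) holomorphic_on {w. para w > P.M0}"
    using P.cmod_B_ge by (intro holomorphic_on_compose_gen[OF _ D_holo, unfolded comp_def] holomorphic_intros Bh) auto
  have st: "sectorial_trivialization f Vp \<Psi>"
    unfolding sectorial_trivialization_def
  proof (intro conjI ballI exI)
    show "\<Psi> holomorphic_on Vp" unfolding \<Psi>_def
      by (rule holomorphic_on_compose_gen[OF holo_inv(1) P.fwd.holo_fatou, unfolded comp_def]) (use inVp in auto)
    show "\<Psi> (eval_fps f z) - \<Psi> z = 1" if "z \<in> Vp" for z
      using P.fwd.fatou_F[OF inVp(3)[OF that]] by (simp add: \<Psi>_def F_def chart_map_def)
    have "has_asymp_expansion (\<lambda>z. - (- orbit_sum F (\<lambda>w. eval_fps (step_defect f) (- 1 / w)) (- 1 /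
        z))) (- 1) (- A\<Psi>)"
      unfolding F_def by (intro asymp_uminus asymp_orbit_sum[OF f P.fwd.near_translation_axioms[unfolded F_def] ep(1)
          A\<Psi>])
    then show "has_asymp_expansion (\<lambda>z. \<Psi> z + 1 / z) (- 1) (- A\<Psi>)"
    proof (rule asymp_cong[OF _ less_imp_le[OF M(4)]])
      fix z assume "z \<in> horn M"
      then have p: "para (- 1 / z) > P.M0" using inVp by (simp add: Vp_def)
      have "orbit_sum F (\<lambda>w. F w - w - 1) (- 1 / z) = orbit_sum F (\<lambda>w. eval_fps (step_defect f) (- 1
          / w)) (- 1 / z)"
        unfolding orbit_sum_def using X2[OF wX(1)[OF P.fwd.cmod_gt(1)[OF P.fwd.para_iter_gt[OF p]]]] by simp
      then show "- (- orbit_sum F (\<lambda>w. eval_fps (step_defect f) (- 1 / w)) (- 1 / z)) = \<Psi> z + 1 / z"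
        by (simp add: \<Psi>_def fatou_def)
    qed
  qed
  have abp: "abel1_regular_part f (- 1) Vp Rp A"
    unfolding abel1_regular_part_def
  proof (intro conjI ballI impI)
    have "(\<lambda>z. orbit_sum F D (- 1 / z)) holomorphic_on Vp"
      by (rule holomorphic_on_compose_gen[OF holo_inv(1) P.fwd.holo_orbit_sum[OF P.decay_fwd[OF D_le] Dh], unfolded
          comp_def])
         (use inVp in auto)
    then show "Rp holomorphic_on Vp" unfolding Rp_def by (intro holomorphic_intros)
    show "has_asymp_expansion Rp (- 1) A"
      unfolding Rp_def F_def D_def by (rule asymp_orbit_sum[OF f P.fwd.near_translation_axioms[unfolded F_def] dl(1) A])
    fix z assume z: "z \<in> Vp"
    have "near z" using small horn_norm M(4) z by (simp add: Vp_def)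
    then have "eval_fps (abel_rhs f) z = - z + Ln (eval_fps f z / z)" using inVp(1)[OF z] by (simp add: near_def)
    moreover have "orbit_sum F D (F (- 1 / z)) = orbit_sum F D (- 1 / z) - D (- 1 / z)"
      by (rule P.fwd.orbit_sum_F[OF P.decay_fwd[OF D_le] inVp(3)[OF z]])
    moreover have "F (- 1 / z) = - 1 / eval_fps f z" "D (- 1 / z) = eval_fps (abel_rhs f) z"
        by (simp_all add: F_def chart_map_def D_def)
    ultimately show "Rp (eval_fps f z) - Rp z = - z + Ln (eval_fps f z / z)" by (simp add: Rp_def)
  qed
  have abm: "abel1_regular_part f 1 Vm Rm A"
    unfolding abel1_regular_part_def
  proof (intro conjI ballI impI)
    show "Rm holomorphic_on Vm" unfolding Rm_def
      by (rule holomorphic_on_compose_gen[OF holo_inv(2) P.bwd.holo_orbit_sum[OF P.decay_bwd[OF D_le] DBh], unfolded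
          comp_def])
         (use inVm in auto)
    let ?d = "abel_rhs f oo (- rev_germ f)"
    have "has_asymp_expansion (\<lambda>z. - orbit_sum B (\<lambda>w. eval_fps ?d (- 1 / w)) (- 1 / z)) (- 1) (-
        fps_flip A)"
      unfolding B_def
      by (rule asymp_orbit_sum[OF rf P.bwd.near_translation_axioms[unfolded B_def] germ_compose(1)[OF dl(1) mr] _
          rev_germ_formal_abel[OF f A(2)]])
         (use A(1) in simp)
    then have "has_asymp_expansion (\<lambda>z. - orbit_sum B (\<lambda>w. D (- B w)) (- 1 / z)) (- 1) (- fps_flip A)"
    proof (rule asymp_cong[OF _ less_imp_le[OF M(4)]])
      fix z assume "z \<in> horn M"
      then have p: "para (- 1 / z) > P.M0" using inVp by (simp add: Vp_def)
      have "eval_fps ?d (- 1 / w) = D (- B w)" if "R < cmod w" for w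
        using wX(2)[OF that] by (simp add: near_def D_def B_def chart_map_def)
      then have "orbit_sum B (\<lambda>w. eval_fps ?d (- 1 / w)) (- 1 / z) = orbit_sum B (\<lambda>w. D (- B w)) (- 1 / z)"
        unfolding orbit_sum_def using P.bwd.cmod_gt(1)[OF P.bwd.para_iter_gt[OF p]] by simp
      then show "- orbit_sum B (\<lambda>w. eval_fps ?d (- 1 / w)) (- 1 / z) = - orbit_sum B (\<lambda>w. D (- B w))
          (- 1 / z)" by simp
    qed
    then have "has_asymp_expansion (\<lambda>z. - (- orbit_sum B (\<lambda>w. D (- B w)) (- 1 / z))) (- 1) (- (-
        fps_flip A))"
      by (rule asymp_uminus)
    then have "has_asymp_expansion (\<lambda>z. - (- orbit_sum B (\<lambda>w. D (- B w)) (- 1 / (- z)))) 1 (fps_flip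
        (- (- fps_flip A)))"
      by (rule asymp_mirror)
    moreover have "fps_flip (- (- fps_flip A)) = A" by (intro fps_ext) (simp flip: mult.assoc power_mult_distrib)
    ultimately show "has_asymp_expansion Rm 1 A" by (simp add: Rm_def[abs_def])
    fix z assume z: "z \<in> Vm" "eval_fps f z \<in> Vm"
    let ?w = "- 1 / z"
    have "cmod (- z) < 2 / M" using z(1) horn_norm M(4) unfolding Vm_def by fastforce
    then have "near z" by (intro small) simp
    then have dz: "eval_fps (abel_rhs f) z = - z + Ln (eval_fps f z / z)" using inVm(1)[OF z(1)] by (simp add: near_def)
    have Fw: "1 / eval_fps f z = - F ?w" by (simp add: F_def chart_map_def)
    have pF: "para (- F ?w) > P.M0" using inVm(3)[OF z(2)] unfolding Fw .
    have "orbit_sum B (\<lambda>w. D (- B w)) (B (- F ?w)) = orbit_sum B (\<lambda>w. D (- B w)) (- F ?w) - D (- B (-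
        F ?w))"
      by (rule P.bwd.orbit_sum_F[OF P.decay_bwd[OF D_le] pF])
    moreover have "B (- F ?w) = - ?w" by (rule P.BF[OF inVm(4)[OF z(1)]])
    ultimately have "orbit_sum B (\<lambda>w. D (- B w)) (- ?w) = orbit_sum B (\<lambda>w. D (- B w)) (- F ?w) - D
        ?w" by simp
    moreover have "D ?w = eval_fps (abel_rhs f) z" by (simp add: D_def)
    ultimately show "Rm (eval_fps f z) - Rm z = - z + Ln (eval_fps f z / z)"
      using dz unfolding Rm_def Fw by simp
  qed
  have lens: "para (- 1 / z) > M" "para (- (- 1 / z)) > M" "jump F B D (- 1 / z) = Rp z - Rm z"
    "Im (- 1 / z) = Im z / (cmod z)\<^sup>2" "cmod z > 0" if "z \<in> Vp \<inter> Vm" for z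
    using inVp[of z] inVm[of z] that by (auto simp: jump_def Rp_def Rm_def Im_divide cmod_power2)
  have "moment_pair f (qi, q0)"
    unfolding moment_pair_def case_prod_conv
  proof (intro conjI exI ballI impI)
    show "A - A = fps_const 0" by simp
    fix z assume z: "z \<in> Vp \<inter> Vm"
    note l = lens[OF z]
    {
      assume "Im z > 0"
      then have "Im (- 1 / z) > 0" using l(4,5) by simp
      then have *: "exp (2 * of_real pi * \<i> * fatou F (- 1 / z)) \<in> eball 0 (fps_conv_radius qi) \<and>
       jump F B D (- 1 / z) = eval_fps qi (exp (2 * of_real pi * \<i> * fatou F (- 1 / z)))"
        using l M by (intro qi(4)) linarith+
      then show "exp (2 * of_real pi * \<i> * \<Psi> z) \<in> eball 0 (fps_conv_radius qi)" by (simp only: \<Psi>_def)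
      show "Rp z - Rm z = eval_fps qi (exp (2 * of_real pi * \<i> * \<Psi> z))" using * l(3) by (simp only: \<Psi>_def)
    }
    {
      assume "Im z < 0"
      then have i: "Im (- 1 / z) < 0" using l(4,5) by (simp add: divide_neg_pos)
      show "exp (- (2 * of_real pi * \<i> * \<Psi> z)) \<in> eball 0 (fps_conv_radius q0)"
        using jc[OF i l(1,2)] by (simp only: \<Psi>_def)
      show "Rm z - Rp z = eval_fps q0 (exp (- (2 * of_real pi * \<i> * \<Psi> z)))"
        using jl[OF i l(1,2)] l(3) by (simp add: \<Psi>_def algebra_simps)
    }
  qed (use qi q0 ap rp st abp abm in auto)
  moreover have "jump F B D w = eval_fps qi (exp (2 * of_real pi * \<i> * fatou F w))"
    if "Im w > 0" "para w > M" "para (- w) > M" for w using qi(4)[of w] that M by simp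
  ultimately show ?thesis
    using that[of C R M qi q0] P.parabolic_axioms M(3) qi(1,2) q0(1,2) jl unfolding F_def B_def D_def by simp
qed


section \<open>Uniqueness of the moment and transfer to a conjugate germ\<close>

lemma germ_eqI:
  assumes p: "analytic_germ p" "analytic_germ q" and t: "t \<longlonglongrightarrow> 0" "\<And>n :: nat. t n \<noteq> 0"
    and eq: "\<And>n. eval_fps p (t n) = eval_fps q (t n)"
  shows "p = q"
proof (rule ccontr)
  assume ne: "p \<noteq> q"
  define d k where "d = p - q" and "k = subdegree d"
  have d: "analytic_germ d" unfolding d_def by (rule germ_diff(1)[OF p])
  have "\<forall>\<^sub>F z in nhds 0. eval_fps d z = eval_fps p z - eval_fps q z
      \<and> z \<in> eball 0 (fps_conv_radius d)"
    unfolding d_def using d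
    by (intro eventually_conj germ_diff(2)[OF p] eventually_nhds_in_open) (auto simp: analytic_germ_def
        zero_ereal_def d_def)
  then have "\<forall>\<^sub>F n in sequentially. eval_fps d (t n) = eval_fps p (t n) - eval_fps q (t n)
      \<and> t n \<in> eball 0 (fps_conv_radius d)"
    using t(1) by (rule eventually_compose_filterlim)
  then have "\<forall>\<^sub>F n in sequentially. eval_fps (fps_shift k d) (t n) = 0"
  proof eventually_elim
    case (elim n)
    have "eval_fps (fps_shift k d) (t n) = eval_fps d (t n) / t n ^ k"
      using elim t(2)[of n] by (subst eval_fps_shift) (auto simp: k_def)
    then show ?case using elim eq by simp
  qed
  moreover have "analytic_germ (fps_shift k d)" using d by (simp add: analytic_germ_def)
  then have "(\<lambda>n. eval_fps (fps_shift k d) (t n)) \<longlonglongrightarrow> eval_fps (fps_shift k d) 0"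
    by (intro isCont_tendsto_compose[OF germ_isCont t(1)])
  ultimately have "eval_fps (fps_shift k d) 0 = 0"
    by (metis LIMSEQ_unique tendsto_eventually)
  then have "fps_nth d k = 0" by (simp add: eval_fps_at_0)
  then have "d = 0" unfolding k_def by (rule nth_subdegree_zero_iff[THEN iffD1])
  then show False using ne unfolding d_def by (metis right_minus_eq)
qed

lemma eval_scale: "eval_fps (p oo (fps_const b * fps_X)) z = eval_fps p (b * z :: complex)"
  unfolding eval_fps_def fps_nth_compose_linear power_mult_distrib by (simp only: mult_ac)

lemma germ_scale: "analytic_germ p \<Longrightarrow> analytic_germ (p oo (fps_const b * fps_X))"
proof -
  assume p: "analytic_germ p"
  have "(\<lambda>z. b * z) has_fps_expansion (fps_const b * fps_X)" by (intro fps_expansion_intros)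
  then show ?thesis by (intro germ_compose(1)[OF p germ_expansion(1)]) auto
qed

lemma germ_add_const:
  assumes "analytic_germ p"
  shows "analytic_germ (p + fps_const a)" "\<forall>\<^sub>F z in nhds 0. eval_fps (p + fps_const a) z = eval_fps p z + a"
  using germ_expansion[OF has_fps_expansion_add[of "eval_fps p" p "\<lambda>_. a" "fps_const a"]] assms
  by (simp_all add: analytic_germ_iff)

lemma germ_eq_scaled:
  assumes p: "analytic_germ p" "analytic_germ q" and t: "t \<longlonglongrightarrow> 0" "\<And>n :: nat. t n \<noteq> 0"
    and eq: "\<And>n. eval_fps q (t n) = eval_fps p (b * t n) + a"
  shows "q = (p oo (fps_const b * fps_X)) + fps_const a"
proof -
  let ?p = "p oo (fps_const b * fps_X)"
  note s = germ_add_const[OF germ_scale[OF p(1)], of b a]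
  have "\<forall>\<^sub>F n in sequentially. eval_fps (?p + fps_const a) (t n) = eval_fps ?p (t n) + a"
    using s(2) t(1) by (rule eventually_compose_filterlim)
  then obtain N where N: "\<And>n. n \<ge> N \<Longrightarrow> eval_fps (?p + fps_const a) (t n) = eval_fps ?p (t n) + a"
    unfolding eventually_sequentially by blast
  show ?thesis
  proof (rule germ_eqI[OF p(2) s(1), of "\<lambda>n. t (n + N)"])
    show "(\<lambda>n. t (n + N)) \<longlonglongrightarrow> 0" by (rule LIMSEQ_ignore_initial_segment[OF t(1)])
    show "eval_fps q (t (n + N)) = eval_fps (?p + fps_const a) (t (n + N))" for n
      using N[of "n + N"] eq by (simp add: eval_scale)
  qed (rule t(2))
qed

lemma scale_scale: "(p oo (fps_const b * fps_X)) oo (fps_const c * fps_X) = p oo (fps_const (b * c) * fps_X :: complex fps)"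
  by (intro fps_ext) (simp add: power_mult_distrib)

lemma moment_rel_sym:
  assumes "(x, y) \<in> moment_rel"
  shows "(y, x) \<in> moment_rel"
proof -
  obtain g1 h1 g2 h2 where xy: "x = (g1, h1)" "y = (g2, h2)" by (metis surj_pair)
  obtain a b where b: "b \<noteq> 0" and g: "g1 = (g2 oo (fps_const b * fps_X)) + fps_const a"
    and h: "h1 = (h2 oo (fps_const (1 / b) * fps_X)) - fps_const a"
    using assms by (auto simp: moment_rel_def xy)
  have "g2 = (g1 oo (fps_const (1 / b) * fps_X)) + fps_const (- a)"
    unfolding g fps_compose_add_distrib scale_scale using b by simp
  moreover have "h2 = (h1 oo (fps_const (1 / (1 / b)) * fps_X)) - fps_const (- a)"
    unfolding h fps_compose_sub_distrib scale_scale using b by simp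
  moreover have "1 / b \<noteq> 0" using b by simp
  ultimately show ?thesis unfolding moment_rel_def xy mem_Collect_eq case_prod_conv by blast
qed

lemma moment_rel_trans:
  assumes "(x, y) \<in> moment_rel" "(y, z) \<in> moment_rel"
  shows "(x, z) \<in> moment_rel"
proof -
  obtain g1 h1 g2 h2 g3 h3 where xyz: "x = (g1, h1)" "y = (g2, h2)" "z = (g3, h3)" by (metis surj_pair)
  obtain a b where b: "b \<noteq> 0" and g: "g1 = (g2 oo (fps_const b * fps_X)) + fps_const a"
    and h: "h1 = (h2 oo (fps_const (1 / b) * fps_X)) - fps_const a"
    using assms(1) by (auto simp: moment_rel_def xyz)
  obtain c d where d: "d \<noteq> 0" and g': "g2 = (g3 oo (fps_const d * fps_X)) + fps_const c"
    and h': "h2 = (h3 oo (fps_const (1 / d) * fps_X)) - fps_const c"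
    using assms(2) by (auto simp: moment_rel_def xyz)
  have "g1 = (g3 oo (fps_const (d * b) * fps_X)) + fps_const (c + a)"
    unfolding g g' fps_compose_add_distrib scale_scale by (simp add: add.assoc)
  moreover have "h1 = (h3 oo (fps_const (1 / (d * b)) * fps_X)) - fps_const (c + a)"
    unfolding h h' fps_compose_sub_distrib scale_scale by (simp add: diff_diff_eq)
  moreover have "d * b \<noteq> 0" using b d by simp
  ultimately show ?thesis unfolding moment_rel_def xyz mem_Collect_eq case_prod_conv by blast
qed

text \<open>The half-opening 3 pi / 4 lies strictly between pi / 2 and pi. So the sectors around
  both directions contain the imaginary axis, and any two petals contain it near 0.\<close>

lemma sectors_near_axis:
  assumes "z \<noteq> 0" "Re z \<le> 0 \<or> d = 1" "Re z \<ge> 0 \<or> d = - 1" "d = 1 \<or> d = - 1"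
  shows "z \<in> sector d (3 * pi / 4)"
proof -
  have "Re (z / d) \<ge> 0" "z / d \<noteq> 0" using assms by auto
  then have "\<bar>Arg (z / d)\<bar> \<le> pi / 2" using Arg_Re_nonneg by blast
  also have "\<dots> < 3 * pi / 4" using pi_gt3 by simp
  finally show ?thesis using assms(1) by (simp add: sector_def)
qed

lemma asymp_limit:
  assumes A: "has_asymp_expansion X d A"
      and z: "z \<longlonglongrightarrow> 0" "\<forall>\<^sub>F n in sequentially. z n \<in> sector d (3 * pi / 4)"
  shows "(\<lambda>n :: nat. X (z n)) \<longlonglongrightarrow> fps_nth A 0"
proof -
  have "(\<lambda>z. X z - fps_nth A 0) \<in> O[at 0 within sector d (3 * pi / 4)](\<lambda>z. z ^ 1)"
    using A[unfolded has_asymp_expansion_def, rule_format, of "3 * pi / 4" 1] pi_gt3 by simp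
  moreover have "filterlim z (at 0 within sector d (3 * pi / 4)) sequentially"
    unfolding filterlim_at using z by (auto elim: eventually_mono simp: sector_def)
  ultimately have "(\<lambda>n. X (z n) - fps_nth A 0) \<in> O(\<lambda>n. z n ^ 1)" by (rule landau_o.big.compose)
  then obtain c where c: "\<forall>\<^sub>F n in sequentially. norm (X (z n) - fps_nth A 0) \<le> c * norm (z n ^ 1)"
    by (auto elim: landau_o.bigE)
  have "(\<lambda>n. c * norm (z n ^ 1)) \<longlonglongrightarrow> c * norm ((0 :: complex) ^ 1)"
      by (intro tendsto_intros z)
  then have "(\<lambda>n. c * norm (z n ^ 1)) \<longlonglongrightarrow> 0" by simp
  then have "(\<lambda>n. X (z n) - fps_nth A 0) \<longlonglongrightarrow> 0" by (rule Lim_null_comparison[OF c])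
  then show ?thesis by (simp add: LIM_zero_iff)
qed

text \<open>Orbits drift to the right in the chart, so from some index on they lie in a proper
  sector wherever they start in the petal. Only in such sectors do the expansions give
  limits.\<close>

lemma (in near_translation) orbit_sector:
  assumes w: "para w > height_bound"
  shows "(\<lambda>n. - 1 / (F ^^ n) w) \<longlonglongrightarrow> 0" "\<forall>\<^sub>F n in sequentially. - 1 / (F
      ^^ n) w \<in> sector (- 1) (3 * pi / 4)"
    "\<forall>\<^sub>F n in sequentially. 1 / (F ^^ n) w \<in> sector 1 (3 * pi / 4)"
proof -
  show "(\<lambda>n. - 1 / (F ^^ n) w) \<longlonglongrightarrow> 0"
      by (rule tendsto_divide_0[OF tendsto_const iter_at_infinity[OF w]])
  obtain N :: nat where N: "real N > 3 - Re w" using reals_Archimedean2 by blast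
  have Re: "Re (1 / (F ^^ n) w) > 0" "(F ^^ n) w \<noteq> 0" if "n \<ge> N" for n
  proof -
    have "real N \<le> real n" using that by simp
    then have p: "Re ((F ^^ n) w) > 0" using N Re_iter_ge[OF w, of n] by linarith
    then show "(F ^^ n) w \<noteq> 0" by auto
    then show "Re (1 / (F ^^ n) w) > 0" using p by (simp add: Re_divide sum_power2_gt_zero_iff complex_eq_iff)
  qed
  show "\<forall>\<^sub>F n in sequentially. 1 / (F ^^ n) w \<in> sector 1 (3 * pi / 4)"
    unfolding eventually_sequentially using Re by (intro exI[of _ N] allI impI sectors_near_axis) (auto simp: less_imp_le)
  show "\<forall>\<^sub>F n in sequentially. - 1 / (F ^^ n) w \<in> sector (- 1) (3 * pi / 4)"
    unfolding eventually_sequentially using Re by (intro exI[of _ N] allI impI sectors_near_axis) (auto simp: less_imp_le)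
qed

text \<open>Arbitrary petals, \<Psi>, \<open>R_+\<close> and \<open>R_-\<close> are compared with
  the orbit sums by going to the limit along orbits. The expansions fix these limits, so everything
  agrees up to constants: that of \<Psi> becomes the factor b, those of \<open>R_+\<close> and
  \<open>R_-\<close> become a. The imaginary axis lies in any pair of petals near 0.\<close>

lemma moment_pair_jump:
  assumes f: "f \<in> prenormalized" and par0: "parabolic (chart_map f) (chart_map (rev_germ f)) C R0"
      and mp: "moment_pair f (gi, g0)"
  obtains a b X where "b \<noteq> 0"
    "\<And>y. y > X \<Longrightarrow> jump (chart_map f) (chart_map (rev_germ f)) (\<lambda>w. eval_fps (abel_rhs f)
        (- 1 / w)) (\<i> * of_real y) =
        eval_fps gi (b * exp (2 * of_real pi * \<i> * fatou (chart_map f) (\<i> * of_real y))) + a"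
    "\<And>y. y > X \<Longrightarrow> jump (chart_map f) (chart_map (rev_germ f)) (\<lambda>w. eval_fps (abel_rhs f)
        (- 1 / w)) (- \<i> * of_real y) =
        - eval_fps g0 (1 / b * exp (- (2 * of_real pi * \<i> * fatou (chart_map f) (- \<i> * of_real y)))) + a"
proof -
  note dl = abel_rhs[OF f]
  define D where "D = (\<lambda>w. eval_fps (abel_rhs f) (- 1 / w))"
  define F B where "F = chart_map f" and "B = chart_map (rev_germ f)"
  obtain Vp Vm \<Psi> Rp Rm Ap Am c where
    Vp: "petal f (- 1) Vp" and Vm: "petal (fps_inv f) 1 Vm"
    and \<Psi>: "sectorial_trivialization f Vp \<Psi>"
    and rp: "abel1_regular_part f (- 1) Vp Rp Ap" and rm: "abel1_regular_part f 1 Vm Rm Am"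
    and up: "\<And>z. z \<in> Vp \<inter> Vm \<Longrightarrow> Im z > 0 \<Longrightarrow>
        Rp z - Rm z = eval_fps gi (exp (2 * of_real pi * \<i> * \<Psi> z))"
    and low: "\<And>z. z \<in> Vp \<inter> Vm \<Longrightarrow> Im z < 0 \<Longrightarrow>
        Rm z - Rp z = eval_fps g0 (exp (- (2 * of_real pi * \<i> * \<Psi> z)))"
    using mp unfolding moment_pair_def attracting_petal_def repelling_petal_def by fast
  obtain A\<Psi> where A\<Psi>: "has_asymp_expansion (\<lambda>z. \<Psi> z + 1 / z) (- 1) A\<Psi>"
    and \<Psi>f: "\<And>z. z \<in> Vp \<Longrightarrow> \<Psi> (eval_fps f z) = \<Psi> z + 1"
    using \<Psi> unfolding sectorial_trivialization_def by (auto simp: diff_eq_eq add.commute)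
  have b34: "0 < 3 * pi / 4 \<and> 3 * pi / 4 < pi" by simp
  obtain r1 where r1: "r1 > 0" "sector (- 1) (3 * pi / 4) \<inter> ball 0 r1 \<subseteq> Vp"
    using Vp b34 unfolding petal_def by metis
  obtain r2 where r2: "r2 > 0" "sector 1 (3 * pi / 4) \<inter> ball 0 r2 \<subseteq> Vm"
    using Vm b34 unfolding petal_def by metis
  have Vp_inv: "eval_fps f z \<in> Vp" if "z \<in> Vp" for z using Vp that unfolding petal_def by blast
  have Vm_inv: "eval_fps (fps_inv f) z \<in> Vm" if "z \<in> Vm" for z using Vm that unfolding petal_def by blast
  define near where "near = (\<lambda>z. (z \<noteq> 0 \<longrightarrow> eval_fps (abel_rhs f) z = - z + Ln (eval_fps
      f z / z))
     \<and> eval_fps (rev_germ f) (- z) = - eval_fps (fps_inv f) z)"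
  have "\<forall>\<^sub>F z in nhds 0. near z"
    unfolding near_def by (intro eventually_conj dl(4)) (use eventually_uminus_nhds_0[OF rev_germ_eval[OF f]] in simp)
  then obtain X3 where X3: "X3 \<ge> 1" "\<And>w. X3 < cmod w \<Longrightarrow> near (- 1 / w)"
    by (rule eventually_nhds_0_at_infinity) blast
  define R where "R = max R0 X3"
  interpret P: parabolic F B C R unfolding F_def B_def by (rule parabolic_mono[OF par0]) (simp add: R_def)
  have near: "near (- 1 / w)" "w \<noteq> 0" if "R < cmod w" for w using X3(1) X3(2)[of w] that by (auto simp: R_def)
  define b where "b = exp (2 * of_real pi * \<i> * fps_nth A\<Psi> 0)"
  define a where "a = fps_nth Am 0 - fps_nth Ap 0"
  have main: "\<Psi> (- 1 / w) = fps_nth A\<Psi> 0 + fatou F w \<and> jump F B D w = Rp (- 1 / w) - Rm (- 1 / w) + a"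
    if w: "para w > P.M0" "para (- w) > P.M0" "- 1 / w \<in> Vp" "- 1 / w \<in> Vm" for w
  proof -
    note orb = P.fwd.orbit_sector[OF w(1)] and orb' = P.bwd.orbit_sector[OF w(2)]
    define z where "z = (\<lambda>n. - 1 / (F ^^ n) w)"
    have zf: "z n = (eval_fps f ^^ n) (- 1 / w)" for n
      using chart_map_funpow[where f = f and n = n and z = "- 1 / w"] by (simp add: z_def F_def)
    have zV: "z n \<in> Vp" for n unfolding zf by (induction n) (use w(3) Vp_inv in auto)
    have zS: "z (Suc n) = eval_fps f (z n)" for n by (simp add: zf)
    have gt: "R < cmod ((F ^^ n) w)" for n by (rule P.fwd.cmod_gt(1)[OF P.fwd.para_iter_gt[OF w(1)]])
    have z0: "z \<longlonglongrightarrow> 0" "\<forall>\<^sub>F n in sequentially. z n \<in> sector (- 1) (3 * pi / 4)"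
      using orb unfolding z_def by auto
    have Dz: "D ((F ^^ n) w) = - z n + Ln (eval_fps f (z n) / z n)" for n
      using near[OF gt[of n]] by (simp add: near_def D_def z_def)
    have \<Psi>n: "\<Psi> (z n) = \<Psi> (- 1 / w) + of_nat n" for n
      by (induction n) (use \<Psi>f zV zS in \<open>auto simp: z_def\<close>)
    \<comment> \<open>This sequence is constant: \<Psi> grows by 1 in each step, and 1 / z n cancels
      the n-th iterate of w.\<close>
    have "(\<lambda>n. (\<Psi> (z n) + 1 / z n) + ((F ^^ n) w - of_nat n)) \<longlonglongrightarrow> fps_nth A\<Psi>
        0 + fatou F w"
      by (intro tendsto_add asymp_limit[OF A\<Psi> z0] P.fwd.fatou_lim w(1))
    moreover have "(\<Psi> (z n) + 1 / z n) + ((F ^^ n) w - of_nat n) = \<Psi> (- 1 / w)" for n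
      by (simp add: \<Psi>n) (simp add: z_def)
    ultimately have 1: "\<Psi> (- 1 / w) = fps_nth A\<Psi> 0 + fatou F w"
      by (simp add: LIMSEQ_const_iff)
    have 2: "orbit_sum F D w = fps_nth Ap 0 - Rp (- 1 / w)"
    proof (rule orbit_sum_telescope[where A = "\<lambda>w. Rp (- 1 / w)"])
      show "D ((F ^^ n) w) = Rp (- 1 / (F ^^ Suc n) w) - Rp (- 1 / (F ^^ n) w)" for n
        using rp zV[of n] zV[of "Suc n"] zS[of n] Dz[of n] unfolding abel1_regular_part_def z_def by metis
      show "(\<lambda>n. Rp (- 1 / (F ^^ n) w)) \<longlonglongrightarrow> fps_nth Ap 0"
        using rp asymp_limit[OF _ z0] unfolding abel1_regular_part_def z_def by blast
    qed
    \<comment> \<open>u is the backward orbit of w and v the same orbit in the variable z. The given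
      repelling petal is invariant under the inverse germ, so v stays in it.\<close>
    define u v where "u = (\<lambda>n. - (B ^^ n) (- w))" and "v = (\<lambda>n. - 1 / u n)"
    have v0: "v \<longlonglongrightarrow> 0" "\<forall>\<^sub>F n in sequentially. v n \<in> sector 1 (3 * pi / 4)"
      using orb'(3) tendsto_minus[OF orb'(1)] unfolding v_def u_def by auto
    have ugt: "R < cmod (u n)" for n
      unfolding u_def norm_minus_cancel by (rule P.bwd.cmod_gt(1)[OF P.bwd.para_iter_gt[OF w(2)]])
    have uS: "u (Suc n) = - B (- u n)" for n by (simp add: u_def)
    have Fu: "F (u (Suc n)) = u n" for n using P.FB[of "- u n"] ugt[of n] by (simp add: uS)
    have fv: "eval_fps f (v (Suc n)) = v n" for n using arg_cong[OF Fu[of n], of "\<lambda>x. - 1 / x"]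
      by (simp add: v_def F_def chart_map_def)
    have vS: "v (Suc n) = eval_fps (fps_inv f) (v n)" for n
    proof -
      have "v (Suc n) = 1 / B (- u n)" by (simp add: v_def uS)
      also have "\<dots> = - eval_fps (rev_germ f) (- v n)" by (simp add: B_def chart_map_def v_def)
      also have "\<dots> = eval_fps (fps_inv f) (v n)" using near(1)[OF ugt[of n]] by (simp add: near_def v_def)
      finally show ?thesis .
    qed
    have vV: "v n \<in> Vm" for n
      by (induction n) (use w(4) Vm_inv vS in \<open>auto simp: v_def u_def\<close>)
    have Du: "D (u n) = - v n + Ln (eval_fps f (v n) / v n)" for n
      using near[OF ugt[of n]] by (simp add: near_def D_def v_def)
    have 3: "orbit_sum B (\<lambda>x. D (- B x)) (- w) = - fps_nth Am 0 - - Rm (1 / (- w))"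
    proof (rule orbit_sum_telescope[where A = "\<lambda>x. - Rm (1 / x)"])
      have e: "1 / (B ^^ n) (- w) = v n" for n by (simp add: v_def u_def)
      fix n
      have "D (- B ((B ^^ n) (- w))) = D (u (Suc n))" by (simp add: u_def)
      also have "\<dots> = Rm (v n) - Rm (v (Suc n))"
        using rm vV[of n] vV[of "Suc n"] fv[of n] Du[of "Suc n"] unfolding abel1_regular_part_def by metis
      finally show "D (- B ((B ^^ n) (- w))) = - Rm (1 / (B ^^ Suc n) (- w)) - - Rm (1 / (B ^^ n) (- w))"
        unfolding e by simp
    next
      have e: "1 / (B ^^ n) (- w) = v n" for n by (simp add: v_def u_def)
      show "(\<lambda>n. - Rm (1 / (B ^^ n) (- w))) \<longlonglongrightarrow> - fps_nth Am 0"
        unfolding e using rm asymp_limit[OF _ v0] unfolding abel1_regular_part_def by (intro tendsto_minus) blast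
    qed
    show ?thesis using 1 2 3 by (simp add: jump_def a_def)
  qed
  define X where "X = max P.M0 (max (1 / r1) (1 / r2))"
  have axis: "jump F B D w = Rp (- 1 / w) - Rm (- 1 / w) + a" "\<Psi> (- 1 / w) = fps_nth A\<Psi> 0 + fatou F w" "- 1
      / w \<in> Vp \<inter> Vm"
    if "w = \<i> * of_real y \<or> w = - \<i> * of_real y" "y > X" for y w
  proof -
    have y: "y > P.M0" "y > 1 / r1" "y > 1 / r2" "y > 0" using that(2) P.fwd.height_bound_pos by (auto simp: X_def)
    have n: "cmod w = y" "Re w = 0" "w \<noteq> 0" using that(1) y by (auto simp: norm_mult)
    have iy: "1 / y < r1" "1 / y < r2" using y r1(1) r2(1) by (auto simp: field_simps)
    have Re0: "Re (- 1 / w) = 0" using n by (simp add: Re_divide)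
    have "- 1 / w \<in> sector (- 1) (3 * pi / 4)" "- 1 / w \<in> sector 1 (3 * pi / 4)"
      using Re0 n by (intro sectors_near_axis; simp)+
    moreover have "- 1 / w \<in> ball 0 r1" "- 1 / w \<in> ball 0 r2" using n iy by (auto simp: norm_divide)
    ultimately show V: "- 1 / w \<in> Vp \<inter> Vm" using r1(2) r2(2) by blast
    have "para w > P.M0" "para (- w) > P.M0" using n y by (auto simp: para_def)
    then show "jump F B D w = Rp (- 1 / w) - Rm (- 1 / w) + a" "\<Psi> (- 1 / w) = fps_nth A\<Psi> 0 + fatou F w"
      using main[of w] V by auto
  qed
  show ?thesis
  proof (rule that[of b X a])
    show "b \<noteq> 0" by (simp add: b_def)
    fix y assume y: "y > X"
    have y0: "y > 0" using y P.fwd.height_bound_pos by (auto simp: X_def)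
    let ?w = "\<i> * complex_of_real y"
    have "Im (- 1 / ?w) > 0" using y0 by (simp add: Im_divide power2_eq_square)
    then have "jump F B D ?w = eval_fps gi (exp (2 * of_real pi * \<i> * (fps_nth A\<Psi> 0 + fatou F ?w))) + a"
      using axis[of ?w y] y up by simp
    then show "jump (chart_map f) (chart_map (rev_germ f)) (\<lambda>w. eval_fps (abel_rhs f) (- 1 / w)) ?w =
        eval_fps gi (b * exp (2 * of_real pi * \<i> * fatou (chart_map f) ?w)) + a"
      by (simp only: b_def exp_add[symmetric] distrib_left[symmetric] F_def B_def D_def)
    let ?w = "- \<i> * complex_of_real y"
    have "Im (- 1 / ?w) < 0" using y0 by (simp add: Im_divide power2_eq_square)
    then have "eval_fps g0 (exp (- (2 * of_real pi * \<i> * (fps_nth A\<Psi> 0 + fatou F ?w)))) = Rm (- 1 / ?w) - Rp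
        (- 1 / ?w)"
      using axis(2,3)[of ?w y] y low[of "- 1 / ?w"] by simp
    then have "jump F B D ?w = - eval_fps g0 (exp (- (2 * of_real pi * \<i> * (fps_nth A\<Psi> 0 + fatou F ?w)))) + a"
      using axis(1)[of ?w y] y by simp
    moreover have "exp (- (2 * of_real pi * \<i> * (fps_nth A\<Psi> 0 + fatou F ?w))) = 1 / b * exp (- (2 * of_real
        pi * \<i> * fatou F ?w))"
      by (simp add: b_def exp_minus exp_add exp_diff distrib_left divide_inverse)
    ultimately show "jump (chart_map f) (chart_map (rev_germ f)) (\<lambda>w. eval_fps (abel_rhs f) (- 1 / w)) ?w =
        - eval_fps g0 (1 / b * exp (- (2 * of_real pi * \<i> * fatou (chart_map f) ?w))) + a"
      by (simp only: F_def B_def D_def)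
  qed
qed


text \<open>The parameter s treats both ends of the imaginary axis at once. The sequence provides
  the nonzero points tending to 0 at which germs are compared.\<close>

lemma (in near_translation) fatou_axis:
  fixes s :: complex
  assumes s: "s = \<i> \<or> s = - \<i>" and X: "X \<ge> height_bound"
  defines "t \<equiv> \<lambda>n :: nat. exp (2 * of_real pi * s * fatou F (s * of_real (X + 1 + real n)))"
  shows "t \<longlonglongrightarrow> 0"
proof (rule Lim_null_comparison)
  have "filterlim (\<lambda>n. X + 1 - 3 + real n) at_top sequentially"
    by (intro filterlim_tendsto_add_at_top[OF tendsto_const] filterlim_real_sequentially)
  then have "filterlim (\<lambda>n. - (X + 1 - 3 + real n)) at_bot sequentially"
    unfolding filterlim_uminus_at_bot minus_minus .
  then show "(\<lambda>n. exp (- (X + 1 - 3 + real n))) \<longlonglongrightarrow> 0"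
      by (rule filterlim_compose[OF exp_at_bot])
  have "cmod (t n) \<le> exp (- (X + 1 - 3 + real n))" for n
  proof -
    define y where "y = X + 1 + real n"
    let ?y = y and ?w = "s * of_real y"
    have y: "?y > 0" "?y > height_bound" using X height_bound_pos by (auto simp: y_def)
    have "para ?w > height_bound" using s y by (auto simp: para_def norm_mult)
    then have "cmod (fatou F ?w - ?w) \<le> 3" by (rule fatou_near3)
    then have "cmod (s * (fatou F ?w - ?w)) \<le> 3" using s by (auto simp: norm_mult)
    then have "\<bar>Re (s * (fatou F ?w - ?w))\<bar> \<le> 3" using abs_Re_le_cmod order_trans by blast
    moreover have "Re (s * ?w) = - ?y" using s by auto
    ultimately have "Re (s * fatou F ?w) \<le> - (?y - 3)" by (simp add: algebra_simps) 
    then have "?y - 3 \<le> - Re (s * fatou F ?w)" by simp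
    moreover have "0 \<le> ?y - 3" using y height_bound_ge(1) by simp
    ultimately have "1 * (?y - 3) \<le> (2 * pi) * (- Re (s * fatou F ?w))"
      using pi_gt3 by (intro mult_mono) auto
    moreover have "cmod (t n) = exp ((2 * pi) * Re (s * fatou F ?w))"
      unfolding t_def y_def by (simp add: mult.assoc)
    ultimately show ?thesis by (simp add: y_def algebra_simps)
  qed
  then show "\<forall>\<^sub>F n in sequentially. norm (t n) \<le> exp (- (X + 1 - 3 + real n))" by simp
qed

lemma moment_relI:
  assumes par: "parabolic F B C R"
    and g: "analytic_germ gi" "analytic_germ g0" "analytic_germ qi" "analytic_germ q0" and b: "b \<noteq> 0"
    and up: "\<And>y. y > X \<Longrightarrow> eval_fps qi (exp (2 * of_real pi * \<i> * fatou F (\<i> * of_real y))) =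
        eval_fps gi (b * exp (2 * of_real pi * \<i> * fatou F (\<i> * of_real y))) + a"
    and low: "\<And>y. y > X \<Longrightarrow> eval_fps q0 (exp (- (2 * of_real pi * \<i> * fatou F (- \<i> * of_real
        y)))) =
        eval_fps g0 (1 / b * exp (- (2 * of_real pi * \<i> * fatou F (- \<i> * of_real y)))) - a"
  shows "((qi, q0), (gi, g0)) \<in> moment_rel"
proof -
  interpret parabolic F B C R by (rule par)
  define Z where "Z = max X M0"
  have y: "Z + 1 + real n > X" for n by (auto simp: Z_def)
  have "qi = (gi oo (fps_const b * fps_X)) + fps_const a"
    by (rule germ_eq_scaled[OF g(1,3) fwd.fatou_axis[of \<i> Z] _ up[OF y]]) (simp_all add: Z_def)
  moreover have "q0 = (g0 oo (fps_const (1 / b) * fps_X)) + fps_const (- a)"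
  proof (rule germ_eq_scaled[OF g(2,4) fwd.fatou_axis[of "- \<i>" Z]])
    show "eval_fps q0 (exp (2 * of_real pi * - \<i> * fatou F (- \<i> * of_real (Z + 1 + real n)))) =
        eval_fps g0 (1 / b * exp (2 * of_real pi * - \<i> * fatou F (- \<i> * of_real (Z + 1 + real n)))) + - a" for n
      using low[OF y[of n]] by (simp only: mult_minus_left mult_minus_right add_uminus_conv_diff)
  qed (simp_all add: Z_def)
  then have "q0 = (g0 oo (fps_const (1 / b) * fps_X)) - fps_const a" by (simp flip: fps_const_neg)
  ultimately show ?thesis using b unfolding moment_rel_def mem_Collect_eq case_prod_conv by blast
qed

text \<open>Every pair of f is related to the canonical one, since both describe the same jump on
  the imaginary axis. The 1-moment is thus one class of \<open>moment_rel\<close>, with a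
  representative whose germs both vanish at 0.\<close>

lemma one_moment_canonical:
  assumes f: "f \<in> prenormalized"
  obtains C R M qi q0 where "parabolic (chart_map f) (chart_map (rev_germ f)) C R" "M \<ge>
      near_translation.height_bound C R"
    "analytic_germ qi" "fps_nth qi 0 = 0" "analytic_germ q0" "fps_nth q0 0 = 0"
    "one_moment f = moment_rel `` {(qi, q0)}"
    "\<And>w. Im w > 0 \<Longrightarrow> para w > M \<Longrightarrow> para (- w) > M \<Longrightarrow>
       jump (chart_map f) (chart_map (rev_germ f)) (\<lambda>w. eval_fps (abel_rhs f) (- 1 / w)) w = eval_fps qi (exp
           (2 * of_real pi * \<i> * fatou (chart_map f) w))"
    "\<And>w. Im w < 0 \<Longrightarrow> para w > M \<Longrightarrow> para (- w) > M \<Longrightarrow>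
       jump (chart_map f) (chart_map (rev_germ f)) (\<lambda>w. eval_fps (abel_rhs f) (- 1 / w)) w = - eval_fps q0
           (exp (- (2 * of_real pi * \<i> * fatou (chart_map f) w)))"
proof -
  obtain C R M qi q0 where par: "parabolic (chart_map f) (chart_map (rev_germ f)) C R"
      and M: "M \<ge> near_translation.height_bound C R"
    and q: "analytic_germ qi" "fps_nth qi 0 = 0" "analytic_germ q0" "fps_nth q0 0 = 0"
    and mp: "moment_pair f (qi, q0)"
    and up: "\<And>w. Im w > 0 \<Longrightarrow> para w > M \<Longrightarrow> para (- w) > M \<Longrightarrow>
       jump (chart_map f) (chart_map (rev_germ f)) (\<lambda>w. eval_fps (abel_rhs f) (- 1 / w)) w = eval_fps qi (exp
           (2 * of_real pi * \<i> * fatou (chart_map f) w))"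
    and low: "\<And>w. Im w < 0 \<Longrightarrow> para w > M \<Longrightarrow> para (- w) > M \<Longrightarrow>
       jump (chart_map f) (chart_map (rev_germ f)) (\<lambda>w. eval_fps (abel_rhs f) (- 1 / w)) w = - eval_fps q0
           (exp (- (2 * of_real pi * \<i> * fatou (chart_map f) w)))"
    using moment_pair_canonical[OF f] by metis
  interpret P: parabolic "chart_map f" "chart_map (rev_germ f)" C R by (rule par)
  have Mpos: "M > 0" using M P.fwd.height_bound_pos by linarith
  have para: "para (\<i> * of_real y) > M" "para (- (\<i> * of_real y)) > M" if "y > M" for y
    using that Mpos by (auto simp: para_def norm_mult)
  have rel: "((qi, q0), p) \<in> moment_rel" if p: "moment_pair f p" for p
  proof -
    obtain gi g0 where pp: "p = (gi, g0)" by (cases p)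
    have g: "analytic_germ gi" "analytic_germ g0" using p unfolding moment_pair_def pp by auto
    obtain a b X where b: "b \<noteq> 0"
      and j: "\<And>y. y > X \<Longrightarrow> jump (chart_map f) (chart_map (rev_germ f)) (\<lambda>w. eval_fps
          (abel_rhs f) (- 1 / w)) (\<i> * of_real y) =
        eval_fps gi (b * exp (2 * of_real pi * \<i> * fatou (chart_map f) (\<i> * of_real y))) + a"
       "\<And>y. y > X \<Longrightarrow> jump (chart_map f) (chart_map (rev_germ f)) (\<lambda>w. eval_fps (abel_rhs
           f) (- 1 / w)) (- \<i> * of_real y) =
        - eval_fps g0 (1 / b * exp (- (2 * of_real pi * \<i> * fatou (chart_map f) (- \<i> * of_real y)))) + a"
      by (rule moment_pair_jump[OF f par p[unfolded pp]]) blast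
    show ?thesis unfolding pp
    proof (rule moment_relI[OF par g q(1,3) b, of "max X M" a])
      fix y assume y: "y > max X M"
      then have "y > 0" using Mpos by simp
      then show "eval_fps qi (exp (2 * of_real pi * \<i> * fatou (chart_map f) (\<i> * of_real y))) =
        eval_fps gi (b * exp (2 * of_real pi * \<i> * fatou (chart_map f) (\<i> * of_real y))) + a"
        using j(1)[of y] up[of "\<i> * of_real y"] para[of y] y by simp
      have "- eval_fps q0 (exp (- (2 * of_real pi * \<i> * fatou (chart_map f) (- \<i> * of_real y)))) =
        - eval_fps g0 (1 / b * exp (- (2 * of_real pi * \<i> * fatou (chart_map f) (- \<i> * of_real y)))) + a"
        using j(2)[of y] low[of "- \<i> * of_real y"] para[of y] y \<open>y > 0\<close> by simp
      then show "eval_fps q0 (exp (- (2 * of_real pi * \<i> * fatou (chart_map f) (- \<i> * of_real y)))) =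
        eval_fps g0 (1 / b * exp (- (2 * of_real pi * \<i> * fatou (chart_map f) (- \<i> * of_real y)))) - a"
        by algebra
    qed
  qed
  have "one_moment f = moment_rel `` {(qi, q0)}"
  proof (intro set_eqI iffI)
    fix x assume "x \<in> one_moment f"
    then obtain p where "moment_pair f p" "(p, x) \<in> moment_rel" by (auto simp: one_moment_def)
    then show "x \<in> moment_rel `` {(qi, q0)}" using rel moment_rel_trans by blast
  next
    fix x assume "x \<in> moment_rel `` {(qi, q0)}"
    then show "x \<in> one_moment f" using mp by (auto simp: one_moment_def)
  qed
  then show ?thesis using that[OF par M q(1) q(2) q(3) q(4) _ up low] by simp
qed

text \<open>With \<psi> = z + z^2 h the difference - 1 / \<psi> + 1 / z equals h / (1 + z h), which
  tends to h(0). A conjugacy is therefore asymptotically a translation in the chart, by the constant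
  that will shift the Fatou coordinate.\<close>

lemma chart_map_tangent:
  assumes "tangent_to_identity \<psi>"
  obtains c where "((\<lambda>w. chart_map \<psi> w - w) \<longlongrightarrow> c) at_infinity"
proof -
  have \<psi>: "analytic_germ \<psi>" "fps_nth \<psi> 0 = 0" "fps_nth \<psi> 1 = 1" using assms
      by (auto simp: tangent_to_identity_def)
  define h where "h = fps_shift 2 (\<psi> - fps_X)"
  have an: "analytic_germ (\<psi> - fps_X)" by (rule germ_diff(1)[OF \<psi>(1)]) (simp add: analytic_germ_def)
  then have h: "analytic_germ h" by (simp add: h_def analytic_germ_def)
  have "\<psi> = fps_X + fps_X ^ 2 * h"
  proof (rule fps_ext)
    fix n show "fps_nth \<psi> n = fps_nth (fps_X + fps_X ^ 2 * h) n"
    proof (cases "n < 2")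
      case True then show ?thesis using \<psi> by (auto simp: less_2_cases_iff fps_X_power_mult_nth)
    next
      case False
      then obtain m where "n = m + 2" by (metis le_add_diff_inverse2 not_less)
      then show ?thesis by (simp add: h_def fps_X_power_mult_nth)
    qed
  qed
  moreover have "(\<lambda>z. z + z ^ 2 * eval_fps h z) has_fps_expansion (fps_X + fps_X ^ 2 * h)"
    using h by (intro fps_expansion_intros) (simp add: analytic_germ_iff)
  ultimately have "(\<lambda>z. z + z ^ 2 * eval_fps h z) has_fps_expansion \<psi>" by (simp only:)
  then have "\<forall>\<^sub>F z in nhds 0. eval_fps \<psi> z = z + z ^ 2 * eval_fps h z" by (rule germ_expansion(2))
  then have "\<forall>\<^sub>F z in at 0. eval_fps \<psi> z = z + z ^ 2 * eval_fps h z"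
      by (simp add: eventually_nhds_conv_at)
  moreover have c: "(eval_fps h \<longlongrightarrow> fps_nth h 0) (at 0)" using germ_isCont[OF h]
      by (simp add: isCont_def eval_fps_at_0)
  then have l: "((\<lambda>z. 1 + z * eval_fps h z) \<longlongrightarrow> 1 + 0 * fps_nth h 0) (at 0)"
      by (intro tendsto_intros)
  then have "\<forall>\<^sub>F z in at 0. 1 + z * eval_fps h z \<noteq> 0" by (rule tendsto_imp_eventually_ne) simp
  moreover have "\<forall>\<^sub>F z in at (0 :: complex). z \<noteq> 0" by (simp add: eventually_at_filter)
  ultimately have "\<forall>\<^sub>F z in at 0. eval_fps h z / (1 + z * eval_fps h z) = - 1 / eval_fps \<psi> z + 1 / z"
  proof eventually_elim
    case (elim z)
    have "eval_fps \<psi> z = z * (1 + z * eval_fps h z)" using elim(1) by (simp add: power2_eq_square algebra_simps)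
    then show ?case using elim(2,3) by (simp add: divide_simps)
  qed
  moreover have "((\<lambda>z. eval_fps h z / (1 + z * eval_fps h z)) \<longlongrightarrow> fps_nth h 0 / (1 + 0 *
      fps_nth h 0)) (at 0)"
    by (intro tendsto_divide c l) simp
  ultimately have L: "((\<lambda>z. - 1 / eval_fps \<psi> z + 1 / z) \<longlongrightarrow> fps_nth h 0) (at 0)"
    using Lim_transform_eventually by force
  have f: "filterlim (\<lambda>w :: complex. - 1 / w) (at 0) at_infinity"
    unfolding filterlim_at
  proof (intro conjI tendsto_divide_0[OF tendsto_const filterlim_ident])
    have "\<forall>\<^sub>F w in at_infinity. w \<noteq> (0 :: complex)" unfolding eventually_at_infinity
        by (intro exI[of _ 1]) auto
    then show "\<forall>\<^sub>F w in at_infinity. - 1 / w \<in> UNIV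
        \<and> - 1 / w \<noteq> (0 :: complex)" by eventually_elim simp
  qed
  have "((\<lambda>w. - 1 / eval_fps \<psi> (- 1 / w) + 1 / (- 1 / w)) \<longlongrightarrow> fps_nth h 0) at_infinity"
    by (rule filterlim_compose[OF L f])
  then show ?thesis by (intro that[of "fps_nth h 0"]) (simp add: chart_map_def)
qed

text \<open>Additivity of the principal logarithm could fail by a multiple of 2 pi i; the smallness
  conditions keep the imaginary part below 3 < pi.\<close>

lemma Ln_mult_near_1:
  fixes a b c :: complex
  assumes "a \<noteq> 0" "b \<noteq> 0" "c \<noteq> 0" "cmod (Ln a) < 1" "cmod (Ln b) < 1" "cmod (Ln c) < 1"
  shows "Ln (a * b / c) = Ln a + Ln b - Ln c"
proof -
  have "exp (Ln a + Ln b - Ln c) = a * b / c" using assms by (simp add: exp_add exp_diff)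
  moreover have "\<bar>Im (Ln a + Ln b - Ln c)\<bar> < 3"
    using abs_Im_le_cmod[of "Ln a"] abs_Im_le_cmod[of "Ln b"] abs_Im_le_cmod[of "Ln c"] assms by simp
  then have "Ln (exp (Ln a + Ln b - Ln c)) = Ln a + Ln b - Ln c" using pi_gt3 by (intro Ln_exp) auto
  ultimately show ?thesis by simp
qed

text \<open>Conjugating by \<open>\<psi> = log (f / z) - p\<close> turns the cohomological equation of the new germ into
  the one with right-hand side \<open>p\<close>, up to the coboundary of \<open>log (\<psi> / z)\<close>.\<close>
lemma transfer:
  fixes f p :: "complex fps"
  defines "\<psi> \<equiv> log_quot f - p"
  defines "g \<equiv> \<psi> oo (f oo fps_inv \<psi>)"
  assumes f: "f \<in> prenormalized" and p: "analytic_germ p" "fps_nth p 0 = 0" "fps_nth p 1 = 0"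
    and parF: "parabolic (chart_map f) (chart_map (rev_germ f)) C R0"
  shows "g \<in> analytic_class f"
    and "parabolic (chart_map g) (chart_map (rev_germ g)) C' R' \<Longrightarrow>
      \<exists>c X. \<forall>w. Re w = 0 \<and> X < cmod w \<longrightarrow> (\<exists>W. M < para W
          \<and> M < para (- W) \<and> (Im w > 0 \<longrightarrow> Im W > 0)
              \<and> (Im w < 0 \<longrightarrow> Im W < 0) \<and>
        fatou (chart_map g) W = fatou (chart_map f) w + c \<and>
        jump (chart_map g) (chart_map (rev_germ g)) (\<lambda>w. eval_fps (abel_rhs g) (- 1 / w)) W = jump (chart_map
            f) (chart_map (rev_germ f)) (\<lambda>w. eval_fps p (- 1 / w)) w)"
proof -
  note f' = prenormalizedD[OF f] note lf = log_quot[OF f'(1-3)]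
  have \<psi>: "analytic_germ \<psi>" "fps_nth \<psi> 0 = 0" "fps_nth \<psi> 1 = 1" "fps_nth \<psi> 1 \<noteq> 0"
    using germ_diff(1)[OF lf(1) p(1)] lf p f' by (auto simp: \<psi>_def)
  then have tan: "tangent_to_identity \<psi>" by (simp add: tangent_to_identity_def)
  note i = germ_fps_inv[OF \<psi>(1,2,4)] fps_inv_nth_0_1[OF \<psi>(2,3)]
  note lp = log_quot[OF \<psi>(1-3)]
  have tan': "tangent_to_identity (fps_inv \<psi>)" using i by (simp add: tangent_to_identity_def)
  have "fps_inv (fps_inv \<psi>) = \<psi>" by (rule fps_inv_idempotent[OF \<psi>(2,4)])
  then show gc: "g \<in> analytic_class f" unfolding analytic_class_def g_def using tan' by force
  have g: "g \<in> prenormalized" by (rule analytic_class_prenormalized[OF f gc])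
  note g' = prenormalizedD[OF g] note dg = abel_rhs[OF g]
  assume parG: "parabolic (chart_map g) (chart_map (rev_germ g)) C' R'"
  have conj: "g oo \<psi> = \<psi> oo f"
  proof -
    have z: "fps_nth (f oo fps_inv \<psi>) 0 = 0" using f' by simp
    have "g oo \<psi> = \<psi> oo ((f oo fps_inv \<psi>) oo \<psi>)" unfolding g_def
        by (rule fps_compose_assoc[OF \<psi>(2) z, symmetric])
    also have "(f oo fps_inv \<psi>) oo \<psi> = f oo (fps_inv \<psi> oo \<psi>)"
        by (rule fps_compose_assoc[OF \<psi>(2) i(2), symmetric])
    finally show ?thesis by (simp add: fps_inv[OF \<psi>(2,4)])
  qed
  define lq where "lq = log_quot \<psi>"
  have small: "\<forall>\<^sub>F z in nhds 0. cmod (eval_fps q z) < 1"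
      if "analytic_germ q" "fps_nth q 0 = 0" for q :: "complex fps"
    using eventually_compose_filterlim[OF eventually_nhds_in_open[of "ball 0 1"] germ_filterlim[OF that]] by simp
  have inv0: "eval_fps (fps_inv f) 0 = 0" "eval_fps (fps_inv \<psi>) 0 = 0"
    using i fps_inv_nth_0_1[OF f'(2,3)] by (auto simp: eval_fps_at_0)
  \<comment> \<open>By the choice of \<psi> one has log (f / z) - \<psi> = p. Expanding log (\<psi>
    (f z) / \<psi> z) into three logarithms leaves p and the increment of log (\<psi> / z) along
    f.\<close>
  define near where "near = (\<lambda>z. eval_fps g (eval_fps \<psi> z) = eval_fps \<psi> (eval_fps f z) \<and>
     (z \<noteq> 0 \<longrightarrow> eval_fps (abel_rhs g) (eval_fps \<psi> z) = eval_fps p z + eval_fps lq (eval_fps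
         f z) - eval_fps lq z))"
  have "\<forall>\<^sub>F z in nhds 0. near z"
    using germ_compose(2)[OF g'(1) \<psi>(1,2), unfolded conj] germ_compose(2)[OF \<psi>(1) f'(1,2)]
      eventually_germ[OF \<psi>(1,2) dg(4)] lf(2) lp(2) eventually_germ[OF f'(1,2) lp(2)]
      germ_diff(2)[OF lf(1) p(1), folded \<psi>_def] germ_inv_eval(1)[OF f'(1-3)] germ_inv_eval(1)[OF \<psi>(1-3)]
      eventually_germ[OF f'(1,2) germ_inv_eval(1)[OF \<psi>(1-3)]]
      small[OF lf(1,3)] small[OF lp(1,3)] eventually_germ[OF f'(1,2) small[OF lp(1,3)]]
  proof eventually_elim
    case (elim z)
    have c: "eval_fps g (eval_fps \<psi> z) = eval_fps \<psi> (eval_fps f z)" using elim(1,2) by simp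
    have "eval_fps (abel_rhs g) (eval_fps \<psi> z) = eval_fps p z + eval_fps lq (eval_fps f z) - eval_fps lq z" if
        z: "z \<noteq> 0"
    proof -
      have fz: "eval_fps f z \<noteq> 0" using elim(8) inv0(1) z by metis
      have pz: "eval_fps \<psi> z \<noteq> 0" using elim(9) inv0(2) z by metis
      have pfz: "eval_fps \<psi> (eval_fps f z) \<noteq> 0" using elim(10) inv0(2) fz by metis
      define x1 x2 x3 where "x1 = eval_fps f z / z" and "x2 = eval_fps \<psi> (eval_fps f z) / eval_fps f z"
          and "x3 = eval_fps \<psi> z / z"
      have L: "eval_fps (log_quot f) z = Ln x1" "eval_fps lq (eval_fps f z) = Ln x2" "eval_fps lq z = Ln x3"
        using elim(4,5,6) z fz by (auto simp: x1_def x2_def x3_def lq_def)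
      have "Ln (x1 * x2 / x3) = Ln x1 + Ln x2 - Ln x3"
        using z fz pz pfz elim(11,12,13) L by (intro Ln_mult_near_1) (auto simp: x1_def x2_def x3_def lq_def)
      moreover have "x1 * x2 / x3 = eval_fps \<psi> (eval_fps f z) / eval_fps \<psi> z"
        using z fz pz by (simp add: x1_def x2_def x3_def field_simps)
      moreover have "eval_fps (abel_rhs g) (eval_fps \<psi> z) = - eval_fps \<psi> z + Ln (eval_fps \<psi> (eval_fps
          f z) / eval_fps \<psi> z)"
        using elim(3) pz c by simp
      ultimately show ?thesis using elim(7) L by simp
    qed
    then show ?case using c by (simp add: near_def)
  qed
  then obtain X3 where X3: "X3 \<ge> 1" "\<And>w. X3 < cmod w \<Longrightarrow> near (- 1 / w)"
    by (rule eventually_nhds_0_at_infinity) blast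
  \<comment> \<open>T conjugates the chart map of f to that of g.\<close>
  define T where "T = chart_map \<psi>"
  obtain c where c: "((\<lambda>w. T w - w) \<longlongrightarrow> c) at_infinity" unfolding T_def
      using chart_map_tangent[OF tan] by blast
  then obtain X4 where X4: "\<And>w. X4 \<le> cmod w \<Longrightarrow> cmod (T w - w - c) < 1"
    using tendstoD[OF c, of 1] by (auto simp: eventually_at_infinity dist_norm)
  define F B F' B' where "F = chart_map f" and "B = chart_map (rev_germ f)" and "F' = chart_map g"
      and "B' = chart_map (rev_germ g)"
  define R where "R = max (max R0 X3) (max X4 (R' + cmod c + 1))"
  interpret P: parabolic F B C R unfolding F_def B_def by (rule parabolic_mono[OF parF]) (simp add: R_def)
  interpret G: parabolic F' B' C' R' unfolding F'_def B'_def by (rule parG)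
  have Tw: "cmod (T w - w) \<le> cmod c + 1" "R' < cmod (T w)" if "R < cmod w" for w
  proof -
    have "cmod (T w - w - c) < 1" using X4[of w] that by (simp add: R_def)
    then show 1: "cmod (T w - w) \<le> cmod c + 1" using norm_triangle_ineq[of "T w - w - c" c] by simp
    have "cmod w \<le> cmod (T w) + cmod (T w - w)" using norm_triangle_ineq4[of "T w" "T w - w"] by simp
    then show "R' < cmod (T w)" using 1 that by (simp add: R_def)
  qed
  define Dp Dg lam where "Dp = (\<lambda>w. eval_fps p (- 1 / w))" and "Dg = (\<lambda>w. eval_fps (abel_rhs g) (- 1 / w))"
    and "lam = (\<lambda>w. eval_fps lq (- 1 / w))"
  have nr: "near (- 1 / w)" "w \<noteq> 0" if "R < cmod w" for w using X3(1) X3(2)[of w] that by (auto simp: R_def)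
  have TF: "F' (T w) = T (F w)" if "R < cmod w" for w
    using nr[OF that] by (simp add: near_def F'_def T_def F_def chart_map_def)
  have DT: "Dg (T w) = Dp w + (lam (F w) - lam w)" if "R < cmod w" for w
    using nr[OF that] by (simp add: near_def Dg_def Dp_def lam_def T_def F_def chart_map_def)
  have lam0: "(\<lambda>n. lam (x n)) \<longlonglongrightarrow> 0"
      if "filterlim x at_infinity sequentially" for x :: "nat \<Rightarrow> complex"
  proof -
    have "(\<lambda>n. - 1 / x n) \<longlonglongrightarrow> 0" by (rule tendsto_divide_0[OF tendsto_const that])
    then have "(\<lambda>n. eval_fps lq (- 1 / x n)) \<longlonglongrightarrow> eval_fps lq 0"
      by (intro isCont_tendsto_compose[OF germ_isCont]) (use lp in \<open>simp_all add: lq_def\<close>)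
    then show ?thesis using lp by (simp add: lam_def eval_fps_at_0 lq_def)
  qed
  obtain K Y where Y: "\<And>w. Y \<le> cmod w \<Longrightarrow> cmod (Dp w) \<le> K / (cmod w)\<^sup>2"
    unfolding Dp_def using germ_decay[OF p] by metis
  define R2 where "R2 = max R Y"
  interpret P2: parabolic F B C R2 by (rule parabolic_mono[OF P.parabolic_axioms]) (simp add: R2_def)
  have Dp_le: "cmod (Dp w) \<le> K / (cmod w)\<^sup>2" if "R2 < cmod w" for w using Y[of w] that by (simp add: R2_def)
  have RR: "R < cmod w" if "R2 < cmod w" for w using that by (simp add: R2_def)
  \<comment> \<open>The coboundary of \<open>lam\<close> contributes - lam w to the forward sum and
    + lam w to the backward sum, so it cancels in the jump. The Fatou coordinate picks up the limit
    c of T w - w.\<close>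
  have main: "fatou F' (T w) = fatou F w + c \<and> jump F' B' Dg (T w) = jump F B Dp w"
    if w: "para w > P2.M0" "para (- w) > P2.M0" and W: "para (T w) > G.M0" "para (- T w) > G.M0" for w
  proof -
    have gt: "R < cmod ((F ^^ n) w)" for n
      by (rule RR[OF P2.fwd.cmod_gt(1)[OF P2.fwd.para_iter_gt[OF w(1)]]])
    have it: "(F' ^^ n) (T w) = T ((F ^^ n) w)" for n
      by (induction n) (use TF gt in auto)
    have "(\<lambda>n. ((F ^^ n) w - of_nat n) + (T ((F ^^ n) w) - (F ^^ n) w)) \<longlonglongrightarrow> fatou F w + c"
      by (intro tendsto_add P2.fwd.fatou_lim w(1) filterlim_compose[OF c P2.fwd.iter_at_infinity[OF w(1)]])
    moreover have "((F ^^ n) w - of_nat n) + (T ((F ^^ n) w) - (F ^^ n) w) = (F' ^^ n) (T w) - of_nat n" for n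
      by (simp add: it)
    ultimately have 1: "fatou F' (T w) = fatou F w + c"
      using G.fwd.fatou_lim[OF W(1)] LIMSEQ_unique by simp
    have tl: "(\<lambda>n. lam ((F ^^ Suc n) w) - lam ((F ^^ n) w)) sums (0 - lam ((F ^^ 0) w))"
      by (rule telescope_sums[OF lam0[OF P2.fwd.iter_at_infinity[OF w(1)]]])
    have "(\<lambda>n. Dp ((F ^^ n) w) + (lam ((F ^^ Suc n) w) - lam ((F ^^ n) w))) sums (orbit_sum F Dp w + (0 - lam w))"
      using sums_add[OF P2.fwd.orbit_sum_sums[OF P2.decay_fwd[OF Dp_le] w(1)] tl] by simp
    moreover have "Dp ((F ^^ n) w) + (lam ((F ^^ Suc n) w) - lam ((F ^^ n) w)) = Dg ((F' ^^ n) (T w))" for n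
      using DT[OF gt[of n]] by (simp add: it)
    ultimately have 2: "orbit_sum F' Dg (T w) = orbit_sum F Dp w - lam w"
      unfolding orbit_sum_def by (simp add: sums_iff)
    define u where "u = (\<lambda>n. - (B ^^ n) (- w))"
    have ugt: "R2 < cmod (u n)" for n
      unfolding u_def norm_minus_cancel by (rule P2.bwd.cmod_gt(1)[OF P2.bwd.para_iter_gt[OF w(2)]])
    have Fu: "F (u (Suc n)) = u n" for n using P2.FB[of "- u n"] ugt[of n] by (simp add: u_def)
    have itB: "- (B' ^^ n) (- T w) = T (u n)" for n
    proof (induction n)
      case (Suc n)
      have "B' (- F' (T (u (Suc n)))) = - T (u (Suc n))" by (rule G.BF[OF Tw(2)[OF RR[OF ugt]]])
      moreover have "F' (T (u (Suc n))) = T (u n)" using TF[OF RR[OF ugt[of "Suc n"]]] Fu by simp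
      moreover have "- T (u n) = (B' ^^ n) (- T w)" using Suc by (metis minus_minus)
      ultimately show ?case by simp
    qed (simp add: u_def)
    have uinf: "filterlim u at_infinity sequentially"
      using P2.bwd.iter_at_infinity[OF w(2)] unfolding u_def filterlim_at_infinity_conv_norm_at_top norm_minus_cancel .
    have tl: "(\<lambda>n. lam (u n) - lam (u (Suc n))) sums (lam (u 0) - 0)"
      by (rule telescope_sums'[OF lam0[OF uinf]])
    have "(\<lambda>n. Dp (u (Suc n)) + (lam (u n) - lam (u (Suc n)))) sums (orbit_sum B (\<lambda>x. Dp (- B x)) (-
        w) + (lam w - 0))"
      using sums_add[OF P2.bwd.orbit_sum_sums[OF P2.decay_bwd[OF Dp_le] w(2)] tl] by (simp add: u_def)
    moreover have "Dp (u (Suc n)) + (lam (u n) - lam (u (Suc n))) = Dg (- B' ((B' ^^ n) (- T w)))" for n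
      using DT[OF RR[OF ugt[of "Suc n"]]] itB[of "Suc n"] by (simp add: Fu)
    ultimately have 3: "orbit_sum B' (\<lambda>x. Dg (- B' x)) (- T w) = orbit_sum B (\<lambda>x. Dp (- B x)) (- w) + lam w"
      unfolding orbit_sum_def by (simp add: sums_iff)
    show ?thesis using 1 2 3 by (simp add: jump_def)
  qed
  \<comment> \<open>T moves points by at most |c| + 1. Beyond X, imaginary points keep the sign of
    their imaginary part and land in both regions where g is understood.\<close>
  define X where "X = max P2.M0 (max M G.M0 + 2 * cmod c + 2)"
  show "\<exists>c X. \<forall>w. Re w = 0 \<and> X < cmod w \<longrightarrow> (\<exists>W. M < para W
      \<and> M < para (- W) \<and> (Im w > 0 \<longrightarrow> Im W > 0) \<and> (Im w < 0 \<longrightarrow> Im W < 0) \<and>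
        fatou (chart_map g) W = fatou (chart_map f) w + c \<and>
        jump (chart_map g) (chart_map (rev_germ g)) (\<lambda>w. eval_fps (abel_rhs g) (- 1 / w)) W = jump (chart_map
            f) (chart_map (rev_germ f)) (\<lambda>w. eval_fps p (- 1 / w)) w)"
  proof (intro exI allI impI)
    fix w :: complex assume w: "Re w = 0 \<and> X < cmod w"
    have pw: "para w > P2.M0" "para (- w) > P2.M0" using w by (auto simp: para_def X_def)
    have "R < cmod w" by (rule RR[OF P2.fwd.cmod_gt(1)[OF pw(1)]])
    note t = Tw(1)[OF this]
    have re: "\<bar>Re (T w)\<bar> \<le> cmod c + 1" using t abs_Re_le_cmod[of "T w - w"] w by simp
    have im: "\<bar>Im (T w) - Im w\<bar> \<le> cmod c + 1" using t abs_Im_le_cmod[of "T w - w"] by simp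
    have nm: "cmod (T w) \<ge> cmod w - (cmod c + 1)" using t norm_triangle_ineq4[of "T w" "T w - w"] by simp
    have "\<bar>Im w\<bar> = cmod w" using w by (simp add: cmod_def)
    have big: "cmod w > M + 2 * cmod c + 2" "cmod w > G.M0 + 2 * cmod c + 2" using w by (auto simp: X_def)
    have pW: "M < para (T w)" "M < para (- T w)" "G.M0 < para (T w)" "G.M0 < para (- T w)"
      using re nm big unfolding para_def by auto
    have ims: "Im w > 0 \<Longrightarrow> Im (T w) > 0" "Im w < 0 \<Longrightarrow> Im (T w) < 0"
      using im big(2) \<open>\<bar>Im w\<bar> = cmod w\<close> G.fwd.height_bound_pos by (smt (verit) norm_ge_zero)+
    show "M < para (T w) \<and> M < para (- T w) \<and> (Im w > 0 \<longrightarrow> Im (T w) > 0)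
        \<and> (Im w < 0 \<longrightarrow> Im (T w) < 0) \<and>
        fatou (chart_map g) (T w) = fatou (chart_map f) w + c \<and>
        jump (chart_map g) (chart_map (rev_germ g)) (\<lambda>w. eval_fps (abel_rhs g) (- 1 / w)) (T w) = jump
            (chart_map f) (chart_map (rev_germ f)) (\<lambda>w. eval_fps p (- 1 / w)) w"
      using main[OF pw pW(3,4)] pW(1,2) ims by (simp add: F_def B_def F'_def B'_def Dp_def Dg_def)
  qed
qed

text \<open>The canonical pair of h is imposed as a jump over f and transferred to the conjugate g.
  The translation c between the Fatou coordinates of f and g then appears as the factor b = exp (2
  pi i c) of \<open>moment_rel\<close>, with a = 0.\<close>

lemma moment_realized:
  assumes f: "f \<in> prenormalized" and h: "h \<in> prenormalized"
  obtains g where "g \<in> analytic_class f" "one_moment g = one_moment h"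
proof -
  obtain qi q0 where q: "analytic_germ qi" "fps_nth qi 0 = 0" "analytic_germ q0" "fps_nth q0 0 = 0"
    and mh: "one_moment h = moment_rel `` {(qi, q0)}"
    using one_moment_canonical[OF h] by metis
  obtain C R where par: "parabolic (chart_map f) (chart_map (rev_germ f)) C R" using chart_map_parabolic[OF f] .
  obtain p X where p: "analytic_germ p" "fps_nth p 0 = 0" "fps_nth p 1 = 0"
    and j: "\<And>y. y > X \<Longrightarrow> jump (chart_map f) (chart_map (rev_germ f)) (\<lambda>w. eval_fps p (- 1
        / w)) (\<i> * of_real y) =
        eval_fps qi (exp (2 * of_real pi * \<i> * fatou (chart_map f) (\<i> * of_real y)))"
      "\<And>y. y > X \<Longrightarrow> jump (chart_map f) (chart_map (rev_germ f)) (\<lambda>w. eval_fps p (- 1 /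
          w)) (- \<i> * of_real y) =
        - eval_fps q0 (exp (- (2 * of_real pi * \<i> * fatou (chart_map f) (- \<i> * of_real y))))"
    by (rule parabolic.realize[OF par q]) blast
  define \<psi> g where "\<psi> = log_quot f - p" and "g = \<psi> oo (f oo fps_inv \<psi>)"
  note tr = transfer[OF f p par, folded \<psi>_def, folded g_def]
  have g: "g \<in> prenormalized" by (rule analytic_class_prenormalized[OF f tr(1)])
  obtain C' R' M ri r0 where parG: "parabolic (chart_map g) (chart_map (rev_germ g)) C' R'"
    and r: "analytic_germ ri" "analytic_germ r0" and mg: "one_moment g = moment_rel `` {(ri, r0)}"
    and up: "\<And>w. Im w > 0 \<Longrightarrow> para w > M \<Longrightarrow> para (- w) > M \<Longrightarrow>
       jump (chart_map g) (chart_map (rev_germ g)) (\<lambda>w. eval_fps (abel_rhs g) (- 1 / w)) w = eval_fps ri (exp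
           (2 * of_real pi * \<i> * fatou (chart_map g) w))"
    and low: "\<And>w. Im w < 0 \<Longrightarrow> para w > M \<Longrightarrow> para (- w) > M \<Longrightarrow>
       jump (chart_map g) (chart_map (rev_germ g)) (\<lambda>w. eval_fps (abel_rhs g) (- 1 / w)) w = - eval_fps r0
           (exp (- (2 * of_real pi * \<i> * fatou (chart_map g) w)))"
    using one_moment_canonical[OF g] by metis
  obtain c Z where cZ: "\<And>w. Re w = 0 \<Longrightarrow> Z < cmod w \<Longrightarrow>
      \<exists>W. M < para W \<and> M < para (- W) \<and> (Im w > 0 \<longrightarrow> Im W > 0)
          \<and> (Im w < 0 \<longrightarrow> Im W < 0) \<and>
        fatou (chart_map g) W = fatou (chart_map f) w + c \<and>
        jump (chart_map g) (chart_map (rev_germ g)) (\<lambda>w. eval_fps (abel_rhs g) (- 1 / w)) W = jump (chart_map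
            f) (chart_map (rev_germ f)) (\<lambda>w. eval_fps p (- 1 / w)) w"
    using tr(2)[OF parG, of M] by blast
  define b where "b = exp (2 * of_real pi * \<i> * c)"
  have "((qi, q0), (ri, r0)) \<in> moment_rel"
  proof (rule moment_relI[OF par r q(1,3), of b "max X (max Z 0)" 0])
    show "b \<noteq> 0" by (simp add: b_def)
    fix y assume y: "y > max X (max Z 0)"
    {
      let ?w = "\<i> * complex_of_real y"
      obtain W where W: "M < para W" "M < para (- W)" "Im W > 0" "fatou (chart_map g) W = fatou (chart_map f) ?w + c"
        "jump (chart_map g) (chart_map (rev_germ g)) (\<lambda>w. eval_fps (abel_rhs g) (- 1 / w)) W = jump
            (chart_map f) (chart_map (rev_germ f)) (\<lambda>w. eval_fps p (- 1 / w)) ?w"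
        using cZ[of ?w] y by (auto simp: norm_mult)
      have "exp (2 * of_real pi * \<i> * fatou (chart_map g) W) = b * exp (2 * of_real pi * \<i> * fatou (chart_map f) ?w)"
        by (simp add: W(4) b_def exp_add distrib_left)
      then show "eval_fps qi (exp (2 * of_real pi * \<i> * fatou (chart_map f) ?w)) =
        eval_fps ri (b * exp (2 * of_real pi * \<i> * fatou (chart_map f) ?w)) + 0"
        using up[OF W(3,1,2)] W(5) j(1)[of y] y by simp
    }
    {
      let ?w = "- \<i> * complex_of_real y"
      obtain W where W: "M < para W" "M < para (- W)" "Im W < 0" "fatou (chart_map g) W = fatou (chart_map f) ?w + c"
        "jump (chart_map g) (chart_map (rev_germ g)) (\<lambda>w. eval_fps (abel_rhs g) (- 1 / w)) W = jump
            (chart_map f) (chart_map (rev_germ f)) (\<lambda>w. eval_fps p (- 1 / w)) ?w"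
        using cZ[of ?w] y by (auto simp: norm_mult)
      have "exp (- (2 * of_real pi * \<i> * fatou (chart_map g) W)) = 1 / b * exp (- (2 * of_real pi * \<i> * fatou
          (chart_map f) ?w))"
        unfolding W(4) by (simp add: b_def exp_minus exp_add exp_diff distrib_left divide_inverse)
      then show "eval_fps q0 (exp (- (2 * of_real pi * \<i> * fatou (chart_map f) ?w))) =
        eval_fps r0 (1 / b * exp (- (2 * of_real pi * \<i> * fatou (chart_map f) ?w))) - 0"
        using low[OF W(3,1,2)] W(5) j(2)[of y] y by simp
    }
  qed
  then have "one_moment g = one_moment h"
    unfolding mg mh using moment_rel_sym moment_rel_trans by blast
  then show ?thesis using that tr(1) by blast
qed

theorem theorem4:
  fixes f :: "complex fps"
  assumes "f \<in> prenormalized"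
  shows "one_conjugacy_class ` analytic_class f = prenormalized // one_conjugacy"
proof (intro equalityI subsetI)
  fix x assume "x \<in> one_conjugacy_class ` analytic_class f"
  then obtain g where "g \<in> analytic_class f" "x = one_conjugacy `` {g}" by (auto simp: one_conjugacy_class_def)
  then show "x \<in> prenormalized // one_conjugacy"
    using analytic_class_prenormalized[OF assms] by (auto intro: quotientI)
next
  fix x assume "x \<in> prenormalized // one_conjugacy"
  then obtain h where h: "h \<in> prenormalized" "x = one_conjugacy `` {h}" by (auto elim: quotientE)
  obtain g where g: "g \<in> analytic_class f" "one_moment g = one_moment h" using moment_realized[OF assms h(1)] .
  have "g \<in> prenormalized" by (rule analytic_class_prenormalized[OF assms g(1)])
  then have "one_conjugacy_class g = x"
    using g(2) h by (auto simp: one_conjugacy_class_def one_conjugacy_def)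
  then show "x \<in> one_conjugacy_class ` analytic_class f" using g(1) by blast
qed

end
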